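(* Let $d\ge 5$, and let $l_\infty$ and $\tilde l_\infty$ be the infinite-time local times of two independent aperiodic simple random walks on $\mathbb{Z}^d$, both started at $0$. For a positive integer $n$ let $\mathcal{L}(n)=\{z\in\mathbb{Z}^d:\ l_\infty(z)=n\}$ and $\tilde{\mathcal{L}}(n)=\{z\in\mathbb{Z}^d:\ \tilde l_\infty(z)=n\}$. Let $(n_L)_{L\ge1}$ and $(m_L)_{L\ge1}$ be sequences of positive integers such that $\max(n_L,m_L)\gg L^{d/2}$ as $L\to\infty$. Then for every $\epsilon>0$, $$\lim_{L\to\infty}\mathbb{P}\Big(\mathrm{cap}\big(\mathcal{L}(n_L)\cap\tilde{\mathcal{L}}(m_L)\big)\ge L^{1-\frac{2}{d}+\epsilon}\ \Big|\ \big|\mathcal{L}(n_L)\cap\tilde{\mathcal{L}}(m_L)\big|\ge L\Big)=0.$$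
   Context: The aperiodic simple random walk on $\mathbb{Z}^d$ is the Markov chain for which, given $S_n$, the position $S_{n+1}$ is uniform on the $2d+1$ sites $\{z\in\mathbb{Z}^d:\ |z-S_n|\le 1\}$, where $|z|=|z_1|+\dots+|z_d|$; $P_x$ is its law when $S_0=x$. $(S_n)$ and $(\tilde S_n)$ are two independent such walks started at $0$, and $\mathbb{P}=P_0\otimes\tilde P_0$ is their joint law. Local times: $l_\infty(z)=\sum_{k=0}^\infty\mathbf{1}\{S_k=z\}$ and $\tilde l_\infty(z)=\sum_{k=0}^\infty\mathbf{1}\{\tilde S_k=z\}$. For a finite set $\Lambda\subset\mathbb{Z}^d$, $\mathrm{cap}(\Lambda)=\sum_{z\in\Lambda}P_z(T_\Lambda=\infty)$ with $T_\Lambda=\inf\{n>0:\ S_n\in\Lambda\}$. The notation $a_L\gg b_L$ means $a_L/b_L\to\infty$ as $L\to\infty$. *)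

theory Defs
  imports "HOL-Probability.Probability"
begin

definition l1_norm :: "int ^ 'd::finite \<Rightarrow> int" where
  "l1_norm z = (\<Sum>i\<in>UNIV. \<bar>z $ i\<bar>)"

definition nbhd :: "int ^ 'd::finite \<Rightarrow> (int ^ 'd) set" where
  "nbhd x = {z. l1_norm (z - x) \<le> 1}"

lemma nbhd_eq:
  fixes x :: "int ^ 'd::finite"
  shows "nbhd x = insert x ((\<lambda>(i, s). x + axis i s) ` (UNIV \<times> {1, -1}))" (is "_ = ?B")
proof
  show "?B \<subseteq> nbhd x"
    by (auto simp: nbhd_def l1_norm_def axis_def if_distrib[of abs] cong: if_cong)
  show "nbhd x \<subseteq> ?B"
  proof
    fix z assume "z \<in> nbhd x"
    then have le: "(\<Sum>i\<in>UNIV. \<bar>(z - x) $ i\<bar>) \<le> 1"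
      by (simp add: nbhd_def l1_norm_def)
    show "z \<in> ?B"
    proof (cases "z = x")
      case False
      then obtain j where j: "(z - x) $ j \<noteq> 0"
        by (auto simp: vec_eq_iff)
      have eq: "(\<Sum>i\<in>UNIV. \<bar>(z - x) $ i\<bar>) = \<bar>(z - x) $ j\<bar> + (\<Sum>i\<in>UNIV - {j}. \<bar>(z - x) $ i\<bar>)"
        by (rule sum.remove) auto
      moreover have "0 \<le> (\<Sum>i\<in>UNIV - {j}. \<bar>(z - x) $ i\<bar>)"
        by (rule sum_nonneg) auto
      ultimately have "\<bar>(z - x) $ j\<bar> = 1" and 0: "(\<Sum>i\<in>UNIV - {j}. \<bar>(z - x) $ i\<bar>) = 0"
        using le j by linarith+
      then have j1: "(z - x) $ j \<in> {1, -1}" by auto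
      have "\<forall>i\<in>UNIV - {j}. \<bar>(z - x) $ i\<bar> = 0"
        using 0 by (subst (asm) sum_nonneg_eq_0_iff) auto
      then have "z = x + axis j ((z - x) $ j)"
        by (auto simp: vec_eq_iff axis_def)
      with j1 show ?thesis
        by (metis (mono_tags, lifting) SigmaI UNIV_I case_prod_conv image_eqI insertCI)
    qed simp
  qed
qed

lemma finite_nbhd [simp, intro]: "finite (nbhd x)"
  by (simp add: nbhd_eq)

lemma nbhd_nonempty [simp]: "nbhd x \<noteq> {}"
  by (simp add: nbhd_eq)

lemma card_nbhd: "card (nbhd (x :: int ^ 'd::finite)) = 2 * CARD('d) + 1"
proof -
  have "inj_on (\<lambda>(i, s). x + axis i s) (UNIV \<times> {1, -1 :: int})"
    by (auto simp: inj_on_def axis_eq_axis)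
  then have "card ((\<lambda>(i, s). x + axis i s) ` (UNIV \<times> {1, -1 :: int})) = 2 * CARD('d)"
    by (subst card_image) (auto simp: card_cartesian_product)
  moreover have "x \<notin> (\<lambda>(i, s). x + axis i s) ` (UNIV \<times> {1, -1 :: int})"
    by (auto simp: axis_eq_0_iff)
  ultimately show ?thesis
    by (simp add: nbhd_eq)
qed

(* The law of S_i conditionally on the past (S_0, ..., S_(i-1)), for the walk with S_0 = x. *)
definition walk_kernel ::
    "int ^ 'd::finite \<Rightarrow> nat \<Rightarrow> (nat \<Rightarrow> int ^ 'd) \<Rightarrow> (int ^ 'd) measure" where
  "walk_kernel x i S =
     (case i of 0 \<Rightarrow> return (count_space UNIV) x
              | Suc n \<Rightarrow> measure_pmf (pmf_of_set (nbhd (S n))))"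

lemma Ionescu_Tulcea_walk: "Ionescu_Tulcea (walk_kernel x) (\<lambda>_. count_space UNIV)"
  for x :: "int ^ 'd::finite"
proof (rule Ionescu_Tulcea.intro)
  fix i :: nat
  show "walk_kernel x i \<in>
      measurable (PiM {0..<i} (\<lambda>_. count_space UNIV)) (subprob_algebra (count_space UNIV))"
  proof (cases i)
    case 0
    have "(\<lambda>S :: nat \<Rightarrow> int ^ 'd. return (count_space UNIV) x) \<in>
        measurable (PiM {0..<i} (\<lambda>_. count_space UNIV)) (subprob_algebra (count_space UNIV))"
      by (intro measurable_const)
         (auto simp: space_subprob_algebra intro!: prob_space_imp_subprob_space prob_space_return)
    then show ?thesis
      by (simp add: walk_kernel_def[abs_def] 0)
  next
    case (Suc n)
    have "(\<lambda>S. S n) \<in>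
        measurable (PiM {0..<i} (\<lambda>_. count_space UNIV)) (count_space (UNIV :: (int ^ 'd) set))"
      using Suc by (intro measurable_component_singleton) auto
    moreover have "(\<lambda>y :: int ^ 'd. measure_pmf (pmf_of_set (nbhd y))) \<in>
        measurable (count_space UNIV) (subprob_algebra (count_space UNIV))"
      by (auto simp: space_subprob_algebra intro: measure_pmf.subprob_space_axioms)
    ultimately have "(\<lambda>S. measure_pmf (pmf_of_set (nbhd (S n)))) \<in>
        measurable (PiM {0..<i} (\<lambda>_. count_space (UNIV :: (int ^ 'd) set)))
          (subprob_algebra (count_space UNIV))"
      by (rule measurable_compose)
    then show ?thesis
      by (simp add: walk_kernel_def[abs_def] Suc)
  qed
next
  fix i and S :: "nat \<Rightarrow> int ^ 'd"
  show "prob_space (walk_kernel x i S)"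
    by (auto simp: walk_kernel_def prob_space_return measure_pmf.prob_space_axioms split: nat.split)
qed

(* P_x: the Ionescu-Tulcea measure on trajectories determined by walk_kernel x. *)
definition walk_law :: "int ^ 'd::finite \<Rightarrow> (nat \<Rightarrow> int ^ 'd) measure" where
  "walk_law x = projective_family.lim UNIV
     (Ionescu_Tulcea.CI (walk_kernel x) (\<lambda>_. count_space UNIV)) (\<lambda>_. count_space UNIV)"

lemma sets_walk_law: "sets (walk_law x) = sets (PiM UNIV (\<lambda>_. count_space UNIV))"
proof -
  interpret Ionescu_Tulcea "walk_kernel x" "\<lambda>_. count_space UNIV"
    by (rule Ionescu_Tulcea_walk)
  show ?thesis by (simp add: walk_law_def)
qed

lemma space_walk_law [simp]: "space (walk_law x) = UNIV"
  by (simp add: sets_eq_imp_space_eq[OF sets_walk_law] space_PiM)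

lemma emeasure_walk_law_cylinder:
  "emeasure (walk_law x) {S. \<forall>i\<le>n. S i = s i} =
     (if s 0 = x \<and> (\<forall>i<n. s (Suc i) \<in> nbhd (s i)) then 1 / (2 * CARD('d) + 1) ^ n else 0)"
  for x :: "int ^ 'd::finite"
proof -
  let ?M = "\<lambda>_. count_space UNIV :: (int ^ 'd) measure"
  interpret Ionescu_Tulcea "walk_kernel x" ?M
    by (rule Ionescu_Tulcea_walk)
  let ?r = "\<lambda>m. restrict s {0..<m}"
  have r_sets [measurable]: "{?r m} \<in> sets (PiM {0..<m} ?M)" for m
  proof -
    have "{?r m} = PiE {0..<m} (\<lambda>i. {s i})"
      by (auto simp: PiE_iff fun_eq_iff restrict_def extensional_def)
    then show ?thesis by (simp add: sets_PiM_I_finite)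
  qed
  have step: "emeasure (C 0 (Suc m) (\<lambda>_. undefined)) {?r (Suc m)} =
      emeasure (C 0 m (\<lambda>_. undefined)) {?r m} * emeasure (walk_kernel x m (?r m)) {s m}" for m
  proof -
    have sp: "space (C 0 m (\<lambda>_. undefined)) = space (PiM {0..<m} ?M)"
      by (subst space_C) auto
    have meas: "eP m \<in> measurable (C 0 m (\<lambda>_. undefined)) (subprob_algebra (PiM {0..<Suc m} ?M))"
      using measurable_eP[of m] sets_C[of "\<lambda>_. undefined" 0 m]
      by (simp cong: measurable_cong_sets)
    have "emeasure (C 0 (Suc m) (\<lambda>_. undefined)) {?r (Suc m)} =
        (\<integral>\<^sup>+\<omega>. emeasure (eP m \<omega>) {?r (Suc m)} \<partial>C 0 m (\<lambda>_. undefined))"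
      using sp PiE_empty_domain
      by (simp add: emeasure_bind[OF _ meas r_sets] sp)
    also have "\<dots> = (\<integral>\<^sup>+\<omega>. emeasure (walk_kernel x m (?r m)) {s m} * indicator {?r m} \<omega> \<partial>C 0 m (\<lambda>_. undefined))"
    proof (rule nn_integral_cong)
      fix \<omega> assume "\<omega> \<in> space (C 0 m (\<lambda>_. undefined))"
      then have \<omega>: "\<omega> \<in> space (PiM {0..<m} ?M)" by (simp add: sp)
      have ext: "\<omega> \<in> extensional {0..<m}" using \<omega> by (simp add: space_PiM PiE_def)
      have "{y. fun_upd \<omega> m y = ?r (Suc m)} = (if \<omega> = ?r m then {s m} else {})"
      proof -
        have "fun_upd \<omega> m y = ?r (Suc m) \<longleftrightarrow> \<omega> = ?r m \<and> y = s m" for y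
        proof
          assume a: "fun_upd \<omega> m y = ?r (Suc m)"
          have "\<omega> i = ?r m i" for i
            using fun_cong[OF a, of i] extensional_arb[OF ext, of i]
            by (cases "i < m") (auto split: if_splits)
          moreover have "y = s m" using fun_cong[OF a, of m] by simp
          ultimately show "\<omega> = ?r m \<and> y = s m" by auto
        next
          assume "\<omega> = ?r m \<and> y = s m"
          then show "fun_upd \<omega> m y = ?r (Suc m)" by (auto simp: fun_eq_iff)
        qed
        then show ?thesis by auto
      qed
      then show "emeasure (eP m \<omega>) {?r (Suc m)} =
          emeasure (walk_kernel x m (?r m)) {s m} * indicator {?r m} \<omega>"
        by (subst emeasure_eP[OF \<omega> r_sets]) (auto simp: vimage_def)
    qed
    also have "\<dots> = emeasure (walk_kernel x m (?r m)) {s m} * emeasure (C 0 m (\<lambda>_. undefined)) {?r m}"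
      by (rule nn_integral_cmult_indicator) (subst sets_C, auto)
    finally show ?thesis by (simp add: mult.commute)
  qed
  have "emeasure (C 0 (Suc n) (\<lambda>_. undefined)) {?r (Suc n)} =
     (if s 0 = x \<and> (\<forall>i<n. s (Suc i) \<in> nbhd (s i)) then 1 / (2 * CARD('d) + 1) ^ n else 0)"
  proof (induction n)
    case 0
    show ?case
      using r_sets[of 0] by (subst step) (auto simp: walk_kernel_def restrict_def)
  next
    case (Suc n)
    show ?case
    proof -
      have "emeasure (walk_kernel x (Suc n) (?r (Suc n))) {s (Suc n)} =
          (if s (Suc n) \<in> nbhd (s n) then 1 / (2 * CARD('d) + 1) else 0)"
        by (simp add: walk_kernel_def emeasure_pmf_single card_nbhd)
      then show ?thesis
        by (subst step, subst Suc.IH)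
           (auto simp: less_Suc_eq field_simps simp flip: ennreal_mult')
    qed
  qed
  moreover have "{S. \<forall>i\<le>n. S i = s i} = prod_emb UNIV ?M {0..<Suc n} {?r (Suc n)}"
  proof -
    have "restrict S {0..<Suc n} = ?r (Suc n) \<longleftrightarrow> (\<forall>i\<le>n. S i = s i)" for S
      using restrict_ext[of "{0..<Suc n}" S s] by (auto simp: less_Suc_eq_le dest: fun_cong[where x = i for i])
         (metis atLeastLessThan_iff le0 le_imp_less_Suc restrict_apply')
    then show ?thesis
      by (auto simp: prod_emb_def space_PiM)
  qed
  moreover have "prod_emb {0..<Suc n} ?M {0..<Suc n} {?r (Suc n)} = {?r (Suc n)}"
    by (rule prod_emb_id) (auto simp: PiE_iff)
  ultimately show ?thesis
    unfolding walk_law_def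
    by (simp add: lim emeasure_CI[of "{0..<Suc n}" "Suc n"] del: C.simps)
qed

lemma prob_space_walk_law: "prob_space (walk_law x)"
proof -
  interpret Ionescu_Tulcea "walk_kernel x" "\<lambda>_. count_space UNIV"
    by (rule Ionescu_Tulcea_walk)
  interpret E: prob_space "CI {}"
    by (rule PF.prob_space_P) auto
  have "emeasure (walk_law x) (prod_emb UNIV (\<lambda>_. count_space UNIV) {} (space (CI {}))) =
      emeasure (CI {}) (space (CI {}))"
    unfolding walk_law_def by (rule lim) (auto simp: PF.space_P)
  also have "prod_emb UNIV (\<lambda>_. count_space UNIV) {} (space (CI {})) = space (walk_law x)"
    by (auto simp: prod_emb_def PF.space_P space_PiM)
  finally show ?thesis
    by (auto intro!: prob_spaceI simp: E.emeasure_space_1)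
qed

definition local_time :: "(nat \<Rightarrow> int ^ 'd::finite) \<Rightarrow> int ^ 'd \<Rightarrow> ennreal" where
  "local_time S z = (\<Sum>k. indicator {z} (S k))"

definition level_set :: "(nat \<Rightarrow> int ^ 'd::finite) \<Rightarrow> nat \<Rightarrow> (int ^ 'd) set" where
  "level_set S n = {z. local_time S z = of_nat n}"

(* Inf {} is \<infinity> in enat, so the value is \<infinity> if there is no return to A. *)
definition return_time :: "(int ^ 'd::finite) set \<Rightarrow> (nat \<Rightarrow> int ^ 'd) \<Rightarrow> enat" where
  "return_time A S = Inf (enat ` {n. 0 < n \<and> S n \<in> A})"

(* Meant for finite A only: on infinite A the sum is 0. The same holds for card. For d at least 5
   the ranges of two independent walks have almost surely finite intersection. *)
definition capacity :: "(int ^ 'd::finite) set \<Rightarrow> real" where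
  "capacity A = (\<Sum>z\<in>A. \<P>(S in walk_law z. return_time A S = \<infinity>))"

end

(*
  Write N for the larger of n_L and m_L. If each point of a finite set A is visited exactly N times,
  then all visits but the last one fail to escape from A, so this has probability at most
  C exp(-N cap A). For the union bound over A, interpolate this with the probability that A is
  covered by the walk: the Green function is in l^p for some p < 2 when d >= 5, so the p-th powers of
  the covering probabilities, summed over all A of size k, are at most (k!)^2 times a k-th power; one
  of the two walks contributes a full power, the other one the power p - 1. Since cap A >= c sqrt |A|, sets of size about cap(A)^2 suffice,
  and the numerator is at most exp(-c N L^(1-2/d+eps)).

  For the denominator, take for A a cube of side about L^(1/d) in the sublattice (1+2Z)^d, whose
  capacity is of order L^(1-2/d) and whose points are joined by paths avoiding A. The walk observed
  on A is a symmetric chain Q with killing e; adding e to the diagonal gives a doubly stochastic chain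
  q, and dQ/dq >= exp(-C N e(A)) on trajectories that spend at most N units of time in each point.
  By a variance bound q spends almost equal time everywhere, and the deficit of order N^(1/2) at each
  point is corrected deterministically at a cost that is negligible because N >> L^(d/2).
  So the denominator is at least exp(-C N L^(1-2/d)).
*)
theory Submission
  imports Defs
begin

text \<open>Only terms of order N L^(1-2/d) may survive in the exponents, and two errors compete
  with them. In the numerator it is entropy: sets of about a^2 points placed anywhere cost exp(C
  a^4), and with a just above L^(1-2/d) this a^4 stays below N L^(1-2/d) because N is at least
  L^(d/2). In the denominator it is fluctuation: with s = L^(1/d), K = s^d points and \<rho> of
  order s^2, the deficit per point is about sqrt(\<rho> K N), and K such deficits are of order at
  most N s^(d-2) as soon as s^(d+6) is of order at most N; this holds since (d+6)/d is at most d/2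
  for d >= 5. The shape of A comes from the need to hit every count exactly. A missing visit is made
  up by holding, but the chain must then move on without touching other points of A, so Q needs a
  positive link between any two points. In a full cube an inner point leads only to itself and its
  neighbours; the even hyperplanes between the odd points give room to pass. The links may be as
  small as exp(-C s), since about one per point is used.\<close>

type_synonym 'd path = "nat \<Rightarrow> int ^ 'd"

section \<open>The Markov property of the walk law\<close>

lemma sum_nbhd:
  fixes f :: "int ^ 'd::finite \<Rightarrow> 'b::comm_monoid_add"
  shows "(\<Sum>y\<in>nbhd x. f y) = f x + (\<Sum>i\<in>UNIV. f (x + axis i 1) + f (x - axis i 1))"
proof -
  have inj: "inj_on (\<lambda>(i, s). x + axis i s) (UNIV \<times> {1, -1 :: int})"
    by (auto simp: inj_on_def axis_eq_axis)
  have "x \<notin> (\<lambda>(i, s). x + axis i s) ` (UNIV \<times> {1, -1 :: int})"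
    by (auto simp: axis_eq_0_iff)
  then have "(\<Sum>y\<in>nbhd x. f y) = f x + (\<Sum>y\<in>(\<lambda>(i, s). x + axis i s) ` (UNIV \<times> {1, -1 :: int}). f y)"
    by (simp add: nbhd_eq)
  also have "(\<Sum>y\<in>(\<lambda>(i, s). x + axis i s) ` (UNIV \<times> {1, -1 :: int}). f y) =
      (\<Sum>(i, s)\<in>UNIV \<times> {1, -1 :: int}. f (x + axis i s))"
    by (subst sum.reindex[OF inj]) (simp add: case_prod_unfold)
  also have "\<dots> = (\<Sum>i\<in>UNIV. \<Sum>s\<in>{1, -1 :: int}. f (x + axis i s))"
    by (rule sum.cartesian_product[symmetric])
  also have "\<dots> = (\<Sum>i\<in>UNIV. f (x + axis i 1) + f (x - axis i 1))"
  proof (rule sum.cong[OF refl])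
    fix i :: 'd
    have "axis i (-1::int) = - axis i 1" by (simp add: vec_eq_iff axis_def)
    then show "(\<Sum>s\<in>{1, -1 :: int}. f (x + axis i s)) = f (x + axis i 1) + f (x - axis i 1)"
      by simp
  qed
  finally show ?thesis .
qed

lemma nbhd_sym: "y \<in> nbhd x \<longleftrightarrow> x \<in> nbhd y"
proof -
  have "l1_norm (y - x) = l1_norm (x - y)" for x y :: "int ^ 'd::finite"
    by (simp add: l1_norm_def abs_minus_commute)
  from this[of y x] show ?thesis by (simp add: nbhd_def)
qed

lemma self_in_nbhd [simp]: "x \<in> nbhd x"
  by (simp add: nbhd_def l1_norm_def)

abbreviation step_prob :: "'d::finite itself \<Rightarrow> real" where
  "step_prob _ \<equiv> 1 / (2 * real CARD('d) + 1)"

abbreviation traj :: "'d::finite path measure" where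
  "traj \<equiv> PiM UNIV (\<lambda>_. count_space UNIV)"

lemma space_traj [simp]: "space traj = UNIV"
  by (simp add: space_PiM)

declare sets_walk_law [measurable_cong]

lemma sets_coord [measurable]: "{S :: 'd::finite path. S i \<in> A} \<in> sets traj"
proof -
  have "(\<lambda>S :: 'd path. S i) \<in> measurable traj (count_space UNIV)"
    by (rule measurable_component_singleton) simp
  from measurable_sets[OF this, of A] show ?thesis by (simp add: vimage_def)
qed

lemma sets_cylinder [measurable]: "{S :: 'd::finite path. \<forall>i\<le>n. S i = s i} \<in> sets traj"
proof -
  have "{S :: 'd path. \<forall>i\<le>n. S i = s i} = (\<Inter>i\<in>{..n}. {S. S i \<in> {s i}})"
    by auto
  also have "\<dots> \<in> sets traj"
    by (intro sets.finite_INT sets_coord) auto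
  finally show ?thesis .
qed

lemma measurable_case_nat_traj [measurable]:
  "case_nat (x :: int ^ 'd::finite) \<in> measurable traj traj"
proof (rule measurable_PiM_single)
  fix i :: nat and A :: "(int ^ 'd) set" assume "A \<in> sets (count_space UNIV)"
  show "{S \<in> space traj. case_nat x S i \<in> A} \<in> sets traj"
  proof (cases i)
    case 0 then show ?thesis by (cases "x \<in> A") (auto intro: sets.top[of traj, simplified])
  next
    case (Suc k) then show ?thesis using sets_coord[of k A] by simp
  qed
qed simp_all

lemma measurable_shift [measurable]:
  "(\<lambda>(S :: 'd::finite path) i. S (i + j)) \<in> measurable traj traj"
  by (rule measurable_PiM_single) (auto intro: sets_coord)

lemma traj_cylinders:
  "sets (traj :: 'd::finite path measure) =
     sigma_sets UNIV (insert {} (range (\<lambda>(n, s). {S. \<forall>i\<le>n::nat. S i = s i})))" (is "_ = sigma_sets _ ?E")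
proof
  have "?E \<subseteq> sets traj" using sets_cylinder by auto
  then show "sigma_sets UNIV ?E \<subseteq> sets traj"
    using sets.sigma_sets_subset[of ?E traj] by simp
next
  interpret sigma_algebra UNIV "sigma_sets UNIV ?E" by (rule sigma_algebra_sigma_sets) auto
  have pre: "{S. S i \<in> A} \<in> sigma_sets UNIV ?E" for i :: nat and A :: "(int ^ 'd) set"
  proof -
    \<comment> \<open>Lists code the finite histories because they are countable; entries beyond the
      end of a short list are unspecified values, which does no harm.\<close>
    let ?C = "(\<lambda>l. {S. \<forall>j\<le>i. S j = l ! j}) ` {l :: (int ^ 'd) list. l ! i \<in> A}"
    have "{S. S i \<in> A} = \<Union>?C"
    proof (intro equalityI subsetI)
      fix S :: "'d path" assume "S \<in> {S. S i \<in> A}"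
      then have "map S [0..<Suc i] \<in> {l. l ! i \<in> A}" "S \<in> {S'. \<forall>j\<le>i. S' j = map S [0..<Suc i] ! j}"
        by (auto simp del: upt_Suc)
      then show "S \<in> \<Union>?C" by blast
    qed auto
    moreover have "\<Union>?C \<in> sigma_sets UNIV ?E"
    proof (rule countable_UN'')
      show "countable {l :: (int ^ 'd) list. l ! i \<in> A}"
        by (rule countable_subset[OF subset_UNIV]) simp
    next
      fix l :: "(int ^ 'd) list"
      show "{S. \<forall>j\<le>i. S j = l ! j} \<in> sigma_sets UNIV ?E"
        by (rule sigma_sets.Basic) (auto intro!: image_eqI[where x = "(i, \<lambda>j. l ! j)"])
    qed
    ultimately show ?thesis by simp
  qed
  have "(\<lambda>S. S) \<in> measurable (sigma UNIV ?E) (traj :: 'd path measure)"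
    by (rule measurable_PiM_single) (auto simp: pre)
  from measurable_sets[OF this] show "sets traj \<subseteq> sigma_sets UNIV ?E"
    by auto
qed

lemma Int_stable_cylinders:
  "Int_stable (insert {} (range (\<lambda>(n, s). {S :: nat \<Rightarrow> 'a. \<forall>i\<le>n::nat. S i = s i})))" (is "Int_stable ?E")
proof -
  have "{S. \<forall>i\<le>n. S i = s i} \<inter> {S. \<forall>i\<le>n'. S i = s' i} \<in> ?E" if "n \<le> n'" for n n' and s s' :: "nat \<Rightarrow> 'a"
  proof (cases "\<forall>i\<le>n. s i = s' i")
    case True
    then have "{S. \<forall>i\<le>n. S i = s i} \<inter> {S. \<forall>i\<le>n'. S i = s' i} = {S. \<forall>i\<le>n'. S i = s' i}"
      using that by auto
    then show ?thesis by (auto intro!: image_eqI[where x = "(n', s')"])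
  next
    case False
    then have "{S. \<forall>i\<le>n. S i = s i} \<inter> {S. \<forall>i\<le>n'. S i = s' i} = {}"
      using that by (auto dest: order_trans)
    then show ?thesis by simp
  qed
  note * = this
  have *: "{S. \<forall>i\<le>n. S i = s i} \<inter> {S. \<forall>i\<le>n'. S i = s' i} \<in> ?E" for n n' and s s' :: "nat \<Rightarrow> 'a"
    using *[of n n' s s'] *[of n' n s' s] by (metis Int_commute nle_le)
  show ?thesis
    unfolding Int_stable_def using * by auto
qed

text \<open>Both sides are measures in A that agree on cylinders, where the product formula splits
  off one factor. Pulling A back along \<open>case_nat x\<close> prepends the start, so that
  conditioning on the first step becomes an equation between measures of path events.\<close>

lemma emeasure_one_step:
  fixes x :: "int ^ 'd::finite"
  assumes A: "A \<in> sets traj"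
  shows "emeasure (walk_law x) A =
     (\<Sum>y\<in>nbhd x. emeasure (walk_law y) {S. case_nat x S \<in> A}) / (2 * CARD('d) + 1)"
proof -
  let ?c = "of_nat (2 * CARD('d) + 1) :: ennreal"
  let ?E = "insert {} (range (\<lambda>(n, s). {S :: 'd path. \<forall>i\<le>n::nat. S i = s i}))"
  define D where "D y = distr (walk_law y) traj (case_nat x)" for y
  define M where "M = measure_of UNIV (sets traj) (\<lambda>A. (\<Sum>y\<in>nbhd x. emeasure (D y) A) / ?c)"
  have pre: "A \<in> sets traj \<Longrightarrow> {S. case_nat x S \<in> A} \<in> sets traj" for A
    using measurable_sets[OF measurable_case_nat_traj[of x], of A] by (simp add: vimage_def)
  have D: "emeasure (D y) A = emeasure (walk_law y) {S. case_nat x S \<in> A}" if "A \<in> sets traj" for A y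
    unfolding D_def using that by (subst emeasure_distr) (auto simp: vimage_def)
  have setsM [simp]: "sets M = sets traj"
    unfolding M_def by (metis sets.sets_measure_of_eq space_traj)
  have spM [simp]: "space M = UNIV" using sets_eq_imp_space_eq[OF setsM] by simp
  have eM: "emeasure M A = (\<Sum>y\<in>nbhd x. emeasure (D y) A) / ?c" if "A \<in> sets traj" for A
    unfolding M_def
  proof (rule emeasure_measure_of_sigma)
    show "sigma_algebra UNIV (sets traj)"
      using sets.sigma_algebra_axioms[of traj] by simp
    show "positive (sets traj) (\<lambda>A. (\<Sum>y\<in>nbhd x. emeasure (D y) A) / ?c)"
      by (simp add: positive_def)
    show "countably_additive (sets traj) (\<lambda>A. (\<Sum>y\<in>nbhd x. emeasure (D y) A) / ?c)"
    proof (rule countably_additiveI)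
      fix F :: "nat \<Rightarrow> 'd path set" assume F: "range F \<subseteq> sets traj" "disjoint_family F"
      have "(\<Sum>i. (\<Sum>y\<in>nbhd x. emeasure (D y) (F i)) / ?c) = (\<Sum>y\<in>nbhd x. \<Sum>i. emeasure (D y) (F i)) / ?c"
        by (simp add: divide_ennreal_def suminf_sum)
      also have "\<dots> = (\<Sum>y\<in>nbhd x. emeasure (D y) (\<Union> (range F))) / ?c"
        using F by (subst suminf_emeasure) (auto simp: D_def)
      finally show "(\<Sum>i. (\<Sum>y\<in>nbhd x. emeasure (D y) (F i)) / ?c) = (\<Sum>y\<in>nbhd x. emeasure (D y) (\<Union> (range F))) / ?c" .
    qed
    show "A \<in> sets traj" by fact
  qed
  have "walk_law x = M"
  proof (rule measure_eqI_generator_eq[OF Int_stable_cylinders])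
    show "sets (walk_law x) = sigma_sets UNIV ?E"
      by (simp add: sets_walk_law traj_cylinders)
    show "sets M = sigma_sets UNIV ?E"
      by (simp add: traj_cylinders)
    show "range (\<lambda>l. {S :: 'd path. \<forall>i\<le>(0::nat). S i = from_nat l}) \<subseteq> ?E"
      by (auto intro!: image_eqI[where x = "(0, \<lambda>_. from_nat l)" for l])
    show "(\<Union>l. {S :: 'd path. \<forall>i\<le>(0::nat). S i = from_nat l}) = UNIV"
      by auto (metis from_nat_to_nat)
    show "emeasure (walk_law x) {S. \<forall>i\<le>(0::nat). S i = from_nat l} \<noteq> \<infinity>" for l :: nat
      using prob_space.finite_measure[OF prob_space_walk_law[of x]] finite_measure.emeasure_finite by auto
    fix X assume X: "X \<in> ?E"
    show "emeasure (walk_law x) X = emeasure M X"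
    proof (cases "X = {}")
      case False
      then obtain n s where Xs: "X = {S. \<forall>i\<le>n. S i = s i}" using X by auto
      have [measurable]: "X \<in> sets traj" unfolding Xs by (rule sets_cylinder)
      show ?thesis
      proof (cases n)
        case 0
        have "{S. case_nat x S \<in> X} = (if s 0 = x then UNIV else {})" by (auto simp: Xs 0)
        moreover have "emeasure (walk_law y) UNIV = 1" for y :: "int ^ 'd"
          using prob_space.emeasure_space_1[OF prob_space_walk_law[of y]] by simp
        ultimately have "emeasure M X = (if s 0 = x then 1 else 0)"
          by (auto simp: eM D card_nbhd ennreal_add_eq_top ennreal_mult_less_top of_nat_less_top intro!: ennreal_divide_self)
        then show ?thesis unfolding Xs using 0 by (subst emeasure_walk_law_cylinder) auto
      next
        case (Suc k)
        have "{S. case_nat x S \<in> X} = (if s 0 = x then {S. \<forall>i\<le>k. S i = s (Suc i)} else {})"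
          using All_less_Suc2[of "Suc k" "\<lambda>i. case_nat x S i = s i" for S]
          by (auto simp: Xs Suc less_Suc_eq_le)
        moreover define p where "p j = ennreal (1 / real ((2 * CARD('d) + 1) ^ j))" for j
        ultimately have "(\<Sum>y\<in>nbhd x. emeasure (D y) X) = (\<Sum>y\<in>nbhd x. if s 0 = x \<and> s (Suc 0) = y \<and> (\<forall>i<k. s (Suc (Suc i)) \<in> nbhd (s (Suc i))) then p k else 0)"
          by (intro sum.cong) (simp_all add: D emeasure_walk_law_cylinder)
        also have "\<dots> = (if s 0 = x \<and> s (Suc 0) \<in> nbhd x \<and> (\<forall>i<k. s (Suc (Suc i)) \<in> nbhd (s (Suc i))) then p k else 0)"
        proof -
          have "(\<Sum>y\<in>nbhd x. if s 0 = x \<and> s (Suc 0) = y \<and> R then p k else 0) =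
              (if s 0 = x \<and> s (Suc 0) \<in> nbhd x \<and> R then p k else 0)" for R
            by (cases "s 0 = x"; cases R) (simp_all add: sum.delta')
          then show ?thesis .
        qed
        finally have e: "emeasure M X = (if s 0 = x \<and> s (Suc 0) \<in> nbhd x \<and> (\<forall>i<k. s (Suc (Suc i)) \<in> nbhd (s (Suc i))) then p k else 0) / ?c"
          by (simp add: eM)
        have all: "(\<forall>i<n. s (Suc i) \<in> nbhd (s i)) \<longleftrightarrow> s (Suc 0) \<in> nbhd (s 0) \<and> (\<forall>i<k. s (Suc (Suc i)) \<in> nbhd (s (Suc i)))"
          by (simp add: Suc All_less_Suc2)
        have c: "p n = p k / ?c"
          unfolding ennreal_of_nat_eq_real_of_nat p_def by (subst divide_ennreal) (simp_all add: Suc field_simps)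
        show ?thesis unfolding e unfolding Xs emeasure_walk_law_cylinder all
          using c by (auto simp: p_def simp del: of_nat_add of_nat_mult of_nat_power)
      qed
    qed simp
  qed simp
  then show ?thesis using A by (simp add: eM D)
qed

text \<open>Hitting, escape and level probabilities are handled through the difference equations
  that this yields, by induction on the number of steps or visits.\<close>

lemma one_step:
  fixes x :: "int ^ 'd::finite"
  assumes A: "A \<in> sets traj"
  shows "measure (walk_law x) A =
     step_prob TYPE('d) * (\<Sum>y\<in>nbhd x. measure (walk_law y) {S. case_nat x S \<in> A})"
proof -
  interpret prob_space "walk_law y" for y :: "int ^ 'd" by (rule prob_space_walk_law)
  have "ennreal (measure (walk_law x) A) = (\<Sum>y\<in>nbhd x. ennreal (measure (walk_law y) {S. case_nat x S \<in> A})) / (2 * CARD('d) + 1)"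
    using emeasure_one_step[OF A, of x] by (simp add: emeasure_eq_measure)
  also have "\<dots> = ennreal ((\<Sum>y\<in>nbhd x. measure (walk_law y) {S. case_nat x S \<in> A}) / (2 * CARD('d) + 1))"
    by (simp add: sum_nonneg divide_ennreal[symmetric] ennreal_of_nat_eq_real_of_nat ennreal_mult'' del: ennreal_plus)
  finally show ?thesis by (simp add: sum_nonneg field_simps)
qed


lemma start_AE: "AE S in walk_law x. S 0 = x"
proof -
  interpret prob_space "walk_law x" by (rule prob_space_walk_law)
  have "emeasure (walk_law x) {S. \<forall>i\<le>(0::nat). S i = (\<lambda>_. x) i} = 1"
    by (subst emeasure_walk_law_cylinder) simp
  then have "prob {S. S 0 = x} = 1" by (simp add: emeasure_eq_measure)
  moreover have "{S. S 0 = x} \<in> events" using sets_coord[of 0 "{x}"] by (simp add: sets_walk_law)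
  ultimately show ?thesis using AE_in_set_eq_1[of "{S. S 0 = x}"] by simp
qed

text \<open>The heat kernel, as a recursion on the first step so that its bounds follow by
  induction; \<open>hk_eq_measure\<close> gives its probabilistic meaning.\<close>

primrec hk :: "nat \<Rightarrow> int ^ 'd::finite \<Rightarrow> int ^ 'd \<Rightarrow> real" where
  "hk 0 x z = of_bool (x = z)"
| "hk (Suc k) x z = step_prob TYPE('d) * (\<Sum>y\<in>nbhd x. hk k y z)"

lemma vimage_sets_traj:
  assumes "f \<in> measurable traj traj" and "B \<in> sets (traj :: 'd::finite path measure)"
  shows "{S :: 'd path. f S \<in> B} \<in> sets traj"
  using measurable_sets[OF assms] by (simp add: vimage_def)

lemma sets_visit_shift:
  fixes z :: "int ^ 'd::finite"
  assumes "B \<in> sets traj"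
  shows "{S. S k = z \<and> (\<lambda>i. S (i + k)) \<in> B} \<in> sets traj"
proof -
  have "{S. S k = z \<and> (\<lambda>i. S (i + k)) \<in> B} = {S. S k \<in> {z}} \<inter> {S. (\<lambda>i. S (i + k)) \<in> B}" by auto
  then show ?thesis
    using sets_coord[of k "{z}"] vimage_sets_traj[OF measurable_shift assms, of k] by auto
qed

text \<open>Deterministic times are enough: events at a random time are later split over the values
  of that time.\<close>

lemma markov:
  fixes x z :: "int ^ 'd::finite"
  assumes B: "B \<in> sets traj"
  shows "measure (walk_law x) {S. S j = z \<and> (\<lambda>i. S (i + j)) \<in> B} = hk j x z * measure (walk_law z) B"
proof (induction j arbitrary: x)
  case 0
  have "AE S in walk_law x. S \<in> {S. S 0 = z \<and> (\<lambda>i. S (i + 0)) \<in> B} \<longleftrightarrow> S \<in> (if x = z then B else {})"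
    using start_AE[of x] by eventually_elim auto
  then have "measure (walk_law x) {S. S 0 = z \<and> (\<lambda>i. S (i + 0)) \<in> B} = measure (walk_law x) (if x = z then B else {})"
    using sets_visit_shift[OF B, of 0 z] B by (intro measure_eq_AE) (auto simp: sets_walk_law)
  then show ?case by simp
next
  case (Suc j)
  show ?case
    using one_step[OF sets_visit_shift[OF B, of "Suc j" z], of x] by (simp add: Suc.IH sum_distrib_right)
qed

lemma hk_eq_measure: "hk j x z = measure (walk_law x) {S. S j = z}"
  for x z :: "int ^ 'd::finite"
proof -
  have "UNIV \<in> sets (traj :: 'd path measure)"
    by (metis sets.top space_traj)
  from markov[OF this, of x j z] show ?thesis
    using prob_space.prob_space[OF prob_space_walk_law[of z]] by simp
qed

text \<open>Probability of staying off A at times 1 to k; the start itself may lie in A. The finite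
  horizon keeps the sums of the lower bound finite.\<close>

primrec esc :: "(int ^ 'd::finite) set \<Rightarrow> nat \<Rightarrow> int ^ 'd \<Rightarrow> real" where
  "esc A 0 x = 1"
| "esc A (Suc k) x = step_prob TYPE('d) * (\<Sum>y\<in>nbhd x - A. esc A k y)"

lemma sets_avoid: "{S :: 'd::finite path. \<forall>i\<in>I. S i \<notin> A} \<in> sets traj"
proof -
  have "{S :: 'd path. \<forall>i\<in>I. S i \<notin> A} = (\<Inter>i. if i \<in> I then {S. S i \<in> - A} else UNIV)"
    by (auto split: if_splits)
  also have "\<dots> \<in> sets traj"
    using sets_coord[of _ "- A"] sets.top[of traj]
    by (intro sets.countable_INT) auto
  finally show ?thesis .
qed

lemma esc_eq_measure:
  fixes x :: "int ^ 'd::finite"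
  shows "measure (walk_law x) {S. \<forall>i\<in>{1..k}. S i \<notin> A} = esc A k x"
proof (induction k arbitrary: x)
  case 0
  then show ?case using prob_space.prob_space[OF prob_space_walk_law[of x]] by simp
next
  case (Suc k)
  have *: "measure (walk_law y) {S. case_nat x S \<in> {S. \<forall>i\<in>{1..Suc k}. S i \<notin> A}} = (if y \<in> A then 0 else esc A k y)" for y
  proof -
    have "(\<forall>i\<in>{1..Suc k}. case_nat x S i \<notin> A) \<longleftrightarrow> (\<forall>i\<in>{0..k}. S i \<notin> A)" for S :: "'d path"
    proof -
      have "{1..Suc k} = Suc ` {0..k}" by simp
      moreover have "(\<forall>i\<in>Suc ` {0..k}. P i) \<longleftrightarrow> (\<forall>i\<in>{0..k}. P (Suc i))" for P by blast
      ultimately show ?thesis by (simp only: nat.case)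
    qed
    moreover have "AE S in walk_law y. S \<in> {S. \<forall>i\<in>{0..k}. S i \<notin> A} \<longleftrightarrow> S \<in> (if y \<in> A then {} else {S. \<forall>i\<in>{1..k}. S i \<notin> A})"
      using start_AE[of y]
    proof eventually_elim
      case (elim S)
      have "{0..k} = insert 0 {1..k}" by auto
      then show ?case using elim by auto
    qed
    then have "measure (walk_law y) {S. \<forall>i\<in>{0..k}. S i \<notin> A} = measure (walk_law y) (if y \<in> A then {} else {S. \<forall>i\<in>{1..k}. S i \<notin> A})"
      by (intro measure_eq_AE) (auto simp: sets_walk_law sets_avoid)
    ultimately show ?thesis using Suc.IH[of y] by simp
  qed
  have "measure (walk_law x) {S. \<forall>i\<in>{1..Suc k}. S i \<notin> A} = step_prob TYPE('d) * (\<Sum>y\<in>nbhd x. if y \<in> A then 0 else esc A k y)"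
    using one_step[OF sets_avoid[of "{1..Suc k}" A], of x] unfolding * .
  also have "(\<Sum>y\<in>nbhd x. if y \<in> A then 0 else esc A k y) = (\<Sum>y\<in>nbhd x - A. esc A k y)"
    by (intro sum.mono_neutral_cong_right) auto
  finally show ?case by simp
qed

section \<open>Escape probabilities and prescribed visit counts\<close>

definition escape :: "(int ^ 'd::finite) set \<Rightarrow> int ^ 'd \<Rightarrow> real" where
  "escape A x = measure (walk_law x) {S. \<forall>i>0. S i \<notin> A}"

lemma return_time_infinity_iff: "return_time A S = \<infinity> \<longleftrightarrow> (\<forall>i>0. S i \<notin> A)"
proof -
  have "Inf (enat ` X) = \<infinity> \<longleftrightarrow> X = {}" for X :: "nat set"
  proof (cases "X = {}")
    case False
    then obtain x where "x \<in> X" by auto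
    then have "Inf (enat ` X) \<le> enat x" by (intro Inf_lower) auto
    then show ?thesis using False by auto
  qed (simp add: Inf_enat_def)
  moreover have "{i. 0 < i \<and> S i \<in> A} = {} \<longleftrightarrow> (\<forall>i>0. S i \<notin> A)" by blast
  ultimately show ?thesis by (simp only: return_time_def)
qed

lemma capacity_eq: "capacity A = (\<Sum>z\<in>A. escape A z)"
  by (simp add: capacity_def escape_def return_time_infinity_iff)

lemma sets_avoid': "{S :: 'd::finite path. \<forall>i>0. S i \<notin> A} \<in> sets traj"
proof -
  have "{S :: 'd path. \<forall>i>0. S i \<notin> A} = {S. \<forall>i\<in>{0<..}. S i \<notin> A}" by auto
  then show ?thesis by (simp only: sets_avoid)
qed

lemma escape_nonneg: "0 \<le> escape A x"
  by (simp add: escape_def)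

lemma escape_le_1: "escape A x \<le> 1"
  unfolding escape_def by (rule prob_space.prob_le_1[OF prob_space_walk_law])

lemma local_time_case_nat: "local_time (case_nat x S) z = indicator {z} x + local_time S z"
  unfolding local_time_def
proof -
  have "(\<lambda>k. indicator {z} (case_nat x S (Suc k)) :: ennreal) sums (\<Sum>k. indicator {z} (S k))"
    using summable_sums[OF summableI] by simp
  from sums_unique[OF sums_Suc[OF this]]
  show "(\<Sum>k. indicator {z} (case_nat x S k)) = indicator {z} x + (\<Sum>k. indicator {z} (S k) :: ennreal)"
    by (simp add: add.commute)
qed

lemma measurable_local_time [measurable]:
  "(\<lambda>S :: 'd::finite path. local_time S z) \<in> borel_measurable traj"
proof -
  have "(\<lambda>S :: 'd path. indicator {z} (S k) :: ennreal) \<in> borel_measurable traj" for k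
  proof -
    have "(\<lambda>S :: 'd path. indicator {S. S k \<in> {z}} S :: ennreal) \<in> borel_measurable traj"
      using sets_coord[of k "{z}"] by (rule borel_measurable_indicator)
    then show ?thesis by (simp add: indicator_def)
  qed
  then show ?thesis unfolding local_time_def by measurable
qed

definition lev_event :: "(int ^ 'd::finite) set \<Rightarrow> (int ^ 'd \<Rightarrow> nat) \<Rightarrow> 'd path set" where
  "lev_event A v = {S. \<forall>z\<in>A. local_time S z = of_nat (v z)}"

lemma sets_lev_event [measurable]: "lev_event A v \<in> sets (traj :: 'd::finite path measure)"
proof -
  have 1: "{S :: 'd path. local_time S z = of_nat k} \<in> sets traj" for z k
    using measurable_sets[OF measurable_local_time[of z], of "{of_nat k}"] by (simp add: vimage_def)
  have "lev_event A v = (\<Inter>z. if z \<in> A then {S. local_time S z = of_nat (v z)} else UNIV)"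
    by (auto simp: lev_event_def split: if_splits)
  also have "\<dots> \<in> sets traj"
    using 1 sets.top[of traj] by (intro sets.countable_INT') auto
  finally show ?thesis .
qed

text \<open>The quantity estimated from above and from below. As a function of the position and of
  the visits still to be made it solves \<open>lev_step_out\<close> and \<open>lev_step_in\<close>,
  and both bounds rest on these equations.\<close>

definition lev :: "(int ^ 'd::finite) set \<Rightarrow> (int ^ 'd \<Rightarrow> nat) \<Rightarrow> int ^ 'd \<Rightarrow> real" where
  "lev A v x = measure (walk_law x) (lev_event A v)"

lemma lev_nonneg: "0 \<le> lev A v x"
  by (simp add: lev_def)

lemma lev_le_1: "lev A v x \<le> 1"
  unfolding lev_def by (rule prob_space.prob_le_1[OF prob_space_walk_law])

lemma lev_event_case_nat:
  assumes "x \<notin> A"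
  shows "{S. case_nat x S \<in> lev_event A v} = lev_event A v"
proof -
  have "(\<forall>z\<in>A. indicator {z} x + local_time S z = of_nat (v z)) \<longleftrightarrow> (\<forall>z\<in>A. local_time S z = of_nat (v z))" for S
  proof (rule ball_cong[OF refl])
    fix z assume "z \<in> A"
    then have "indicator {z} x = (0 :: ennreal)" using assms by (auto simp: indicator_def)
    then show "indicator {z} x + local_time S z = of_nat (v z) \<longleftrightarrow> local_time S z = of_nat (v z)" by simp
  qed
  then show ?thesis by (simp add: lev_event_def local_time_case_nat)
qed

lemma lev_step_out:
  fixes x :: "int ^ 'd::finite"
  assumes "x \<notin> A"
  shows "lev A v x = step_prob TYPE('d) * (\<Sum>y\<in>nbhd x. lev A v y)"
  unfolding lev_def using one_step[OF sets_lev_event, of x A v] lev_event_case_nat[OF assms, of v] by simp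

text \<open>Local time counts time 0, so a walk standing at x has already used one of its
  \<open>v x\<close> visits, and with none left the event is impossible.\<close>

lemma lev_step_in:
  fixes x :: "int ^ 'd::finite"
  assumes "x \<in> A"
  shows "lev A v x = (if v x = 0 then 0 else step_prob TYPE('d) * (\<Sum>y\<in>nbhd x. lev A (v(x := v x - 1)) y))"
proof (cases "v x")
  case 0
  then have "{S. case_nat x S \<in> lev_event A v} = {}"
    using assms by (auto simp: lev_event_def local_time_case_nat intro!: bexI[of _ x])
  then show ?thesis
    unfolding lev_def using one_step[OF sets_lev_event, of x A v] 0 by simp
next
  case (Suc k)
  have 1: "1 + a = (1 + of_nat k :: ennreal) \<longleftrightarrow> a = of_nat k" for a
    by (simp add: ennreal_add_left_cancel)
  have "(\<forall>z\<in>A. indicator {z} x + local_time S z = of_nat (v z)) \<longleftrightarrow> (\<forall>z\<in>A. local_time S z = of_nat ((v(x := v x - 1)) z))" for S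
  proof (rule ball_cong[OF refl])
    fix z assume "z \<in> A"
    show "indicator {z} x + local_time S z = of_nat (v z) \<longleftrightarrow> local_time S z = of_nat ((v(x := v x - 1)) z)"
      by (cases "z = x") (simp_all add: Suc 1)
  qed
  then have "{S. case_nat x S \<in> lev_event A v} = lev_event A (v(x := v x - 1))"
    by (auto simp: lev_event_def local_time_case_nat)
  then show ?thesis
    unfolding lev_def using one_step[OF sets_lev_event, of x A v] Suc by simp
qed

section \<open>Heat kernel bound\<close>

lemma hk_nonneg: "0 \<le> hk k x z"
  by (simp add: hk_eq_measure)

lemma hk_Suc_right: "hk (Suc k) x z = step_prob TYPE('d) * (\<Sum>y\<in>nbhd z. hk k x y)"
  for x z :: "int ^ 'd::finite"
proof (induction k arbitrary: x)
  case 0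
  have "(\<Sum>y\<in>nbhd x. of_bool (y = z)) = (of_bool (z \<in> nbhd x) :: real)"
    by (simp add: of_bool_def sum.delta)
  moreover have "(\<Sum>y\<in>nbhd z. of_bool (x = y)) = (of_bool (x \<in> nbhd z) :: real)"
    by (simp add: of_bool_def sum.delta')
  ultimately show ?case by (simp add: nbhd_sym[of z x])
next
  case (Suc k)
  have "hk (Suc (Suc k)) x z = step_prob TYPE('d) * (\<Sum>y\<in>nbhd x. hk (Suc k) y z)" by simp
  also have "\<dots> = step_prob TYPE('d) * (\<Sum>y\<in>nbhd x. step_prob TYPE('d) * (\<Sum>y'\<in>nbhd z. hk k y y'))"
    by (simp only: Suc.IH)
  also have "\<dots> = step_prob TYPE('d) * (\<Sum>y'\<in>nbhd z. step_prob TYPE('d) * (\<Sum>y\<in>nbhd x. hk k y y'))"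
    by (simp add: sum_distrib_left) (rule sum.swap)
  finally show ?case by simp
qed

lemma hk_sym: "hk k x z = hk k z x"
proof (induction k arbitrary: x z)
  case (Suc k)
  show ?case unfolding hk_Suc_right[of k x z] by (simp add: Suc.IH[of x])
qed auto

text \<open>The number of steps in each coordinate direction is multinomial; \<open>Ec\<close> is its expectation.\<close>
primrec Ec :: "nat \<Rightarrow> (('d::finite \<Rightarrow> nat) \<Rightarrow> real) \<Rightarrow> real" where
  "Ec 0 \<phi> = \<phi> (\<lambda>_. 0)"
| "Ec (Suc k) \<phi> = step_prob TYPE('d) * (Ec k \<phi> + 2 * (\<Sum>i\<in>UNIV. Ec k (\<lambda>c. \<phi> (c(i := Suc (c i))))))"

lemma Ec_add: "Ec k (\<lambda>c. \<phi> c + \<psi> c) = Ec k \<phi> + Ec k \<psi>"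
  by (induction k arbitrary: \<phi> \<psi>) (simp_all add: sum.distrib algebra_simps)

lemma Ec_cmult: "Ec k (\<lambda>c. a * \<phi> c) = a * Ec k \<phi>"
  by (induction k arbitrary: \<phi>) (simp_all add: sum_distrib_left algebra_simps)

lemma Ec_mono: "(\<And>c. \<phi> c \<le> \<psi> c) \<Longrightarrow> Ec k \<phi> \<le> Ec k \<psi>"
proof (induction k arbitrary: \<phi> \<psi>)
  case (Suc k)
  then have "Ec k \<phi> + 2 * (\<Sum>i\<in>UNIV. Ec k (\<lambda>c. \<phi> (c(i := Suc (c i))))) \<le>
      Ec k \<psi> + 2 * (\<Sum>i\<in>UNIV. Ec k (\<lambda>c. \<psi> (c(i := Suc (c i)))))"
    by (intro add_mono mult_left_mono sum_mono) auto
  then show ?case by (simp add: divide_right_mono)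
qed simp

lemma Ec_const: "Ec k (\<lambda>c :: 'd::finite \<Rightarrow> nat. a) = a"
  by (induction k) (simp_all add: field_simps add_nonneg_eq_0_iff)

text \<open>Size biasing: each of the k + 1 steps goes along axis i with probability 2/(2d+1), and
  deleting such a step leaves k independent ones. Where \<open>c i - 1\<close> is truncated, the
  factor \<open>real (c i)\<close> is 0.\<close>

lemma Ec_size_bias:
  fixes \<phi> :: "('d::finite \<Rightarrow> nat) \<Rightarrow> real"
  shows "Ec (Suc k) (\<lambda>c. real (c i) * \<phi> (c(i := c i - 1))) = 2 * real (Suc k) * step_prob TYPE('d) * Ec k \<phi>"
proof (induction k arbitrary: \<phi>)
  case 0
  let ?f = "\<lambda>c. real (c i) * \<phi> (c(i := c i - 1))"
  have "?f ((\<lambda>_. 0)(j := Suc 0)) = (if j = i then \<phi> (\<lambda>_. 0) else 0)" for j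
    by (auto intro!: arg_cong[of _ _ \<phi>])
  then have "(\<Sum>j\<in>UNIV. ?f ((\<lambda>_. 0)(j := Suc 0))) = (\<Sum>j\<in>UNIV. if j = i then \<phi> (\<lambda>_. 0) else 0)"
    by (intro sum.cong refl)
  also have "\<dots> = \<phi> (\<lambda>_. 0)" by simp
  finally have "(\<Sum>j\<in>UNIV. ?f ((\<lambda>_. 0)(j := Suc 0))) = \<phi> (\<lambda>_. 0)" .
  moreover have "Ec (Suc 0) ?f = step_prob TYPE('d) * (?f (\<lambda>_. 0) + 2 * (\<Sum>j\<in>UNIV. ?f ((\<lambda>_. 0)(j := Suc 0))))"
    by (simp only: Ec.simps)
  ultimately show ?case by (simp only:) simp
next
  case (Suc k)
  let ?c = "step_prob TYPE('d)"
  let ?f = "\<lambda>c. real (c i) * \<phi> (c(i := c i - 1))"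
  have *: "Ec (Suc k) (\<lambda>c. ?f (c(j := Suc (c j)))) =
     (if j = i then Ec (Suc k) \<phi> else 0) + Ec (Suc k) (\<lambda>c. real (c i) * (\<lambda>c. \<phi> (c(j := Suc (c j)))) (c(i := c i - 1)))" for j
  proof (cases "j = i")
    case True
    have "?f (c(j := Suc (c j))) = \<phi> c + real (c i) * (\<lambda>c. \<phi> (c(j := Suc (c j)))) (c(i := c i - 1))" for c
      using True by (cases "c i") (auto simp: algebra_simps fun_upd_idem)
    then show ?thesis using True by (simp only: Ec_add if_True refl)
  next
    case False
    then have "?f (c(j := Suc (c j))) = real (c i) * (\<lambda>c. \<phi> (c(j := Suc (c j)))) (c(i := c i - 1))" for c
      by (simp add: fun_upd_twist)
    then show ?thesis using False by (simp only: if_False add_0)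
  qed
  have "Ec (Suc (Suc k)) ?f = ?c * (Ec (Suc k) ?f + 2 * (\<Sum>j\<in>UNIV. Ec (Suc k) (\<lambda>c. ?f (c(j := Suc (c j))))))"
    by (rule Ec.simps(2))
  also have "(\<Sum>j\<in>UNIV. Ec (Suc k) (\<lambda>c. ?f (c(j := Suc (c j))))) =
      Ec (Suc k) \<phi> + 2 * real (Suc k) * ?c * (\<Sum>j\<in>UNIV. Ec k (\<lambda>c. \<phi> (c(j := Suc (c j)))))"
    (is "_ = _ + _ * ?S")
  proof -
    have "Ec (Suc k) (\<lambda>c. ?f (c(j := Suc (c j)))) =
        (if j = i then Ec (Suc k) \<phi> else 0) + 2 * real (Suc k) * ?c * Ec k (\<lambda>c. \<phi> (c(j := Suc (c j))))" for j
      using *[of j] Suc.IH[of "\<lambda>c. \<phi> (c(j := Suc (c j)))"] by (simp only:)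
    then show ?thesis by (simp only: sum.distrib sum_distrib_left sum.delta[OF finite] UNIV_I if_True)
  qed
  also have "Ec (Suc k) ?f = 2 * real (Suc k) * ?c * Ec k \<phi>" by (rule Suc.IH)
  also have "?c * (2 * real (Suc k) * ?c * Ec k \<phi> + 2 * (Ec (Suc k) \<phi> + 2 * real (Suc k) * ?c * ?S)) =
      2 * ?c * Ec (Suc k) \<phi> + 2 * real (Suc k) * ?c * Ec (Suc k) \<phi>"
  proof -
    have e: "c * (2 * m * c * A + 2 * (E + 2 * m * c * S)) = 2 * c * E + 2 * m * c * E" if "E = c * (A + 2 * S)" for c m A E S :: real
      unfolding that by (simp add: algebra_simps)
    show ?thesis by (rule e[OF Ec.simps(2)])
  qed
  also have "\<dots> = 2 * real (Suc (Suc k)) * ?c * Ec (Suc k) \<phi>"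
    by (simp add: algebra_simps add_divide_distrib del: Ec.simps)
  finally show ?case .
qed

text \<open>Negative moments without tail estimates: size biasing turns a factor 1/(c i + 1) into c
  i / c i, which is at most 1, at the price of one factor of order 1/(k + 1). This is done once for
  each i in J.\<close>

lemma Ec_prod_inverse:
  fixes J :: "'d::finite set"
  shows "Ec k (\<lambda>c. \<Prod>i\<in>J. 1 / real (Suc (c i))) \<le> ((2 * real CARD('d) + 1) / (2 * real (Suc k))) ^ card J"
proof -
  have "finite J" by simp
  then show ?thesis
  proof (induction J arbitrary: k)
    case (insert i J)
    let ?c = "step_prob TYPE('d)"
    let ?g = "\<lambda>c :: 'd \<Rightarrow> nat. \<Prod>i\<in>J. 1 / real (Suc (c i))"
    let ?\<phi> = "\<lambda>c. \<Prod>i\<in>insert i J. 1 / real (Suc (c i))"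
    have "real (c i) * ?\<phi> (c(i := c i - 1)) \<le> ?g c" for c
    proof -
      have "(\<Prod>j\<in>J. 1 / real (Suc ((c(i := c i - 1)) j))) = ?g c"
        using insert.hyps by (intro prod.cong) auto
      then have "?\<phi> (c(i := c i - 1)) = 1 / real (Suc (c i - 1)) * ?g c"
        using insert.hyps by simp
      then have "real (c i) * ?\<phi> (c(i := c i - 1)) = real (c i) / real (Suc (c i - 1)) * ?g c" by simp
      also have "\<dots> \<le> 1 * ?g c"
        by (intro mult_right_mono prod_nonneg) (auto simp: field_simps)
      finally show ?thesis by simp
    qed
    then have "Ec (Suc k) (\<lambda>c. real (c i) * ?\<phi> (c(i := c i - 1))) \<le> Ec (Suc k) ?g"
      by (rule Ec_mono)
    also have "\<dots> \<le> ((2 * real CARD('d) + 1) / (2 * real (Suc (Suc k)))) ^ card J"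
      by (rule insert.IH)
    also have "\<dots> \<le> ((2 * real CARD('d) + 1) / (2 * real (Suc k))) ^ card J"
      by (intro power_mono frac_le) auto
    finally have "2 * real (Suc k) * ?c * Ec k ?\<phi> \<le> ((2 * real CARD('d) + 1) / (2 * real (Suc k))) ^ card J"
      by (simp only: Ec_size_bias[of k i ?\<phi>])
    then have "Ec k ?\<phi> \<le> (2 * real CARD('d) + 1) / (2 * real (Suc k)) * ((2 * real CARD('d) + 1) / (2 * real (Suc k))) ^ card J"
    proof -
      have "X \<le> b / a * B" if "a * (1 / b) * X \<le> B" "0 < a" "0 < b" for a b X B :: real
        using that by (simp add: field_simps)
      then show ?thesis using \<open>2 * real (Suc k) * ?c * Ec k ?\<phi> \<le> _\<close> by simp
    qed
    then show ?case using insert.hyps by simp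
  qed (simp add: Ec_const)
qed

section \<open>Local bound for the one-dimensional simple walk\<close>

primrec srw1 :: "nat \<Rightarrow> int \<Rightarrow> real" where
  "srw1 0 t = of_bool (t = 0)"
| "srw1 (Suc j) t = (srw1 j (t - 1) + srw1 j (t + 1)) / 2"

lemma srw1_nonneg: "0 \<le> srw1 j t"
  by (induction j arbitrary: t) auto

text \<open>The walk is at 2 m - j with binomial probability, also for m > j where the coefficient
  is 0; every other point lies below -j or has the wrong parity.\<close>

lemma srw1_binomial: "srw1 j t \<le> real (j choose (j div 2)) / 2 ^ j"
proof -
  have 1: "srw1 j (2 * int m - int j) = real (j choose m) / 2 ^ j" for m
  proof (induction j arbitrary: m)
    case (Suc j)
    show ?case
    proof (cases m)
      case 0
      have z: "srw1 i t = 0" if "\<bar>t\<bar> > int i" for i t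
        using that by (induction i arbitrary: t) auto
      then show ?thesis using Suc.IH[of 0] 0 by (simp add: algebra_simps z)
    next
      case (Suc m')
      have "2 * int m - int (Suc j) - 1 = 2 * int m' - int j" "2 * int m - int (Suc j) + 1 = 2 * int m - int j"
        using Suc by auto
      then show ?thesis using Suc.IH[of m'] Suc.IH[of m] Suc by (simp add: field_simps)
    qed
  qed (auto simp: binomial_eq_0_iff)
  have 2: "srw1 j t = 0" if "t < - int j \<or> odd (t + int j)" for t
    using that by (induction j arbitrary: t) auto
  show ?thesis
  proof (cases "t < - int j \<or> odd (t + int j)")
    case False
    then obtain m where "t + int j = 2 * int m"
      by (metis evenE linorder_not_less minus_le_iff nonneg_int_cases zero_le_mult_iff diff_ge_0_iff_ge diff_minus_eq_add le_minus_iff zero_less_numeral not_less)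
    then have "t = 2 * int m - int j" by simp
    then show ?thesis using 1[of m] binomial_maximum[of j m] by (simp add: divide_right_mono)
  qed (simp add: 2)
qed

text \<open>The square of the left side times 2 n + 1 starts at 1 and does not increase: consecutive
  values have the ratio (2n+1)(2n+3)/(2n+2)^2.\<close>

lemma central_binomial_le: "real ((2 * n) choose n) / 4 ^ n \<le> 1 / sqrt (real (2 * n + 1))"
proof -
  have "(real ((2 * n) choose n) / 4 ^ n)\<^sup>2 * real (2 * n + 1) \<le> 1"
  proof (induction n)
    case (Suc n)
    let ?b = "real ((2 * n) choose n)"
    have "Suc n * (2 * Suc n choose Suc n) = (2 * Suc n) * ((2 * n + 1) choose n)"
      using Suc_times_binomial[of n "2 * n + 1"] by simp
    moreover have "Suc n * ((2 * n + 1) choose Suc n) = (2 * n + 1) * (2 * n choose n)"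
      using Suc_times_binomial[of n "2 * n"] by simp
    moreover have "((2 * n + 1) choose Suc n) = ((2 * n + 1) choose n)"
      using binomial_symmetric[of n "2 * n + 1"] by simp
    ultimately have "Suc n * (2 * Suc n choose Suc n) = 2 * (2 * n + 1) * (2 * n choose n)"
      by (metis mult.assoc mult.left_commute)
    then have "real (Suc n) * real (2 * Suc n choose Suc n) = 2 * real (2 * n + 1) * ?b"
      by (metis of_nat_mult of_nat_numeral)
    then have e: "real (2 * Suc n choose Suc n) = 2 * (real (2 * n + 1) / real (Suc n)) * ?b"
      by (simp add: field_simps)
    have le: "real (2 * n + 1) * real (2 * n + 3) / (2 * real (Suc n))\<^sup>2 \<le> 1"
      by (subst divide_le_eq_1_pos) (simp_all add: power2_eq_square algebra_simps add_pos_nonneg)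
    have "(real (2 * Suc n choose Suc n) / 4 ^ Suc n)\<^sup>2 * real (2 * Suc n + 1) =
        ((?b / 4 ^ n)\<^sup>2 * real (2 * n + 1)) * (real (2 * n + 1) * real (2 * n + 3) / (2 * real (Suc n))\<^sup>2)"
    proof -
      have "(2 * (p / q) * b / 4 ^ Suc n)\<^sup>2 * r = ((b / 4 ^ n)\<^sup>2 * p) * (p * r / (2 * q)\<^sup>2)" if "q > 0" for p q b r :: real
        using that by (simp add: field_simps power2_eq_square)
      from this[of "real (Suc n)" "real (2 * n + 1)" ?b "real (2 * n + 3)"]
      have "(2 * (real (2 * n + 1) / real (Suc n)) * ?b / 4 ^ Suc n)\<^sup>2 * real (2 * n + 3) =
        ((?b / 4 ^ n)\<^sup>2 * real (2 * n + 1)) * (real (2 * n + 1) * real (2 * n + 3) / (2 * real (Suc n))\<^sup>2)"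
        by simp
      moreover have "2 * Suc n + 1 = 2 * n + 3" by simp
      ultimately show ?thesis unfolding e by (simp only:)
    qed
    also have "\<dots> \<le> 1 * 1"
      using Suc le by (intro mult_mono) (auto simp del: of_nat_Suc of_nat_add of_nat_mult)
    finally show ?case by simp
  qed simp
  then have "(real ((2 * n) choose n) / 4 ^ n)\<^sup>2 \<le> (1 / sqrt (real (2 * n + 1)))\<^sup>2"
    by (simp add: power_divide field_simps)
  then show ?thesis
    by (rule power2_le_imp_le) simp
qed

text \<open>The factor 2 pays for odd j, which are compared with the central coefficient of j -
  1.\<close>

lemma srw1_le: "srw1 j t \<le> sqrt (2 / real (Suc j))"
proof -
  have even: "real (j choose (j div 2)) / 2 ^ j \<le> sqrt (2 / real (Suc j))" if ev: "even j" for j :: nat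
  proof -
    obtain n where j: "j = 2 * n" using ev by (rule evenE)
    have "real (j choose (j div 2)) / 2 ^ j \<le> 1 / sqrt (real (Suc j))"
      using central_binomial_le[of n] by (simp add: j power_mult)
    also have "\<dots> \<le> sqrt (2 / real (Suc j))"
      by (simp add: real_sqrt_divide divide_right_mono)
    finally show ?thesis .
  qed
  have "real (j choose (j div 2)) / 2 ^ j \<le> sqrt (2 / real (Suc j))"
  proof (cases "even j")
    case False
    then obtain n where j: "j = 2 * n + 1" by (rule oddE)
    have "real (j choose (j div 2)) / 2 ^ j = real ((2 * n + 1) choose n) / 2 ^ j" by (simp add: j)
    also have "\<dots> \<le> 2 * real ((2 * n) choose n) / 2 ^ j"
    proof -
      have "((2 * n + 1) choose n) \<le> 2 * ((2 * n) choose n)"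
      proof (cases n)
        case (Suc n')
        have "(Suc (2 * n) choose Suc n') = (2 * n choose n') + (2 * n choose Suc n')" by simp
        then show ?thesis using binomial_maximum[of "2 * n" n'] Suc by simp
      qed simp
      then show ?thesis by (intro divide_right_mono) (auto simp flip: of_nat_mult)
    qed
    also have "\<dots> = real ((2 * n) choose n) / 4 ^ n" by (simp add: j power_mult)
    also have "\<dots> \<le> 1 / sqrt (real (2 * n + 1))" by (rule central_binomial_le)
    also have "\<dots> \<le> sqrt (2 / real (Suc j))"
    proof -
      have "sqrt (1 / real (2 * n + 1)) \<le> sqrt (2 / real (Suc j))"
        by (rule real_sqrt_le_mono) (simp add: j field_simps)
      then show ?thesis by (simp only: real_sqrt_divide real_sqrt_one)
    qed
    finally show ?thesis .
  qed (rule even)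
  then show ?thesis using srw1_binomial[of j t] by linarith
qed

text \<open>Given how many steps go along each axis, the coordinates are independent one-dimensional
  walks; a holding step counts for no axis.\<close>

lemma hk_eq_Ec: "hk k x z = Ec k (\<lambda>c. \<Prod>i\<in>UNIV. srw1 (c i) (z $ i - x $ i))"
  for x z :: "int ^ 'd::finite"
proof (induction k arbitrary: x)
  case 0
  show ?case
  proof (cases "x = z")
    case False
    then obtain i where "z $ i - x $ i \<noteq> 0" by (metis vec_eq_iff right_minus_eq)
    then have "(\<Prod>i\<in>UNIV. srw1 0 (z $ i - x $ i)) = 0" by (intro prod_zero) auto
    then show ?thesis using False by simp
  qed simp
next
  case (Suc k)
  let ?p = "\<lambda>c x. \<Prod>i\<in>UNIV. srw1 (c i) (z $ i - x $ i)"
  have split: "?p (c(i := Suc (c i))) x = (?p c (x + axis i 1) + ?p c (x - axis i 1)) / 2" for c i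
  proof -
    have rem: "?p c' y = srw1 (c' i) (z $ i - y $ i) * (\<Prod>j\<in>UNIV - {i}. srw1 (c' j) (z $ j - y $ j))" for c' y
      by (rule prod.remove) auto
    have o: "(\<Prod>j\<in>UNIV - {i}. srw1 ((c(i := Suc (c i))) j) (z $ j - x $ j)) = (\<Prod>j\<in>UNIV - {i}. srw1 (c j) (z $ j - x $ j))"
      "(\<Prod>j\<in>UNIV - {i}. srw1 (c j) (z $ j - (x + axis i 1) $ j)) = (\<Prod>j\<in>UNIV - {i}. srw1 (c j) (z $ j - x $ j))"
      "(\<Prod>j\<in>UNIV - {i}. srw1 (c j) (z $ j - (x - axis i 1) $ j)) = (\<Prod>j\<in>UNIV - {i}. srw1 (c j) (z $ j - x $ j))"
      by (auto intro!: prod.cong simp: axis_def)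
    show ?thesis unfolding rem o by (simp add: algebra_simps)
  qed
  have "2 * Ec k (\<lambda>c. ?p (c(i := Suc (c i))) x) = hk k (x + axis i 1) z + hk k (x - axis i 1) z" for i
  proof -
    have "Ec k (\<lambda>c. ?p (c(i := Suc (c i))) x) = Ec k (\<lambda>c. 1/2 * (?p c (x + axis i 1) + ?p c (x - axis i 1)))"
      unfolding split by simp
    then show ?thesis unfolding Suc.IH by (simp only: Ec_cmult Ec_add) simp
  qed
  then have "2 * (\<Sum>i\<in>UNIV. Ec k (\<lambda>c. ?p (c(i := Suc (c i))) x)) = (\<Sum>i\<in>UNIV. hk k (x + axis i 1) z + hk k (x - axis i 1) z)"
    by (simp add: sum_distrib_left)
  then show ?case using Suc.IH[of x] by (simp add: sum_nbhd)
qed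

definition hk_const :: "'d::finite itself \<Rightarrow> real" where
  "hk_const _ = sqrt ((2 * real CARD('d) + 1) ^ CARD('d))"

lemma hk_const_ge_1: "1 \<le> hk_const TYPE('d::finite)"
  by (simp add: hk_const_def one_le_power)

text \<open>The argument gives the order k^(-d/2); the exponent is then weakened to 5/2, common to
  all dimensions considered, so that d survives only in the constant.\<close>

lemma hk_le:
  fixes x z :: "int ^ 'd::finite"
  assumes "5 \<le> CARD('d)"
  shows "hk k x z \<le> hk_const TYPE('d) * real (Suc k) powr (-5/2)"
proof -
  let ?B = "(2 * real CARD('d) + 1) / (2 * real (Suc k))"
  \<comment> \<open>As t^2 bounds the mean of \<open>?Y\<close>, this t is the best choice in sqrt Y
    \<le> Y/(2t) + t/2, a linear bound that takes the place of Jensen's inequality for the square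
    root.\<close>
  define t where "t = sqrt (?B ^ CARD('d))"
  have t: "t > 0" unfolding t_def by (simp add: field_simps add_pos_nonneg)
  let ?Y = "\<lambda>c :: 'd \<Rightarrow> nat. \<Prod>i\<in>UNIV. 1 / real (Suc (c i))"
  let ?s = "sqrt (2 ^ CARD('d))"
  have pw: "(\<Prod>i\<in>UNIV. srw1 (c i) (z $ i - x $ i)) \<le> ?s * ((1 / (2 * t)) * ?Y c + t / 2)" for c
  proof -
    have "(\<Prod>i\<in>UNIV. srw1 (c i) (z $ i - x $ i)) \<le> (\<Prod>i\<in>UNIV. sqrt (2 / real (Suc (c i))))"
      by (intro prod_mono conjI srw1_nonneg srw1_le)
    also have "\<dots> = sqrt (\<Prod>i\<in>UNIV. 2 / real (Suc (c i)))"
    proof -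
      have "(\<Prod>i\<in>A. sqrt (f i)) = sqrt (\<Prod>i\<in>A. f i)" for f :: "'d \<Rightarrow> real" and A
        by (induction A rule: infinite_finite_induct) (auto simp: real_sqrt_mult)
      then show ?thesis .
    qed
    also have "(\<Prod>i\<in>UNIV. 2 / real (Suc (c i))) = 2 ^ CARD('d) * ?Y c"
      by (simp add: prod_dividef)
    also have "sqrt (2 ^ CARD('d) * ?Y c) = ?s * sqrt (?Y c)" by (rule real_sqrt_mult)
    also have "sqrt (?Y c) \<le> (1 / (2 * t)) * ?Y c + t / 2"
    proof -
      have Y: "0 \<le> ?Y c" by (intro prod_nonneg) auto
      have "0 \<le> (sqrt (?Y c) - t)\<^sup>2" by simp
      also have "\<dots> = ?Y c - 2 * t * sqrt (?Y c) + t\<^sup>2" using Y by (simp add: power2_diff algebra_simps)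
      finally show ?thesis using t by (simp add: field_simps power2_eq_square)
    qed
    finally show ?thesis by (simp add: mult_left_mono)
  qed
  have "hk k x z \<le> Ec k (\<lambda>c. ?s * ((1 / (2 * t)) * ?Y c + t / 2))"
    unfolding hk_eq_Ec by (rule Ec_mono) (rule pw)
  also have "\<dots> = ?s * ((1 / (2 * t)) * Ec k ?Y + t / 2)"
    by (simp only: Ec_cmult Ec_add Ec_const)
  also have "\<dots> \<le> ?s * ((1 / (2 * t)) * t\<^sup>2 + t / 2)"
  proof -
    have "Ec k ?Y \<le> t\<^sup>2" using Ec_prod_inverse[of k "UNIV :: 'd set"] by (simp add: t_def)
    then show ?thesis using t by (intro mult_left_mono add_right_mono) auto
  qed
  also have "\<dots> = ?s * t" using t by (simp add: power2_eq_square)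
  also have "\<dots> = sqrt (((2 * real CARD('d) + 1) / real (Suc k)) ^ CARD('d))"
  proof -
    have "2 * ((2 * real CARD('d) + 1) / (2 * real (Suc k))) = (2 * real CARD('d) + 1) / real (Suc k)"
      by (simp add: field_simps)
    then show ?thesis unfolding t_def real_sqrt_mult[symmetric] power_mult_distrib[symmetric] by (simp only:)
  qed
  also have "\<dots> = hk_const TYPE('d) / sqrt (real (Suc k) ^ CARD('d))"
    by (simp add: hk_const_def power_divide real_sqrt_divide)
  also have "\<dots> \<le> hk_const TYPE('d) / sqrt (real (Suc k) ^ 5)"
    using assms order_trans[OF zero_le_one hk_const_ge_1[where 'd='d]] by (intro divide_left_mono mult_pos_pos real_sqrt_le_mono power_increasing) auto
  also have "sqrt (real (Suc k) ^ 5) = real (Suc k) powr (5/2)"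
  proof -
    have "sqrt (x ^ 5) = x powr (5/2)" if "x > 0" for x :: real
    proof -
      have "x ^ 5 = x powr real 5" using that by (subst powr_realpow) auto
      moreover have "sqrt (x powr real 5) = (x powr real 5) powr (1/2)" by (simp only: powr_half_sqrt[OF powr_ge_zero])
      moreover have "(x powr real 5) powr (1/2) = x powr (real 5 * (1/2))" by (rule powr_powr)
      moreover have "real 5 * (1/2) = (5/2 :: real)" by simp
      ultimately show ?thesis by (simp only:)
    qed
    then show ?thesis by simp
  qed
  also have "hk_const TYPE('d) / real (Suc k) powr (5/2) = hk_const TYPE('d) * real (Suc k) powr (-5/2)"
    by (simp add: powr_minus_divide)
  finally show ?thesis .
qed

section \<open>Green function and capacity\<close>

lemma sum_hk_le_1:
  fixes x :: "int ^ 'd::finite"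
  shows "finite U \<Longrightarrow> (\<Sum>z\<in>U. hk k x z) \<le> 1"
proof (induction k arbitrary: x)
  case 0
  then show ?case by (simp add: of_bool_def sum.delta')
next
  case (Suc k)
  have "(\<Sum>z\<in>U. hk (Suc k) x z) = step_prob TYPE('d) * (\<Sum>y\<in>nbhd x. \<Sum>z\<in>U. hk k y z)"
    by (simp add: sum_distrib_left sum_divide_distrib[symmetric]) (rule sum.swap)
  also have "\<dots> \<le> step_prob TYPE('d) * (\<Sum>y\<in>nbhd x. 1)"
    using Suc by (intro mult_left_mono sum_mono) auto
  also have "\<dots> = 1" by (simp add: card_nbhd field_simps add_nonneg_eq_0_iff)
  finally show ?case .
qed

definition green :: "int ^ 'd::finite \<Rightarrow> int ^ 'd \<Rightarrow> real" where
  "green x z = (\<Sum>k. hk k x z)"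

lemma summable_hk:
  fixes x z :: "int ^ 'd::finite"
  assumes "5 \<le> CARD('d)"
  shows "summable (\<lambda>k. hk k x z)"
proof (rule summable_comparison_test')
  show "summable (\<lambda>k. hk_const TYPE('d) * real (Suc k) powr (-5/2))"
    using summable_Suc_iff[of "\<lambda>k. real k powr (-5/2)"] summable_real_powr_iff[of "-5/2"]
    by (intro summable_mult) simp
  show "norm (hk k x z) \<le> hk_const TYPE('d) * real (Suc k) powr (-5/2)" if "0 \<le> k" for k
    using hk_le[OF assms, of k x z] hk_nonneg[of k x z] by simp
qed

lemma green_nonneg: "5 \<le> CARD('d) \<Longrightarrow> 0 \<le> green x z"
  for x z :: "int ^ 'd::finite"
  unfolding green_def by (intro suminf_nonneg summable_hk) (auto simp: hk_nonneg)

lemma green_sym: "green x z = green z x"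
  by (simp add: green_def hk_sym[of _ x z])

definition green_sup :: "'d::finite itself \<Rightarrow> real" where
  "green_sup _ = (\<Sum>k. hk_const TYPE('d) * real (Suc k) powr (-5/2))"

lemma green_le_sup:
  fixes x z :: "int ^ 'd::finite"
  assumes "5 \<le> CARD('d)"
  shows "green x z \<le> green_sup TYPE('d)"
proof -
  have "summable (\<lambda>k. hk_const TYPE('d) * real (Suc k) powr (-5/2))"
    using summable_Suc_iff[of "\<lambda>k. real k powr (-5/2)"] summable_real_powr_iff[of "-5/2"]
    by (intro summable_mult) simp
  then show ?thesis
    unfolding green_def green_sup_def using summable_hk[OF assms] hk_le[OF assms] by (intro suminf_le)
qed

text \<open>Jensen's inequality for the p-th power of b i / a i under the weights a i. It comes from
  the tangent line of t powr p at 1, taken at t = b i / (a i B) with B the sum of the b i; a total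
  weight below 1 is harmless because 1 - p is negative.\<close>

lemma powr_sum_le_weighted:
  fixes a b :: "'i \<Rightarrow> real"
  assumes fin: "finite I" and p: "1 < p" and a: "\<And>i. i \<in> I \<Longrightarrow> 0 < a i" "(\<Sum>i\<in>I. a i) \<le> 1"
    and b: "\<And>i. i \<in> I \<Longrightarrow> 0 \<le> b i"
  shows "(\<Sum>i\<in>I. b i) powr p \<le> (\<Sum>i\<in>I. a i powr (1 - p) * b i powr p)"
proof (cases "(\<Sum>i\<in>I. b i) = 0")
  case True
  then show ?thesis by (auto intro!: sum_nonneg)
next
  case False
  define B where "B = (\<Sum>i\<in>I. b i)"
  have B: "0 < B" using False b by (simp add: B_def order.not_eq_order_implies_strict sum_nonneg)
  have bern: "1 + p * (t - 1) \<le> t powr p" if "0 \<le> t" for t :: real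
  proof -
    have "t * 1 \<le> t powr p / p + 1 powr (p / (p - 1)) / (p / (p - 1))"
      using p that by (intro Youngs_inequality) (auto simp: field_simps)
    then have "p * t \<le> p * (t powr p / p + 1 / (p / (p - 1)))"
      using p by (intro mult_left_mono) auto
    also have "\<dots> = t powr p + (p - 1)" using p by (simp add: field_simps)
    finally show ?thesis by (simp add: algebra_simps)
  qed
  have "1 \<le> p + (1 - p) * (\<Sum>i\<in>I. a i)"
    using mult_left_mono[OF a(2), of "p - 1"] p by (simp add: algebra_simps)
  also have "\<dots> = (\<Sum>i\<in>I. a i * (1 + p * (b i / (a i * B) - 1)))"
  proof -
    have "(\<Sum>i\<in>I. a i * (1 + p * (b i / (a i * B) - 1))) = (\<Sum>i\<in>I. (1 - p) * a i + p / B * b i)"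
    proof (rule sum.cong[OF refl])
      fix i assume "i \<in> I"
      then have "0 < a i" by (rule a(1))
      then show "a i * (1 + p * (b i / (a i * B) - 1)) = (1 - p) * a i + p / B * b i"
        using B by (simp add: field_simps)
    qed
    also have "\<dots> = (1 - p) * (\<Sum>i\<in>I. a i) + p / B * B"
      by (simp add: sum.distrib sum_distrib_left B_def)
    finally show ?thesis using B by simp
  qed
  also have "\<dots> \<le> (\<Sum>i\<in>I. a i * (b i / (a i * B)) powr p)"
    using less_imp_le[OF a(1)] b B
    by (intro sum_mono mult_left_mono bern divide_nonneg_nonneg mult_nonneg_nonneg) auto
  also have "\<dots> = (\<Sum>i\<in>I. a i powr (1 - p) * b i powr p) / B powr p"
    unfolding sum_divide_distrib
  proof (rule sum.cong[OF refl])
    fix i assume i: "i \<in> I"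
    have "(b i / (a i * B)) powr p = b i powr p / (a i powr p * B powr p)"
      using a(1)[OF i] b[OF i] B by (simp add: powr_divide powr_mult)
    moreover have "a i powr (1 - p) = a i / a i powr p"
      using a(1)[OF i] by (simp add: powr_diff)
    ultimately show "a i * (b i / (a i * B)) powr p = a i powr (1 - p) * b i powr p / B powr p"
      by simp
  qed
  finally show ?thesis using B unfolding B_def[symmetric] by (simp add: field_simps)
qed

text \<open>The exponent is below 2 to leave room for an interpolation between two bounds, and above \<open>5/3\<close>,
  where the Green function of dimension 5 becomes summable.\<close>
abbreviation "pexp \<equiv> 19 / 10 :: real"

text \<open>At a fixed time the power sum of \<open>hk k x\<close> is at most its supremum to the
  power 9/10, because the total mass is at most 1: this is of order k^(-9/4). The times are put
  together by the weighted Jensen inequality.\<close>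

lemma sum_green_powr:
  assumes d: "5 \<le> CARD('d::finite)"
  shows "\<exists>\<Gamma>\<ge>1. \<forall>(x :: int ^ 'd) U. finite U \<longrightarrow> (\<Sum>z\<in>U. green x z powr pexp) \<le> \<Gamma>"
proof -
  let ?C = "hk_const TYPE('d)"
  have sum_w: "summable (\<lambda>k. real (Suc k) powr (-11/10))"
    using summable_Suc_iff[of "\<lambda>k. real k powr (-11/10)"] summable_real_powr_iff[of "-11/10"] by simp
  define W where "W = (\<Sum>k. real (Suc k) powr (-11/10))"
  have "(\<Sum>k<1. real (Suc k) powr (-11/10)) \<le> W"
    unfolding W_def using sum_w by (intro sum_le_suminf) auto
  then have W: "1 \<le> W" by simp
  \<comment> \<open>Weights k^(-\<theta>) need \<theta> > 1, and they cost a factor k^(9\<theta>/10)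
    that must leave k^(-9/4 + 9\<theta>/10) summable; \<theta> = 11/10 gives the exponent
    -63/50.\<close>
  define a where "a k = real (Suc k) powr (-11/10) / W" for k
  have a: "0 < a k" "(\<Sum>k<N. a k) \<le> 1" for k N
  proof -
    show "0 < a k" using W by (simp add: a_def)
    have "(\<Sum>k<N. real (Suc k) powr (-11/10)) \<le> W"
      unfolding W_def using sum_w by (intro sum_le_suminf) auto
    then show "(\<Sum>k<N. a k) \<le> 1" using W by (simp add: a_def sum_divide_distrib[symmetric])
  qed
  have sum_e: "summable (\<lambda>k. real (Suc k) powr (-63/50))"
    using summable_Suc_iff[of "\<lambda>k. real k powr (-63/50)"] summable_real_powr_iff[of "-63/50"] by simp
  define G where "G = W powr (9/10) * ?C powr (9/10) * (\<Sum>k. real (Suc k) powr (-63/50))"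
  have part: "(\<Sum>z\<in>U. (\<Sum>k<N. hk k x z) powr pexp) \<le> G" if U: "finite U" for U N and x :: "int ^ 'd"
  proof -
    have "(\<Sum>z\<in>U. (\<Sum>k<N. hk k x z) powr pexp) \<le> (\<Sum>z\<in>U. \<Sum>k<N. a k powr (1 - pexp) * hk k x z powr pexp)"
      using a by (intro sum_mono powr_sum_le_weighted) (auto simp: hk_nonneg)
    also have "\<dots> = (\<Sum>k<N. \<Sum>z\<in>U. a k powr (1 - pexp) * hk k x z powr pexp)"
      by (rule sum.swap)
    also have "\<dots> \<le> (\<Sum>k<N. W powr (9/10) * ?C powr (9/10) * real (Suc k) powr (-63/50))"
    proof (rule sum_mono)
      fix k
      have "(\<Sum>z\<in>U. hk k x z powr pexp) \<le> (\<Sum>z\<in>U. (?C * real (Suc k) powr (-5/2)) powr (9/10) * hk k x z)"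
      proof (rule sum_mono)
        fix z
        have "hk k x z powr pexp = hk k x z powr (9/10) * hk k x z"
          using hk_nonneg[of k x z] by (cases "hk k x z = 0") (auto simp: powr_mult_base[symmetric] powr_add[of _ "9/10" 1, simplified])
        also have "\<dots> \<le> (?C * real (Suc k) powr (-5/2)) powr (9/10) * hk k x z"
          using hk_le[OF d, of k x z] hk_nonneg[of k x z] by (intro mult_right_mono powr_mono2) auto
        finally show "hk k x z powr pexp \<le> (?C * real (Suc k) powr (-5/2)) powr (9/10) * hk k x z" .
      qed
      also have "\<dots> \<le> (?C * real (Suc k) powr (-5/2)) powr (9/10) * 1"
        unfolding sum_distrib_left[symmetric] using sum_hk_le_1[OF U] by (intro mult_left_mono) auto
      finally have "(\<Sum>z\<in>U. a k powr (1 - pexp) * hk k x z powr pexp) \<le> a k powr (1 - pexp) * (?C * real (Suc k) powr (-5/2)) powr (9/10)"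
        unfolding sum_distrib_left[symmetric] by (intro mult_left_mono) auto
      also have "\<dots> = W powr (9/10) * ?C powr (9/10) * real (Suc k) powr (-63/50)"
      proof -
        have "a k powr (1 - pexp) = real (Suc k) powr (99/100) * W powr (9/10)"
          using W by (simp add: a_def powr_divide powr_mult powr_powr powr_minus_divide del: of_nat_Suc)
        moreover have "(?C * real (Suc k) powr (-5/2)) powr (9/10) = ?C powr (9/10) * real (Suc k) powr (-9/4)"
          using hk_const_ge_1[where 'd='d] by (simp add: powr_mult powr_powr del: of_nat_Suc)
        moreover have "real (Suc k) powr (99/100) * real (Suc k) powr (-9/4) = real (Suc k) powr (-63/50)"
          by (simp add: powr_add[symmetric] del: of_nat_Suc)
        ultimately show ?thesis by (simp add: mult_ac del: of_nat_Suc)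
      qed
      finally show "(\<Sum>z\<in>U. a k powr (1 - pexp) * hk k x z powr pexp) \<le> W powr (9/10) * ?C powr (9/10) * real (Suc k) powr (-63/50)" .
    qed
    also have "\<dots> \<le> G"
      unfolding G_def sum_distrib_left[symmetric] using sum_e
      by (intro mult_left_mono sum_le_suminf) auto
    finally show ?thesis .
  qed
  have "(\<Sum>z\<in>U. green x z powr pexp) \<le> G" if U: "finite U" for U and x :: "int ^ 'd"
  proof (rule LIMSEQ_le_const2)
    show "(\<lambda>N. \<Sum>z\<in>U. (\<Sum>k<N. hk k x z) powr pexp) \<longlonglongrightarrow> (\<Sum>z\<in>U. green x z powr pexp)"
    proof (rule tendsto_sum)
      fix z
      have "(\<lambda>N. \<Sum>k<N. hk k x z) \<longlonglongrightarrow> green x z"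
        unfolding green_def by (rule summable_LIMSEQ[OF summable_hk[OF d]])
      then show "(\<lambda>N. (\<Sum>k<N. hk k x z) powr pexp) \<longlonglongrightarrow> green x z powr pexp"
        by (intro tendsto_powr') (auto intro!: always_eventually sum_nonneg simp: hk_nonneg)
    qed
    show "\<exists>N. \<forall>n\<ge>N. (\<Sum>z\<in>U. (\<Sum>k<n. hk k x z) powr pexp) \<le> G"
      using part[OF U] by blast
  qed
  then show ?thesis by (intro exI[of _ "max 1 G"]) (auto intro: max.coboundedI2)
qed

text \<open>Bounds the power sums, not the norm itself. It is kept at least 1 so that its logarithm
  is nonnegative in the entropy estimate.\<close>

definition green_Lp :: "'d::finite itself \<Rightarrow> real" where
  "green_Lp _ = (SOME \<Gamma>. 1 \<le> \<Gamma> \<and> (\<forall>(x :: int ^ 'd) U. finite U \<longrightarrow> (\<Sum>z\<in>U. green x z powr pexp) \<le> \<Gamma>))"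

lemma green_Lp:
  assumes "5 \<le> CARD('d::finite)"
  shows "1 \<le> green_Lp TYPE('d)"
    and "finite U \<Longrightarrow> (\<Sum>z\<in>U. green (x :: int ^ 'd) z powr pexp) \<le> green_Lp TYPE('d)"
  using someI_ex[OF sum_green_powr[OF assms, unfolded Bex_def]] unfolding green_Lp_def by blast+

definition green_L2 :: "'d::finite itself \<Rightarrow> real" where
  "green_L2 _ = max 1 (green_sup TYPE('d) powr (1/10) * green_Lp TYPE('d))"

lemma sum_green_sq_le:
  assumes d: "5 \<le> CARD('d::finite)" and U: "finite U"
  shows "(\<Sum>z\<in>U. (green (x :: int ^ 'd) z)\<^sup>2) \<le> green_L2 TYPE('d)"
proof -
  have "(\<Sum>z\<in>U. (green x z)\<^sup>2) \<le> (\<Sum>z\<in>U. green_sup TYPE('d) powr (1/10) * green x z powr pexp)"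
  proof (rule sum_mono)
    fix z
    have "(green x z)\<^sup>2 = green x z powr (1/10) * green x z powr pexp"
      using green_nonneg[OF d, of x z] by (cases "green x z = 0") (auto simp: powr_add[symmetric])
    also have "\<dots> \<le> green_sup TYPE('d) powr (1/10) * green x z powr pexp"
      using green_le_sup[OF d, of x z] green_nonneg[OF d, of x z] by (intro mult_right_mono powr_mono2) auto
    finally show "(green x z)\<^sup>2 \<le> green_sup TYPE('d) powr (1/10) * green x z powr pexp" .
  qed
  also have "\<dots> \<le> green_sup TYPE('d) powr (1/10) * green_Lp TYPE('d)"
    unfolding sum_distrib_left[symmetric] using green_Lp(2)[OF d U] by (intro mult_left_mono) auto
  finally show ?thesis by (simp add: green_L2_def)
qed

text \<open>Applied to the last visit to \<open>A\<close>, where \<open>R\<close> says that the walk never returns, and to the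
  first one, where \<open>R\<close> says that the rest of \<open>A\<close> is covered later.\<close>
lemma measure_visit_le:
  fixes x :: "int ^ 'd::finite"
  assumes d: "5 \<le> CARD('d)" and A: "finite A" and R: "\<And>z. R z \<in> sets traj"
  defines "V \<equiv> (\<Union>k. \<Union>z\<in>A. {S. S k = z \<and> (\<lambda>i. S (i + k)) \<in> R z})"
  shows "V \<in> sets (walk_law x)" and "measure (walk_law x) V \<le> (\<Sum>z\<in>A. green x z * measure (walk_law z) (R z))"
proof -
  interpret prob_space "walk_law x" by (rule prob_space_walk_law)
  define L where "L k = (\<Union>z\<in>A. {S. S k = z \<and> (\<lambda>i. S (i + k)) \<in> R z})" for k :: nat
  have ev1: "{S. S k = z \<and> (\<lambda>i. S (i + k)) \<in> R z} \<in> events" for k z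
    using sets_visit_shift[OF R, of k z] by (simp add: sets_walk_law)
  have evL: "L k \<in> events" for k unfolding L_def using A ev1 by (intro sets.finite_UN) auto
  then show "V \<in> events" unfolding V_def L_def by auto
  have PL: "prob (L k) \<le> (\<Sum>z\<in>A. hk k x z * measure (walk_law z) (R z))" for k
  proof -
    have "prob (L k) \<le> (\<Sum>z\<in>A. prob {S. S k = z \<and> (\<lambda>i. S (i + k)) \<in> R z})"
      unfolding L_def using A ev1 by (intro finite_measure_subadditive_finite) auto
    then show ?thesis by (simp only: markov[OF R])
  qed
  have sm: "summable (\<lambda>k. \<Sum>z\<in>A. hk k x z * measure (walk_law z) (R z))"
    by (intro summable_sum summable_mult2 summable_hk d)
  have smL: "summable (\<lambda>k. prob (L k))"
    using PL by (intro summable_comparison_test'[OF sm, of 0]) auto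
  have "prob V \<le> (\<Sum>k. prob (L k))"
    unfolding V_def L_def[symmetric] using evL smL by (intro finite_measure_subadditive_countably) auto
  also have "\<dots> \<le> (\<Sum>k. \<Sum>z\<in>A. hk k x z * measure (walk_law z) (R z))"
    by (intro suminf_le PL smL sm)
  also have "\<dots> = (\<Sum>z\<in>A. green x z * measure (walk_law z) (R z))"
    unfolding green_def by (subst suminf_sum) (auto intro!: sum.cong summable_mult2 summable_hk d simp: suminf_mult2[OF summable_hk[OF d]])
  finally show "prob V \<le> (\<Sum>z\<in>A. green x z * measure (walk_law z) (R z))" .
qed

text \<open>Last-exit decomposition: by Borel-Cantelli the walk almost surely makes a last visit to
  A. Equality holds, but a union bound over the time and place of that visit gives the direction
  used below.\<close>

lemma sum_green_escape_ge_1: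
  fixes x :: "int ^ 'd::finite"
  assumes d: "5 \<le> CARD('d)" and A: "finite A" "x \<in> A"
  shows "1 \<le> (\<Sum>z\<in>A. green x z * escape A z)"
proof -
  interpret prob_space "walk_law x" by (rule prob_space_walk_law)
  let ?V = "\<Union>k::nat. \<Union>z\<in>A. {S. S k = z \<and> (\<lambda>i. S (i + k)) \<in> {S. \<forall>i>0. S i \<notin> A}}"
  have evA: "{S. S k \<in> A} \<in> events" for k
    using sets_coord[of k A] by (simp add: sets_walk_law)
  have pA: "prob {S. S k \<in> A} \<le> (\<Sum>z\<in>A. hk k x z)" for k
  proof -
    have "{S. S k \<in> A} = (\<Union>z\<in>A. {S. S k = z})" by auto
    then show ?thesis
      unfolding hk_eq_measure using A sets_coord[of k "{z}" for z]
      by (simp only:) (intro finite_measure_subadditive_finite, auto simp: sets_walk_law)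
  qed
  have "summable (\<lambda>k. prob {S. S k \<in> A})"
  proof (rule summable_comparison_test'[where N = 0])
    show "summable (\<lambda>k. \<Sum>z\<in>A. hk k x z)" by (intro summable_sum summable_hk d)
    show "norm (prob {S. S k \<in> A}) \<le> (\<Sum>z\<in>A. hk k x z)" for k using pA[of k] by simp
  qed
  then have "AE S in walk_law x. eventually (\<lambda>k. S \<in> space (walk_law x) - {S. S k \<in> A}) sequentially"
    using evA by (intro borel_cantelli_AE1) (auto simp: emeasure_eq_measure)
  then have "AE S in walk_law x. S \<in> ?V"
    using start_AE[of x]
  proof eventually_elim
    case (elim S)
    then obtain N where N: "\<And>k. N \<le> k \<Longrightarrow> S k \<notin> A" by (auto simp: eventually_sequentially)
    define k where "k = Max {k. S k \<in> A}"
    have fin: "finite {k. S k \<in> A}" by (rule finite_subset[of _ "{..<N}"]) (use N in \<open>auto simp: not_less[symmetric]\<close>)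
    have "0 \<in> {k. S k \<in> A}" using elim A by simp
    then have "k \<in> {k. S k \<in> A}" unfolding k_def using fin by (intro Max_in) auto
    moreover have "S (i + k) \<notin> A" if "0 < i" for i
      using Max_ge[OF fin, of "i + k"] that unfolding k_def[symmetric] by auto
    ultimately show ?case by auto
  qed
  then have "1 = prob ?V"
    using measure_visit_le(1)[where R = "\<lambda>_. {S. \<forall>i>0. S i \<notin> A}" and x = x, OF d A(1) sets_avoid'] AE_in_set_eq_1[of ?V] by auto
  also have "\<dots> \<le> (\<Sum>z\<in>A. green x z * escape A z)"
    unfolding escape_def by (rule measure_visit_le(2)[where R = "\<lambda>_. {S. \<forall>i>0. S i \<notin> A}", OF d A(1) sets_avoid'])
  finally show ?thesis .
qed

text \<open>Summing the last-exit inequality over x in A bounds |A| by the column sums of the Green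
  function against the escape probabilities. A column sum is at most sqrt |A| times a constant by
  the square summability of the Green function, here through an AM-GM bound with weight sqrt
  |A|.\<close>

lemma capacity_lower:
  assumes d: "5 \<le> CARD('d::finite)" and A: "finite (A :: (int ^ 'd) set)"
  shows "sqrt (real (card A)) \<le> green_L2 TYPE('d) * capacity A"
proof (cases "A = {}")
  case False
  define K where "K = real (card A)"
  let ?s = "sqrt K"
  have K: "1 \<le> K" using False A by (simp add: K_def Suc_leI card_gt_0_iff)
  have G: "(\<Sum>x\<in>A. green x z) \<le> ?s * green_L2 TYPE('d)" for z :: "int ^ 'd"
  proof -
    have "green x z \<le> (1 / ?s + ?s * (green z x)\<^sup>2) / 2" for x
    proof -
      have "0 \<le> (1 - ?s * green z x)\<^sup>2" by simp
      then show ?thesis using K by (simp add: field_simps power2_eq_square green_sym[of x z])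
    qed
    then have "(\<Sum>x\<in>A. green x z) \<le> (\<Sum>x\<in>A. (1 / ?s + ?s * (green z x)\<^sup>2) / 2)"
      by (intro sum_mono)
    also have "\<dots> = (K / ?s + ?s * (\<Sum>x\<in>A. (green z x)\<^sup>2)) / 2"
      by (simp add: sum.distrib sum_divide_distrib[symmetric] sum_distrib_left K_def)
    also have "\<dots> \<le> (?s + ?s * green_L2 TYPE('d)) / 2"
      using sum_green_sq_le[OF d A, of z] K by (simp add: real_div_sqrt mult_left_mono)
    also have "\<dots> \<le> ?s * green_L2 TYPE('d)"
    proof -
      have "?s * 1 \<le> ?s * green_L2 TYPE('d)"
        using K by (intro mult_left_mono) (auto simp: green_L2_def)
      then show ?thesis by simp
    qed
    finally show ?thesis .
  qed
  have "K \<le> (\<Sum>x\<in>A. \<Sum>z\<in>A. green x z * escape A z)"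
    using sum_mono[of A "\<lambda>_. 1" "\<lambda>x. \<Sum>z\<in>A. green x z * escape A z"] sum_green_escape_ge_1[OF d A] by (simp add: K_def)
  also have "\<dots> = (\<Sum>z\<in>A. (\<Sum>x\<in>A. green x z) * escape A z)"
    by (subst sum.swap) (simp add: sum_distrib_right)
  also have "\<dots> \<le> (\<Sum>z\<in>A. ?s * green_L2 TYPE('d) * escape A z)"
    using G by (intro sum_mono mult_right_mono) (auto simp: escape_nonneg)
  also have "\<dots> = ?s * (green_L2 TYPE('d) * capacity A)"
    by (simp add: capacity_eq sum_distrib_left mult_ac)
  finally have "?s * ?s \<le> ?s * (green_L2 TYPE('d) * capacity A)" using K by simp
  then have "?s \<le> green_L2 TYPE('d) * capacity A" using K by (subst (asm) mult_le_cancel_left) auto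
  then show ?thesis by (simp add: K_def)
qed (simp add: capacity_def)

section \<open>Upper bounds for level sets\<close>

definition hitp :: "(int ^ 'd::finite) set \<Rightarrow> int ^ 'd \<Rightarrow> real" where
  "hitp A x = measure (walk_law x) {S. \<exists>i. S i \<in> A}"

lemma sets_hit: "{S :: 'd::finite path. \<exists>i. S i \<in> A} \<in> sets traj"
proof -
  have "{S :: 'd path. \<exists>i. S i \<in> A} = (\<Union>i. {S. S i \<in> A})" by auto
  then show ?thesis using sets_coord by auto
qed

lemma hitp_le_1: "hitp A x \<le> 1"
  unfolding hitp_def by (rule prob_space.prob_le_1[OF prob_space_walk_law])

lemma hitp_nonneg: "0 \<le> hitp A x"
  by (simp add: hitp_def)

lemma hitp_in: "x \<in> A \<Longrightarrow> hitp A x = 1"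
proof -
  assume x: "x \<in> A"
  interpret prob_space "walk_law x" by (rule prob_space_walk_law)
  have "AE S in walk_law x. S \<in> {S. \<exists>i. S i \<in> A}"
    using start_AE[of x] by eventually_elim (use x in auto)
  then show ?thesis
    unfolding hitp_def using sets_hit[of A] by (subst (asm) AE_in_set_eq_1) (auto simp: sets_walk_law)
qed

lemma escape_eq_hitp:
  fixes x :: "int ^ 'd::finite"
  shows "1 - escape A x = step_prob TYPE('d) * (\<Sum>y\<in>nbhd x. hitp A y)"
proof -
  have c: "measure (walk_law y) {S. \<forall>i. S i \<notin> A} = 1 - hitp A y" for y :: "int ^ 'd"
  proof -
    interpret prob_space "walk_law y" by (rule prob_space_walk_law)
    have "{S. \<forall>i. S i \<notin> A} = space (walk_law y) - {S. \<exists>i. S i \<in> A}" by auto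
    then show ?thesis unfolding hitp_def using sets_hit[of A] by (simp only: prob_compl sets_walk_law)
  qed
  have "{S. case_nat x S \<in> {S. \<forall>i>0. S i \<notin> A}} = {S. \<forall>i. S i \<notin> A}"
  proof -
    have "(\<forall>i>0. case_nat x S i \<notin> A) \<longleftrightarrow> (\<forall>i. S i \<notin> A)" for S :: "'d path"
      by (metis Suc_pred nat.case(2) zero_less_Suc)
    then show ?thesis by simp
  qed
  then have "escape A x = step_prob TYPE('d) * (\<Sum>y\<in>nbhd x. 1 - hitp A y)"
    unfolding escape_def using one_step[OF sets_avoid'[of A], of x] by (simp only: c)
  also have "\<dots> = 1 - step_prob TYPE('d) * (\<Sum>y\<in>nbhd x. hitp A y)"
    by (simp add: sum_subtractf card_nbhd right_diff_distrib add_nonneg_eq_0_iff field_simps)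
  finally show ?thesis by simp
qed

text \<open>Holding for one step counts as a return. This pays for the factor of the very last visit
  in \<open>lev_le_prod\<close>.\<close>

lemma escape_upper:
  fixes x :: "int ^ 'd::finite"
  assumes "x \<in> A"
  shows "step_prob TYPE('d) \<le> 1 - escape A x"
proof -
  have "hitp A x \<le> (\<Sum>y\<in>nbhd x. hitp A y)"
    by (rule member_le_sum) (auto simp: hitp_nonneg)
  then have "step_prob TYPE('d) * 1 \<le> step_prob TYPE('d) * (\<Sum>y\<in>nbhd x. hitp A y)"
    using hitp_in[OF assms] by (intro mult_left_mono) auto
  then show ?thesis using escape_eq_hitp[of A x] by simp
qed

definition first_at :: "(int ^ 'd::finite) set \<Rightarrow> nat \<Rightarrow> 'd path set" where
  "first_at A j = {S. S j \<in> A \<and> (\<forall>i\<in>{..<j}. S i \<notin> A)}"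

lemma sets_first_at: "first_at A j \<in> sets (traj :: 'd::finite path measure)"
proof -
  have "first_at A j = {S. S j \<in> A} \<inter> {S. \<forall>i\<in>{..<j}. S i \<notin> A}" by (auto simp: first_at_def)
  then show ?thesis using sets_coord[of j A] sets_avoid[of "{..<j}" A] by simp
qed

lemma first_at_Union: "{S. \<exists>i. S i \<in> A} = (\<Union>j. first_at A j)"
  for A :: "(int ^ 'd::finite) set"
proof -
  have "\<exists>j. S j \<in> A \<and> (\<forall>i<j. S i \<notin> A)" if "S i \<in> A" for S :: "'d path" and i
    using LeastI[of "\<lambda>j. S j \<in> A" i] not_less_Least[of _ "\<lambda>j. S j \<in> A"] that by blast
  then show ?thesis by (fastforce simp: first_at_def)
qed

lemma first_at_disjoint: "disjoint_family (first_at A)"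
proof -
  have "i = j" if "S \<in> first_at A i" "S \<in> first_at A j" for i j S
    using that by (cases i j rule: linorder_cases) (auto simp: first_at_def)
  then show ?thesis by (auto simp: disjoint_family_on_def)
qed

text \<open>Strong Markov property at the first entrance into A, by induction on the entrance time;
  no visit has been counted before it.\<close>

lemma lev_first_at_le:
  assumes M: "\<And>w. w \<in> A \<Longrightarrow> lev A v w \<le> M"
  shows "measure (walk_law y) (first_at A j \<inter> lev_event A v) \<le> M * measure (walk_law y) (first_at A j)"
proof (induction j arbitrary: y)
  case 0
  have ev: "first_at A 0 \<in> sets (walk_law y)" "lev_event A v \<in> sets (walk_law y)"
    by (simp_all add: sets_walk_law sets_first_at sets_lev_event)
  have AE: "AE S in walk_law y. S \<in> first_at A 0 \<longleftrightarrow> S \<in> (if y \<in> A then UNIV else {})"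
    using start_AE[of y] by eventually_elim (auto simp: first_at_def)
  then have 1: "measure (walk_law y) (first_at A 0) = measure (walk_law y) (if y \<in> A then space (walk_law y) else {})"
    using ev sets.top[of "walk_law y"] by (intro measure_eq_AE) auto
  have "AE S in walk_law y. S \<in> first_at A 0 \<inter> lev_event A v \<longleftrightarrow> S \<in> (if y \<in> A then lev_event A v else {})"
    using AE by eventually_elim auto
  then have "measure (walk_law y) (first_at A 0 \<inter> lev_event A v) = measure (walk_law y) (if y \<in> A then lev_event A v else {})"
    using ev by (intro measure_eq_AE) auto
  then show ?case
    using M[of y] prob_space.prob_space[OF prob_space_walk_law[of y]] by (simp only: 1) (simp add: lev_def)
next
  case (Suc j)
  have s: "first_at A (Suc j) \<inter> lev_event A v \<in> sets traj" "first_at A (Suc j) \<in> sets traj"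
    using sets_first_at[of A "Suc j"] sets_lev_event[of A v] by auto
  have f: "{S. case_nat y S \<in> first_at A (Suc j)} = (if y \<in> A then {} else first_at A j)"
    by (auto simp: first_at_def lessThan_Suc_eq_insert_0)
  show ?case
  proof (cases "y \<in> A")
    case True
    then have "{S. case_nat y S \<in> first_at A (Suc j) \<inter> lev_event A v} = {}" using f by auto
    then show ?thesis using one_step[OF s(1), of y] one_step[OF s(2), of y] f True by simp
  next
    case False
    then have "{S. case_nat y S \<in> first_at A (Suc j) \<inter> lev_event A v} = first_at A j \<inter> lev_event A v"
      using f lev_event_case_nat[OF False, of v] by auto
    moreover have "(\<Sum>y'\<in>nbhd y. measure (walk_law y') (first_at A j \<inter> lev_event A v)) \<le>
        (\<Sum>y'\<in>nbhd y. M * measure (walk_law y') (first_at A j))"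
      by (intro sum_mono Suc.IH)
    ultimately show ?thesis
      using one_step[OF s(1), of y] one_step[OF s(2), of y] f False
      by (simp add: sum_distrib_left[symmetric] divide_right_mono)
  qed
qed

lemma local_time_pos_visits: "local_time S z \<noteq> 0 \<Longrightarrow> \<exists>i. S i = z"
proof (rule ccontr)
  assume a: "local_time S z \<noteq> 0" "\<nexists>i. S i = z"
  then have "indicator {z} (S k) = (0 :: ennreal)" for k by (auto simp: indicator_def)
  then show False using a(1) by (simp add: local_time_def)
qed

lemma lev_le_hitp:
  assumes M: "\<And>w. w \<in> A \<Longrightarrow> lev A v w \<le> M" and v: "z \<in> A" "0 < v z"
  shows "lev A v y \<le> M * hitp A y"
proof -
  interpret prob_space "walk_law y" by (rule prob_space_walk_law)
  have sf: "first_at A j \<in> events" "first_at A j \<inter> lev_event A v \<in> events" for j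
    using sets_first_at[of A j] sets_lev_event[of A v] by (auto simp: sets_walk_law)
  have "S \<in> (\<Union>j. first_at A j)" if "S \<in> lev_event A v" for S
  proof -
    have "local_time S z \<noteq> 0" using that v by (auto simp: lev_event_def)
    then show ?thesis using local_time_pos_visits[of S z] v first_at_Union[of A] by auto
  qed
  then have lv: "lev_event A v = (\<Union>j. first_at A j \<inter> lev_event A v)" by auto
  have 1: "(\<lambda>j. prob (first_at A j \<inter> lev_event A v)) sums lev A v y"
    unfolding lev_def
    by (subst (2) lv, rule finite_measure_UNION) (use sf first_at_disjoint[of A] in \<open>auto simp: disjoint_family_on_def\<close>)
  have 2: "(\<lambda>j. prob (first_at A j)) sums hitp A y"
    unfolding hitp_def first_at_Union
    by (rule finite_measure_UNION) (use sf first_at_disjoint[of A] in auto)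
  show ?thesis
    by (rule sums_le[OF _ 1 sums_mult[OF 2]]) (rule lev_first_at_le[OF M])
qed

text \<open>After every visit but the last the walk must return to A, which costs 1 - escape at the
  visited point. The product also charges the last visit, from which no return is required; the
  leading constant makes up for that by \<open>escape_upper\<close>. The induction removes the
  current visit and restarts at the next entrance into A.\<close>

lemma lev_le_prod:
  fixes A :: "(int ^ 'd::finite) set"
  assumes A: "finite A"
  shows "x \<in> A \<Longrightarrow> lev A v x \<le> (2 * real CARD('d) + 1) * (\<Prod>z\<in>A. (1 - escape A z) ^ v z)"
proof (induction "\<Sum>z\<in>A. v z" arbitrary: x v rule: less_induct)
  case less
  note x = \<open>x \<in> A\<close>
  let ?D = "2 * real CARD('d) + 1"
  have p0: "0 \<le> (\<Prod>z\<in>A. (1 - escape A z) ^ v z)"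
    by (intro prod_nonneg) (simp add: escape_le_1)
  show ?case
  proof (cases "v x = 0")
    case True
    then show ?thesis using p0 lev_step_in[OF x, of v] by simp
  next
    case False
    define v' where "v' = v(x := v x - 1)"
    have step: "lev A v x = step_prob TYPE('d) * (\<Sum>y\<in>nbhd x. lev A v' y)"
      using lev_step_in[OF x, of v] False by (simp add: v'_def)
    have prod: "(\<Prod>z\<in>A. (1 - escape A z) ^ v z) = (1 - escape A x) * (\<Prod>z\<in>A. (1 - escape A z) ^ v' z)"
    proof -
      have "(\<Prod>z\<in>A - {x}. (1 - escape A z) ^ v z) = (\<Prod>z\<in>A - {x}. (1 - escape A z) ^ v' z)"
        by (intro prod.cong) (auto simp: v'_def)
      moreover have "(1 - escape A x) ^ v x = (1 - escape A x) * (1 - escape A x) ^ v' x"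
        using False by (cases "v x") (auto simp: v'_def)
      ultimately show ?thesis
        using prod.remove[OF A x, of "\<lambda>z. (1 - escape A z) ^ v z"] prod.remove[OF A x, of "\<lambda>z. (1 - escape A z) ^ v' z"]
        by simp
    qed
    show ?thesis
    proof (cases "\<forall>z\<in>A. v' z = 0")
      case True
      then have "(\<Prod>z\<in>A. (1 - escape A z) ^ v' z) = 1" by (intro prod.neutral) auto
      moreover have "1 \<le> ?D * (1 - escape A x)"
        using escape_upper[OF x] by (simp add: field_simps)
      ultimately show ?thesis using lev_le_1[of A v x] prod by simp
    next
      case False
      then obtain z where z: "z \<in> A" "0 < v' z" by auto
      have lt: "(\<Sum>z\<in>A. v' z) < (\<Sum>z\<in>A. v z)"
        using x A \<open>v x \<noteq> 0\<close> unfolding v'_def by (intro sum_strict_mono_ex1) auto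
      let ?M = "?D * (\<Prod>z\<in>A. (1 - escape A z) ^ v' z)"
      have "lev A v x \<le> step_prob TYPE('d) * (\<Sum>y\<in>nbhd x. ?M * hitp A y)"
        unfolding step using z by (intro mult_left_mono sum_mono lev_le_hitp less.hyps[OF lt]) auto
      also have "\<dots> = ?M * (1 - escape A x)"
        unfolding escape_eq_hitp sum_distrib_left[symmetric] by (simp only: mult_ac)
      finally show ?thesis unfolding prod by (simp only: mult_ac)
    qed
  qed
qed

lemma lev_le_exp:
  fixes A :: "(int ^ 'd::finite) set"
  assumes A: "finite A" "A \<noteq> {}" and n: "0 < n"
  shows "lev A (\<lambda>_. n) x \<le> (2 * real CARD('d) + 1) * exp (- (real n * capacity A))"
proof -
  let ?M = "(2 * real CARD('d) + 1) * (\<Prod>z\<in>A. (1 - escape A z) ^ n)"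
  obtain z where z: "z \<in> A" using A by auto
  have M0: "0 \<le> ?M" by (intro mult_nonneg_nonneg prod_nonneg) (auto simp: escape_le_1)
  have "lev A (\<lambda>_. n) x \<le> ?M * hitp A x"
    using z n A by (intro lev_le_hitp lev_le_prod) auto
  also have "\<dots> \<le> ?M * 1" using M0 hitp_le_1 by (intro mult_left_mono) auto
  also have "(\<Prod>z\<in>A. (1 - escape A z) ^ n) \<le> (\<Prod>z\<in>A. exp (- (real n * escape A z)))"
  proof (intro prod_mono conjI)
    fix z
    have "1 - escape A z \<le> exp (- escape A z)" using exp_ge_add_one_self[of "- escape A z"] by simp
    then have "(1 - escape A z) ^ n \<le> exp (- escape A z) ^ n"
      by (intro power_mono) (auto simp: escape_le_1)
    then show "(1 - escape A z) ^ n \<le> exp (- (real n * escape A z))"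
      by (simp add: exp_of_nat_mult[symmetric])
  qed (simp add: escape_le_1)
  also have "\<dots> = exp (- (real n * capacity A))"
    using A by (simp add: exp_sum[symmetric] capacity_eq sum_distrib_left sum_negf)
  finally show ?thesis by (simp add: mult_left_mono)
qed

section \<open>Covering probabilities and their power sums\<close>

definition cover :: "(int ^ 'd::finite) set \<Rightarrow> int ^ 'd \<Rightarrow> real" where
  "cover A x = measure (walk_law x) {S. \<forall>z\<in>A. \<exists>i. S i = z}"

lemma cover_nonneg: "0 \<le> cover A x"
  by (simp add: cover_def)

lemma sets_cover: "{S :: 'd::finite path. \<forall>z\<in>A. \<exists>i. S i = z} \<in> sets traj"
proof -
  have 1: "{S :: 'd path. \<exists>i. S i = z} \<in> sets traj" for z using sets_hit[of "{z}"] by simp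
  have "{S :: 'd path. \<forall>z\<in>A. \<exists>i. S i = z} = (\<Inter>z. if z \<in> A then {S. \<exists>i. S i = z} else UNIV)"
    by (auto split: if_splits)
  also have "\<dots> \<in> sets traj"
    using 1 sets.top[of "traj :: 'd path measure"] by (intro sets.countable_INT') auto
  finally show ?thesis .
qed

lemma lev_le_cover:
  assumes "\<And>z. z \<in> A \<Longrightarrow> 0 < v z"
  shows "lev A v x \<le> cover A x"
proof -
  interpret prob_space "walk_law x" by (rule prob_space_walk_law)
  have "lev_event A v \<subseteq> {S. \<forall>z\<in>A. \<exists>i. S i = z}"
  proof safe
    fix S z assume "S \<in> lev_event A v" "z \<in> A"
    then have "local_time S z \<noteq> 0" using assms[of z] by (auto simp: lev_event_def)
    then show "\<exists>i. S i = z" by (rule local_time_pos_visits)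
  qed
  then show ?thesis
    unfolding lev_def cover_def using sets_cover[of A] by (intro finite_measure_mono) (auto simp: sets_walk_law)
qed

lemma cover_le_sum:
  fixes A :: "(int ^ 'd::finite) set"
  assumes d: "5 \<le> CARD('d)" and A: "finite A" "A \<noteq> {}"
  shows "cover A x \<le> (\<Sum>z\<in>A. green x z * cover (A - {z}) z)"
proof -
  interpret prob_space "walk_law x" by (rule prob_space_walk_law)
  let ?V = "\<Union>k::nat. \<Union>z\<in>A. {S. S k = z \<and> (\<lambda>i. S (i + k)) \<in> {S. \<forall>w\<in>A - {z}. \<exists>i. S i = w}}"
  have "{S. \<forall>z\<in>A. \<exists>i. S i = z} \<subseteq> ?V"
  proof
    fix S :: "'d path"
    assume S: "S \<in> {S. \<forall>z\<in>A. \<exists>i. S i = z}"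
    then have ex: "\<exists>k. S k \<in> A" using A by auto
    define k where "k = (LEAST k. S k \<in> A)"
    have k: "S k \<in> A" "\<And>i. S i \<in> A \<Longrightarrow> k \<le> i"
      unfolding k_def using LeastI_ex[OF ex] by (auto intro: Least_le)
    have "\<exists>i. S (i + k) = w" if w: "w \<in> A" for w
    proof -
      obtain i where i: "S i = w" using S w by auto
      then have "k \<le> i" using k(2) w by auto
      then show ?thesis using i by (intro exI[of _ "i - k"]) simp
    qed
    then show "S \<in> ?V" using k(1) by auto
  qed
  then have "cover A x \<le> prob ?V"
    unfolding cover_def using measure_visit_le(1)[where R = "\<lambda>z. {S. \<forall>w\<in>A - {z}. \<exists>i. S i = w}", OF d A(1) sets_cover] by (intro finite_measure_mono) auto
  also have "\<dots> \<le> (\<Sum>z\<in>A. green x z * cover (A - {z}) z)"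
    unfolding cover_def by (rule measure_visit_le(2)[where R = "\<lambda>z. {S. \<forall>w\<in>A - {z}. \<exists>i. S i = w}", OF d A(1) sets_cover])
  finally show ?thesis .
qed

text \<open>Every term is compared with the largest one. The square of the cardinality is generous;
  it becomes the factor (k!)^2, which the later estimate can afford.\<close>

lemma powr_sum_le_card:
  fixes f :: "'i \<Rightarrow> real"
  assumes "finite I" "\<And>i. i \<in> I \<Longrightarrow> 0 \<le> f i"
  shows "(\<Sum>i\<in>I. f i) powr pexp \<le> (real (card I))\<^sup>2 * (\<Sum>i\<in>I. f i powr pexp)"
proof (cases "I = {}")
  case False
  let ?M = "Max (f ` I)"
  obtain j where j: "j \<in> I" "f j = ?M" using Max_in[of "f ` I"] assms False by fastforce
  have K: "1 \<le> real (card I)" using False assms by (simp add: Suc_leI card_gt_0_iff)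
  have "(\<Sum>i\<in>I. f i) \<le> (\<Sum>i\<in>I. ?M)" using assms by (intro sum_mono) auto
  then have "(\<Sum>i\<in>I. f i) powr pexp \<le> (real (card I) * f j) powr pexp"
    using assms j by (intro powr_mono2 sum_nonneg) auto
  also have "\<dots> = real (card I) powr pexp * f j powr pexp" using assms j by (simp add: powr_mult)
  also have "\<dots> \<le> real (card I) powr 2 * (\<Sum>i\<in>I. f i powr pexp)"
    using K assms j by (intro mult_mono powr_mono member_le_sum) auto
  also have "real (card I) powr 2 = (real (card I))\<^sup>2" using K by simp
  finally show ?thesis .
qed simp

text \<open>The first visited point z of A is peeled off and the sums are swapped: for fixed z the
  sets A - {z} are distinct k-sets, so the induction hypothesis applies with start z. What remains
  is one power sum of the Green function. As the bound does not depend on F, it serves unions over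
  infinitely many sets.\<close>

lemma sum_cover_powr:
  assumes d: "5 \<le> CARD('d::finite)"
  shows "finite F \<Longrightarrow> (\<And>A. A \<in> F \<Longrightarrow> finite A \<and> card A = k) \<Longrightarrow>
    (\<Sum>A\<in>F. cover A (x :: int ^ 'd) powr pexp) \<le> (fact k)\<^sup>2 * green_Lp TYPE('d) ^ k"
proof (induction k arbitrary: F x)
  case 0
  have "A \<in> {{}}" if "A \<in> F" for A using 0(2)[OF that] by (metis card_0_eq insertI1)
  then have "F \<subseteq> {{}}" by blast
  then have "(\<Sum>A\<in>F. cover A x powr pexp) \<le> (\<Sum>A\<in>{{}}. cover A x powr pexp)"
    by (intro sum_mono2) auto
  also have "\<dots> \<le> 1"
    using prob_space.prob_space[OF prob_space_walk_law[of x]] by (simp add: cover_def)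
  finally show ?case by simp
next
  case (Suc k)
  let ?G = "green_Lp TYPE('d)"
  let ?U = "\<Union>F"
  have finU: "finite ?U" using Suc.prems by auto
  have "(\<Sum>A\<in>F. cover A x powr pexp) \<le> (\<Sum>A\<in>F. (real (Suc k))\<^sup>2 * (\<Sum>z\<in>A. green x z powr pexp * cover (A - {z}) z powr pexp))"
  proof (rule sum_mono)
    fix A assume A: "A \<in> F"
    have fA: "finite A" "card A = Suc k" "A \<noteq> {}" using Suc.prems(2)[OF A] by auto
    have "cover A x powr pexp \<le> (\<Sum>z\<in>A. green x z * cover (A - {z}) z) powr pexp"
      using cover_le_sum[OF d fA(1,3)] by (intro powr_mono2) (auto simp: cover_nonneg)
    also have "\<dots> \<le> (real (Suc k))\<^sup>2 * (\<Sum>z\<in>A. (green x z * cover (A - {z}) z) powr pexp)"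
      using powr_sum_le_card[OF fA(1), of "\<lambda>z. green x z * cover (A - {z}) z"] fA(2)
      by (simp add: green_nonneg[OF d] cover_nonneg)
    finally show "cover A x powr pexp \<le> (real (Suc k))\<^sup>2 * (\<Sum>z\<in>A. green x z powr pexp * cover (A - {z}) z powr pexp)"
      by (simp add: powr_mult green_nonneg[OF d] cover_nonneg)
  qed
  also have "\<dots> = (real (Suc k))\<^sup>2 * (\<Sum>A\<in>F. \<Sum>z\<in>A. green x z powr pexp * cover (A - {z}) z powr pexp)"
    by (simp add: sum_distrib_left)
  also have "(\<Sum>A\<in>F. \<Sum>z\<in>A. green x z powr pexp * cover (A - {z}) z powr pexp) =
      (\<Sum>A\<in>F. \<Sum>z\<in>{z \<in> ?U. z \<in> A}. green x z powr pexp * cover (A - {z}) z powr pexp)"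
    by (intro sum.cong refl) auto
  also have "\<dots> = (\<Sum>z\<in>?U. \<Sum>A\<in>{A \<in> F. z \<in> A}. green x z powr pexp * cover (A - {z}) z powr pexp)"
    using finU Suc.prems(1) by (intro sum.swap_restrict)
  also have "\<dots> = (\<Sum>z\<in>?U. green x z powr pexp * (\<Sum>A\<in>{A \<in> F. z \<in> A}. cover (A - {z}) z powr pexp))"
    by (simp add: sum_distrib_left)
  also have "\<dots> \<le> (\<Sum>z\<in>?U. green x z powr pexp * ((fact k)\<^sup>2 * ?G ^ k))"
  proof (intro sum_mono mult_left_mono)
    fix z
    have inj: "inj_on (\<lambda>A. A - {z}) {A \<in> F. z \<in> A}" by (auto simp: inj_on_def)
    have "(\<Sum>A\<in>{A \<in> F. z \<in> A}. cover (A - {z}) z powr pexp) = (\<Sum>A\<in>(\<lambda>A. A - {z}) ` {A \<in> F. z \<in> A}. cover A z powr pexp)"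
      by (simp add: sum.reindex[OF inj])
    also have "\<dots> \<le> (fact k)\<^sup>2 * ?G ^ k"
    proof (rule Suc.IH)
      fix B assume "B \<in> (\<lambda>A. A - {z}) ` {A \<in> F. z \<in> A}"
      then obtain A where "A \<in> F" "z \<in> A" "B = A - {z}" by auto
      then show "finite B \<and> card B = k" using Suc.prems(2)[of A] by auto
    qed (use Suc.prems in simp)
    finally show "(\<Sum>A\<in>{A \<in> F. z \<in> A}. cover (A - {z}) z powr pexp) \<le> (fact k)\<^sup>2 * ?G ^ k" .
  qed simp
  also have "\<dots> \<le> ?G * ((fact k)\<^sup>2 * ?G ^ k)"
    unfolding sum_distrib_right[symmetric] using green_Lp[OF d] finU by (intro mult_right_mono) auto
  finally have "(\<Sum>A\<in>F. cover A x powr pexp) \<le> (real (Suc k))\<^sup>2 * (?G * ((fact k)\<^sup>2 * ?G ^ k))"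
    by (simp add: mult_left_mono)
  also have "\<dots> = (fact (Suc k))\<^sup>2 * ?G ^ Suc k"
    by (simp add: power_mult_distrib)
  finally show ?case .
qed

text \<open>The walk with the larger count N satisfies both the exponential and the covering bound
  and is at most their geometric mean with weights 1/10 and 9/10; the other walk gives a full
  covering factor. The two covering powers add up to \<open>pexp\<close>, so the surviving tenth of
  the exponent is 2 - pexp.\<close>

lemma lev_mult_le:
  fixes A :: "(int ^ 'd::finite) set"
  assumes A: "finite A" "A \<noteq> {}" and n: "0 < n" "0 < m" and a: "a \<le> capacity A"
  shows "lev A (\<lambda>_. n) x * lev A (\<lambda>_. m) x \<le>
    (2 * real CARD('d) + 1) * exp (- (real (max n m) * a / 10)) * cover A x powr pexp"
proof -
  let ?D = "2 * real CARD('d) + 1"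
  have *: "lev A (\<lambda>_. N) x * lev A (\<lambda>_. M) x \<le> ?D * exp (- (real N * a / 10)) * cover A x powr pexp"
    if "0 < N" "0 < M" for N M
  proof -
    let ?p = "lev A (\<lambda>_. N) x" and ?E = "exp (- (real N * a))"
    have E: "?p \<le> ?D * ?E"
    proof -
      have "?p \<le> ?D * exp (- (real N * capacity A))" by (rule lev_le_exp[OF A that(1)])
      also have "\<dots> \<le> ?D * ?E" using a by (intro mult_left_mono) (auto simp: mult_left_mono)
      finally show ?thesis .
    qed
    have H: "?p \<le> cover A x" "lev A (\<lambda>_. M) x \<le> cover A x" using that by (auto intro: lev_le_cover)
    have "?p = ?p powr (1/10) * ?p powr (9/10)"
      using lev_nonneg[of A "\<lambda>_. N" x] by (cases "?p = 0") (auto simp: powr_add[symmetric])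
    also have "\<dots> \<le> (?D * ?E) powr (1/10) * cover A x powr (9/10)"
      using E H lev_nonneg[of A "\<lambda>_. N" x] by (intro mult_mono powr_mono2) auto
    also have "(?D * ?E) powr (1/10) = ?D powr (1/10) * exp (- (real N * a / 10))"
      by (simp add: powr_mult exp_powr_real)
    also have "?D powr (1/10) \<le> ?D" using powr_mono[of "1/10" 1 ?D] by simp
    finally have "?p \<le> ?D * exp (- (real N * a / 10)) * cover A x powr (9/10)"
      by (simp add: mult_right_mono)
    then have "?p * lev A (\<lambda>_. M) x \<le> (?D * exp (- (real N * a / 10)) * cover A x powr (9/10)) * cover A x"
      using H lev_nonneg[of A _ x] by (intro mult_mono) auto
    also have "\<dots> = ?D * exp (- (real N * a / 10)) * cover A x powr pexp"
      using cover_nonneg[of A x] by (cases "cover A x = 0") (auto simp: powr_add[of _ "9/10" 1, simplified])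
    finally show ?thesis .
  qed
  show ?thesis using *[OF n] *[OF n(2,1)] by (cases "n \<le> m") (simp_all add: max_def mult.commute[of "lev A (\<lambda>_. n) x"])
qed

section \<open>Occupation times of finite symmetric chains\<close>

text \<open>Abstracts the walk observed on A, with transition kernel Q and killing e. The geometry
  of A enters through \<open>osc\<close> alone: if every edge carries energy at most B, then g
  oscillates by at most sqrt(\<rho> B), so \<rho> plays the role of a resistance.\<close>

locale sub_chain =
  fixes A :: "'a set" and Q :: "'a \<Rightarrow> 'a \<Rightarrow> real" and e :: "'a \<Rightarrow> real" and c \<rho> :: real
  assumes fin: "finite A" and ne: "A \<noteq> {}"
    and Q_nonneg: "\<And>x y. x \<in> A \<Longrightarrow> y \<in> A \<Longrightarrow> 0 \<le> Q x y"
    and Q_sym: "\<And>x y. x \<in> A \<Longrightarrow> y \<in> A \<Longrightarrow> Q x y = Q y x"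
    and e_nonneg: "\<And>x. x \<in> A \<Longrightarrow> 0 \<le> e x"
    and row: "\<And>x. x \<in> A \<Longrightarrow> (\<Sum>y\<in>A. Q x y) + e x = 1"
    and c_pos: "0 < c" and hold: "\<And>x. x \<in> A \<Longrightarrow> c \<le> Q x x"
    and osc: "\<And>g B x y. (\<And>x y. x \<in> A \<Longrightarrow> y \<in> A \<Longrightarrow> Q x y * (g x - g y)\<^sup>2 \<le> B) \<Longrightarrow>
        x \<in> A \<Longrightarrow> y \<in> A \<Longrightarrow> (g x - g y)\<^sup>2 \<le> \<rho> * B"
begin

text \<open>Returning the escape probability as extra holding makes the kernel doubly stochastic.\<close>
definition q :: "'a \<Rightarrow> 'a \<Rightarrow> real" where
  "q x y = Q x y + (if x = y then e x else 0)"

lemma q_nonneg: "x \<in> A \<Longrightarrow> y \<in> A \<Longrightarrow> 0 \<le> q x y"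
  by (simp add: q_def Q_nonneg e_nonneg)

lemma Q_le_q: "x \<in> A \<Longrightarrow> Q x y \<le> q x y"
  using e_nonneg by (auto simp: q_def)

lemma q_sym: "x \<in> A \<Longrightarrow> y \<in> A \<Longrightarrow> q x y = q y x"
  by (simp add: q_def Q_sym)

lemma q_row: "x \<in> A \<Longrightarrow> (\<Sum>y\<in>A. q x y) = 1"
  using row[of x] fin by (simp add: q_def sum.distrib)

lemma q_col: "y \<in> A \<Longrightarrow> (\<Sum>x\<in>A. q x y) = 1"
proof -
  assume y: "y \<in> A"
  have "(\<Sum>x\<in>A. q x y) = (\<Sum>x\<in>A. q y x)" using y by (intro sum.cong) (auto simp: q_sym)
  then show ?thesis using q_row[OF y] by simp
qed

text \<open>Expectation under the q-chain from x of a function of its positions at times 0 to T - 1;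
  the position reached by the last step is not recorded.\<close>

primrec E :: "nat \<Rightarrow> 'a \<Rightarrow> ('a list \<Rightarrow> real) \<Rightarrow> real" where
  "E 0 x F = F []"
| "E (Suc T) x F = (\<Sum>y\<in>A. q x y * E T y (\<lambda>xs. F (x # xs)))"

lemma E_add: "E T x (\<lambda>xs. F xs + G xs) = E T x F + E T x G"
  by (induction T arbitrary: x F G) (simp_all add: sum.distrib algebra_simps)

lemma E_cmult: "E T x (\<lambda>xs. a * F xs) = a * E T x F"
  by (induction T arbitrary: x F) (simp_all add: sum_distrib_left algebra_simps)

lemma E_const: "x \<in> A \<Longrightarrow> E T x (\<lambda>xs. a) = a"
proof (induction T arbitrary: x)
  case (Suc T)
  then show ?case using q_row[of x] by (simp add: sum_distrib_right[symmetric])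
qed simp

lemma E_sum: "E T x (\<lambda>xs. \<Sum>i\<in>I. F i xs) = (\<Sum>i\<in>I. E T x (F i))" if "x \<in> A"
  using that by (induction I rule: infinite_finite_induct) (simp_all add: E_add E_const)

lemma E_mono:
  assumes "x \<in> A" and "\<And>xs. set xs \<subseteq> A \<Longrightarrow> length xs = T \<Longrightarrow> F xs \<le> G xs"
  shows "E T x F \<le> E T x G"
  using assms
proof (induction T arbitrary: x F G)
  case (Suc T)
  have "E T y (\<lambda>xs. F (x # xs)) \<le> E T y (\<lambda>xs. G (x # xs))" if "y \<in> A" for y
    using that Suc.prems by (intro Suc.IH) auto
  then show ?case using Suc.prems by (auto intro!: sum_mono mult_left_mono q_nonneg)
qed simp

lemma E_count_Suc:
  assumes "x \<in> A"
  shows "E (Suc T) x (\<lambda>xs. real (count_list xs z)) =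
    of_bool (x = z) + (\<Sum>y\<in>A. q x y * E T y (\<lambda>xs. real (count_list xs z)))"
proof -
  have "E T y (\<lambda>xs. real (count_list (x # xs) z)) = of_bool (x = z) + E T y (\<lambda>xs. real (count_list xs z))" if "y \<in> A" for y
  proof -
    have "E T y (\<lambda>xs. real (count_list (x # xs) z)) = E T y (\<lambda>xs. of_bool (x = z) + real (count_list xs z))"
      by (rule arg_cong[of _ _ "E T y"]) auto
    then show ?thesis using that by (simp add: E_add E_const)
  qed
  then have "E (Suc T) x (\<lambda>xs. real (count_list xs z)) =
      (\<Sum>y\<in>A. q x y * of_bool (x = z) + q x y * E T y (\<lambda>xs. real (count_list xs z)))"
    by (simp add: distrib_left)
  then show ?thesis using q_row[OF assms]
    by (simp add: sum.distrib sum_distrib_right[symmetric])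
qed

text \<open>First moment of the time spent at z: the Green function of q truncated at T.\<close>

definition m1 :: "'a \<Rightarrow> nat \<Rightarrow> 'a \<Rightarrow> real" where
  "m1 z T x = E T x (\<lambda>xs. real (count_list xs z))"

definition qop :: "('a \<Rightarrow> real) \<Rightarrow> 'a \<Rightarrow> real" where
  "qop f x = (\<Sum>y\<in>A. q x y * f y)"

lemma sum_qop: "(\<Sum>x\<in>A. qop f x) = (\<Sum>x\<in>A. f x)"
proof -
  have "(\<Sum>x\<in>A. qop f x) = (\<Sum>y\<in>A. \<Sum>x\<in>A. q x y * f y)"
    unfolding qop_def by (rule sum.swap)
  also have "\<dots> = (\<Sum>y\<in>A. f y)"
    using q_col by (intro sum.cong) (simp_all add: sum_distrib_right[symmetric])
  finally show ?thesis .
qed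

lemma m1_Suc: "x \<in> A \<Longrightarrow> m1 z (Suc T) x = of_bool (x = z) + qop (m1 z T) x"
  by (simp only: m1_def qop_def E_count_Suc)

lemma m1_0: "m1 z 0 x = 0"
  by (simp add: m1_def)

lemma sum_m1: "z \<in> A \<Longrightarrow> (\<Sum>x\<in>A. m1 z T x) = real T"
proof (induction T)
  case (Suc T)
  have "(\<Sum>x\<in>A. m1 z (Suc T) x) = (\<Sum>x\<in>A. of_bool (x = z)) + (\<Sum>x\<in>A. qop (m1 z T) x)"
    by (simp add: m1_Suc sum.distrib)
  then show ?case using Suc fin by (simp add: sum_qop of_bool_def sum.delta)
qed (simp add: m1_0)

text \<open>The increment is the T-step transition probability from x to z.\<close>

lemma m1_increment:
  assumes "z \<in> A"
  shows "x \<in> A \<Longrightarrow> 0 \<le> m1 z (Suc T) x - m1 z T x"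
proof (induction T arbitrary: x)
  case 0
  then show ?case by (simp add: m1_Suc m1_0 qop_def)
next
  case (Suc T)
  have "m1 z (Suc (Suc T)) x - m1 z (Suc T) x = (\<Sum>y\<in>A. q x y * (m1 z (Suc T) y - m1 z T y))"
    using Suc.prems by (simp add: m1_Suc[of x] qop_def right_diff_distrib sum_subtractf)
  also have "\<dots> \<ge> 0"
    using Suc by (intro sum_nonneg mult_nonneg_nonneg q_nonneg) auto
  finally show ?case .
qed

text \<open>The Dirichlet form of the truncated Green function is at most its oscillation; by the
  hypothesis \<open>osc\<close> this bounds the oscillation by \<open>\<rho>\<close> itself, uniformly in time.\<close>
lemma m1_osc:
  assumes z: "z \<in> A" and xy: "x \<in> A" "y \<in> A"
  shows "m1 z T x - m1 z T y \<le> \<rho>"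
proof -
  let ?a = "m1 z T"
  let ?M = "Max (?a ` A)" and ?m = "Min (?a ` A)"
  define D where "D = ?M - ?m"
  have M: "?a x \<le> ?M" "?m \<le> ?a x" if "x \<in> A" for x using that fin by auto
  obtain u w where u: "u \<in> A" "?a u = ?M" and w: "w \<in> A" "?a w = ?m"
    using Max_in[of "?a ` A"] Min_in[of "?a ` A"] fin ne by fastforce
  have D0: "0 \<le> D" using M[OF z] by (simp add: D_def)
  have diff: "?a x - qop ?a x = of_bool (x = z) - (m1 z (Suc T) x - ?a x)" if "x \<in> A" for x
    using m1_Suc[OF that, of z T] by simp
  have r1: "(\<Sum>x\<in>A. m1 z (Suc T) x - ?a x) = 1"
    using sum_m1[OF z] by (simp add: sum_subtractf)
  \<comment> \<open>Summation by parts; both square terms reduce to the same sum because q is doubly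
    stochastic.\<close>
  have energy: "(\<Sum>x\<in>A. \<Sum>y\<in>A. q x y * (?a x - ?a y)\<^sup>2) = 2 * (\<Sum>x\<in>A. ?a x * (?a x - qop ?a x))"
  proof -
    have "(\<Sum>x\<in>A. \<Sum>y\<in>A. q x y * (?a x - ?a y)\<^sup>2) =
        (\<Sum>x\<in>A. \<Sum>y\<in>A. q x y * (?a x)\<^sup>2) + (\<Sum>x\<in>A. \<Sum>y\<in>A. q x y * (?a y)\<^sup>2) - 2 * (\<Sum>x\<in>A. \<Sum>y\<in>A. q x y * (?a x * ?a y))"
      unfolding sum.distrib[symmetric] sum_subtractf[symmetric] sum_distrib_left
      by (intro sum.cong refl) (simp add: power2_diff algebra_simps)
    also have "(\<Sum>x\<in>A. \<Sum>y\<in>A. q x y * (?a x)\<^sup>2) = (\<Sum>x\<in>A. (?a x)\<^sup>2)"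
      using q_row by (intro sum.cong) (simp_all add: sum_distrib_right[symmetric])
    also have "(\<Sum>x\<in>A. \<Sum>y\<in>A. q x y * (?a y)\<^sup>2) = (\<Sum>x\<in>A. (?a x)\<^sup>2)"
      using sum_qop[of "\<lambda>y. (?a y)\<^sup>2"] by (simp add: qop_def)
    also have "(\<Sum>x\<in>A. \<Sum>y\<in>A. q x y * (?a x * ?a y)) = (\<Sum>x\<in>A. ?a x * qop ?a x)"
      by (simp add: qop_def sum_distrib_left algebra_simps)
    finally show ?thesis
      by (simp add: right_diff_distrib sum_subtractf power2_eq_square)
  qed
  have "(\<Sum>x\<in>A. ?a x * (?a x - qop ?a x)) = ?a z - (\<Sum>x\<in>A. ?a x * (m1 z (Suc T) x - ?a x))"
  proof -
    have "(\<Sum>x\<in>A. ?a x * (?a x - qop ?a x)) = (\<Sum>x\<in>A. ?a x * of_bool (x = z) - ?a x * (m1 z (Suc T) x - ?a x))"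
      by (intro sum.cong refl) (simp only: diff right_diff_distrib)
    then show ?thesis
      using z fin by (simp add: sum_subtractf of_bool_def if_distrib[of "\<lambda>t. _ * t"] sum.delta cong: if_cong)
  qed
  \<comment> \<open>The increments of \<open>m1\<close> are nonnegative and sum to 1 over A, so the
    subtracted sum is an average of \<open>?a\<close>.\<close>
  also have "\<dots> \<le> ?M - ?m"
  proof -
    have "?m * (\<Sum>x\<in>A. m1 z (Suc T) x - ?a x) \<le> (\<Sum>x\<in>A. ?a x * (m1 z (Suc T) x - ?a x))"
      unfolding sum_distrib_left using M m1_increment[OF z] by (intro sum_mono mult_right_mono) auto
    then show ?thesis using M[OF z] r1 by simp
  qed
  finally have en: "(\<Sum>x\<in>A. \<Sum>y\<in>A. q x y * (?a x - ?a y)\<^sup>2) \<le> 2 * D"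
    unfolding energy D_def by simp
  have edge: "Q x y * (?a x - ?a y)\<^sup>2 \<le> D" if "x \<in> A" "y \<in> A" for x y
  proof (cases "x = y")
    case False
    let ?h = "\<lambda>(x, y). q x y * (?a x - ?a y)\<^sup>2"
    \<comment> \<open>An edge occurs in the energy in both orientations, which cancels the factor 2
      in \<open>en\<close>.\<close>
    have "?h (x, y) + ?h (y, x) = (\<Sum>p\<in>{(x, y), (y, x)}. ?h p)" using False by simp
    also have "\<dots> \<le> (\<Sum>p\<in>A \<times> A. ?h p)"
      using that fin by (intro sum_mono2) (auto intro!: mult_nonneg_nonneg q_nonneg)
    also have "\<dots> = (\<Sum>x\<in>A. \<Sum>y\<in>A. q x y * (?a x - ?a y)\<^sup>2)"
      by (simp add: sum.cartesian_product)
    finally have "2 * (q x y * (?a x - ?a y)\<^sup>2) \<le> 2 * D"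
      using en that q_sym[of x y] by (simp add: power2_commute)
    moreover have "Q x y * (?a x - ?a y)\<^sup>2 \<le> q x y * (?a x - ?a y)\<^sup>2"
      using Q_le_q[OF that(1)] by (intro mult_right_mono) auto
    ultimately show ?thesis by simp
  qed (simp add: D0)
  have "D\<^sup>2 \<le> \<rho> * D"
    using osc[of ?a D u w] edge u w by (simp add: D_def)
  moreover have "0 \<le> \<rho>"
  proof -
    have "0 \<le> \<rho> * 1" 
    proof -
      have "Q x y * ((\<lambda>_. 0) x - (\<lambda>_. 0) y)\<^sup>2 \<le> (1::real)" for x y by simp
      from osc[of "\<lambda>_. 0" 1 z z] this z show ?thesis by simp
    qed
    then show ?thesis by simp
  qed
  ultimately have "D \<le> \<rho>"
    using D0 by (cases "D = 0") (auto simp: power2_eq_square)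
  then show ?thesis using M xy unfolding D_def by (smt (verit))
qed

lemma m1_le:
  assumes z: "z \<in> A"
  shows "m1 z T z \<le> real T / real (card A) + \<rho>"
proof -
  have "real (card A) * (m1 z T z - \<rho>) \<le> (\<Sum>x\<in>A. m1 z T x)"
    using sum_mono[of A "\<lambda>_. m1 z T z - \<rho>" "m1 z T"] m1_osc[OF z z] by (force simp: algebra_simps)
  moreover have "0 < card A" using fin ne by (simp add: card_gt_0_iff)
  ultimately show ?thesis
    using sum_m1[OF z, of T] by (simp add: field_simps)
qed

definition m2 :: "'a \<Rightarrow> nat \<Rightarrow> 'a \<Rightarrow> real" where
  "m2 z T x = E T x (\<lambda>xs. (real (count_list xs z))\<^sup>2)"

text \<open>Summing over the start means starting from the stationary law, up to normalisation, so
  the first step of the chain disappears. Only a start at z changes the count, through (1 + Y)^2 = 1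
  + 2 Y + Y^2.\<close>

lemma sum_m2_Suc:
  assumes z: "z \<in> A"
  shows "(\<Sum>x\<in>A. m2 z (Suc T) x) = (\<Sum>x\<in>A. m2 z T x) + 2 * m1 z (Suc T) z - 1"
proof -
  have "m2 z (Suc T) x = qop (m2 z T) x + of_bool (x = z) * (1 + 2 * qop (m1 z T) x)" if x: "x \<in> A" for x
  proof -
    have "E T y (\<lambda>xs. (real (count_list (x # xs) z))\<^sup>2) = of_bool (x = z) + 2 * of_bool (x = z) * m1 z T y + m2 z T y" if "y \<in> A" for y
    proof -
      have "E T y (\<lambda>xs. (real (count_list (x # xs) z))\<^sup>2) =
        E T y (\<lambda>xs. of_bool (x = z) + (2 * of_bool (x = z) * real (count_list xs z) + (real (count_list xs z))\<^sup>2))"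
        by (rule arg_cong[of _ _ "E T y"]) (auto simp: power2_eq_square algebra_simps)
      then show ?thesis using that by (simp only: E_add E_const E_cmult m1_def m2_def add_ac)
    qed
    then have "m2 z (Suc T) x = (\<Sum>y\<in>A. q x y * (of_bool (x = z) + 2 * of_bool (x = z) * m1 z T y + m2 z T y))"
      by (simp add: m2_def)
    also have "\<dots> = of_bool (x = z) * (\<Sum>y\<in>A. q x y) + 2 * of_bool (x = z) * qop (m1 z T) x + qop (m2 z T) x"
      by (simp add: qop_def distrib_left sum.distrib sum_distrib_left algebra_simps)
    finally show ?thesis using q_row[OF x] by (simp add: algebra_simps)
  qed
  then have "(\<Sum>x\<in>A. m2 z (Suc T) x) = (\<Sum>x\<in>A. qop (m2 z T) x) + (\<Sum>x\<in>A. of_bool (x = z) * (1 + 2 * qop (m1 z T) x))"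
    by (simp add: sum.distrib)
  also have "(\<Sum>x\<in>A. of_bool (x = z) * (1 + 2 * qop (m1 z T) x)) = 1 + 2 * qop (m1 z T) z"
    using z fin by (simp add: of_bool_def if_distrib[of "\<lambda>t. t * _"] sum.delta cong: if_cong)
  also have "qop (m1 z T) z = m1 z (Suc T) z - 1"
    using m1_Suc[OF z, of z T] by simp
  finally show ?thesis by (simp add: sum_qop)
qed

lemma sum_m2_le:
  assumes z: "z \<in> A"
  shows "(\<Sum>x\<in>A. m2 z T x) \<le> (real T)\<^sup>2 / real (card A) + 2 * \<rho> * real T"
proof (induction T)
  case (Suc T)
  have K: "1 \<le> real (card A)" using fin ne by (simp add: Suc_leI card_gt_0_iff)
  have "(\<Sum>x\<in>A. m2 z (Suc T) x) \<le> ((real T)\<^sup>2 / real (card A) + 2 * \<rho> * real T) + 2 * (real (Suc T) / real (card A) + \<rho>) - 1"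
    using Suc m1_le[OF z, of "Suc T"] unfolding sum_m2_Suc[OF z]
    by (intro diff_right_mono add_mono mult_left_mono) auto
  also have "\<dots> \<le> (real (Suc T))\<^sup>2 / real (card A) + 2 * \<rho> * real (Suc T)"
    using K by (simp add: field_simps power2_eq_square)
  finally show ?case .
qed (simp add: m2_def)

text \<open>Averaged over the start, the sum over z of the squared deviations is at most 2 \<rho> T,
  so some start attains this. That start is not explicit, which is why the walk must later be able
  to reach any point of the cube.\<close>

lemma variance_bound:
  "\<exists>x\<in>A. E T x (\<lambda>xs. \<Sum>z\<in>A. (real (count_list xs z) - real T / real (card A))\<^sup>2) \<le> 2 * \<rho> * real T"
proof (rule ccontr)
  let ?K = "real (card A)" and ?t = "real T"
  let ?V = "\<lambda>x. E T x (\<lambda>xs. \<Sum>z\<in>A. (real (count_list xs z) - ?t / ?K)\<^sup>2)"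
  assume "\<not> ?thesis"
  then have *: "2 * \<rho> * ?t < ?V x" if "x \<in> A" for x using that by force
  have K: "1 \<le> ?K" using fin ne by (simp add: Suc_leI card_gt_0_iff)
  have "?K * (2 * \<rho> * ?t) < (\<Sum>x\<in>A. ?V x)"
    using sum_strict_mono[OF fin ne *] by simp
  also have "(\<Sum>x\<in>A. ?V x) = (\<Sum>x\<in>A. \<Sum>z\<in>A. m2 z T x - 2 * (?t / ?K) * m1 z T x + (?t / ?K)\<^sup>2)"
  proof (rule sum.cong[OF refl])
    fix x assume x: "x \<in> A"
    have "E T x (\<lambda>xs. (real (count_list xs z) - ?t / ?K)\<^sup>2) = m2 z T x - 2 * (?t / ?K) * m1 z T x + (?t / ?K)\<^sup>2" for z
    proof -
      have "E T x (\<lambda>xs. (real (count_list xs z) - ?t / ?K)\<^sup>2) =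
          E T x (\<lambda>xs. (real (count_list xs z))\<^sup>2 + (- 2 * (?t / ?K) * real (count_list xs z) + (?t / ?K)\<^sup>2))"
        by (rule arg_cong[of _ _ "E T x"]) (auto simp: power2_diff)
      then show ?thesis using x by (simp only: E_add E_const E_cmult m1_def m2_def)
    qed
    then show "?V x = (\<Sum>z\<in>A. m2 z T x - 2 * (?t / ?K) * m1 z T x + (?t / ?K)\<^sup>2)"
      by (simp add: E_sum[OF x])
  qed
  also have "\<dots> = (\<Sum>z\<in>A. (\<Sum>x\<in>A. m2 z T x) - 2 * (?t / ?K) * (\<Sum>x\<in>A. m1 z T x) + ?K * (?t / ?K)\<^sup>2)"
    by (subst sum.swap) (simp add: sum.distrib sum_subtractf sum_distrib_left)
  also have "\<dots> \<le> (\<Sum>z\<in>A. 2 * \<rho> * ?t)"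
  proof (rule sum_mono)
    fix z assume z: "z \<in> A"
    have "- 2 * (?t / ?K) * ?t + ?K * (?t / ?K)\<^sup>2 = - ?t\<^sup>2 / ?K"
      using K by (simp add: field_simps power2_eq_square)
    then show "(\<Sum>x\<in>A. m2 z T x) - 2 * (?t / ?K) * (\<Sum>x\<in>A. m1 z T x) + ?K * (?t / ?K)\<^sup>2 \<le> 2 * \<rho> * ?t"
      using sum_m2_le[OF z, of T] by (simp add: sum_m1[OF z])
  qed
  finally show False by simp
qed

text \<open>Chebyshev's inequality for all points at once. Only excess visits are excluded: missing
  ones can be added afterwards, surplus ones cannot be undone.\<close>

lemma concentration:
  fixes s :: nat
  assumes "0 < s" and T: "T = card A * r" and big: "4 * \<rho> * real T \<le> (real s)\<^sup>2"
  shows "\<exists>x\<in>A. E T x (\<lambda>xs. of_bool (\<forall>z\<in>A. count_list xs z < r + s)) \<ge> 1/2"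
proof -
  have K: "1 \<le> real (card A)" using fin ne by (simp add: Suc_leI card_gt_0_iff)
  have r: "real T / real (card A) = real r" using T K by simp
  obtain x where x: "x \<in> A" and V: "E T x (\<lambda>xs. \<Sum>z\<in>A. (real (count_list xs z) - real r)\<^sup>2) \<le> 2 * \<rho> * real T"
    using variance_bound[of T] unfolding r by blast
  let ?I = "\<lambda>xs. of_bool (\<forall>z\<in>A. count_list xs z < r + s) :: real"
  let ?W = "\<lambda>xs. \<Sum>z\<in>A. (real (count_list xs z) - real r)\<^sup>2"
  have "1 + (- 1 / (real s)\<^sup>2) * ?W xs \<le> ?I xs" for xs
  proof (cases "\<forall>z\<in>A. count_list xs z < r + s")
    case True
    have "0 \<le> ?W xs" by (intro sum_nonneg) auto
    then show ?thesis using True by simp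
  next
    case False
    then obtain z where z: "z \<in> A" "r + s \<le> count_list xs z" by force
    then have "real s \<le> real (count_list xs z) - real r" by simp
    then have "(real s)\<^sup>2 \<le> (real (count_list xs z) - real r)\<^sup>2" by (rule power_mono) simp
    also have "\<dots> \<le> ?W xs" using z fin by (intro member_le_sum) auto
    finally have "1 \<le> 1 / (real s)\<^sup>2 * ?W xs" using \<open>0 < s\<close> by (simp add: field_simps)
    moreover have "?I xs = 0" using False by (simp only: of_bool_def if_False)
    ultimately show ?thesis by (simp only: mult_minus_left minus_divide_left[symmetric])
  qed
  then have "E T x (\<lambda>xs. 1 + (- 1 / (real s)\<^sup>2) * ?W xs) \<le> E T x ?I"
    by (rule E_mono[OF x])
  then have "1 - (1 / (real s)\<^sup>2) * E T x ?W \<le> E T x ?I"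
    using x by (simp only: E_add E_const E_cmult)
  moreover have "(1 / (real s)\<^sup>2) * E T x ?W \<le> 1/2"
  proof -
    have "2 * E T x ?W \<le> (real s)\<^sup>2" using V big by linarith
    then show ?thesis using \<open>0 < s\<close> by (simp add: field_simps)
  qed
  ultimately have "1/2 \<le> E T x ?I" by linarith
  then show ?thesis using x by blast
qed

end

text \<open>The model for u is \<open>u x v = lev A v x\<close>. An inequality in
  \<open>u_step\<close> is enough for a lower bound and allows excursions to be truncated.
  \<open>link\<close> provides direct transitions between all points, so that moving on never spends
  visits at intermediate points; \<open>e0\<close> is the chance to escape after the last visit,
  made at x0.\<close>

locale level_chain = sub_chain A Q e c \<rho>
  for A :: "'a set" and Q :: "'a \<Rightarrow> 'a \<Rightarrow> real" and e :: "'a \<Rightarrow> real" and c \<rho> :: real +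
  fixes u :: "'a \<Rightarrow> ('a \<Rightarrow> nat) \<Rightarrow> real" and x0 :: 'a and b e0 :: real
  assumes u_nonneg: "\<And>x v. 0 \<le> u x v"
    and u_step: "\<And>x v. x \<in> A \<Longrightarrow> 0 < v x \<Longrightarrow> (\<Sum>y\<in>A. Q x y * u y (v(x := v x - 1))) \<le> u x v"
    and x0: "x0 \<in> A" and u_end: "e0 \<le> u x0 (\<lambda>z. if z = x0 then 1 else 0)" and e0: "0 \<le> e0"
    and b_pos: "0 < b" and link: "\<And>x y. x \<in> A \<Longrightarrow> y \<in> A \<Longrightarrow> b \<le> Q x y"
    and two: "2 \<le> card A"
begin

lemma Q_le_1: "x \<in> A \<Longrightarrow> y \<in> A \<Longrightarrow> Q x y \<le> 1"
  using member_le_sum[of y A "Q x"] fin Q_nonneg row[of x] e_nonneg[of x] by force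

lemma b_le_1: "b \<le> 1"
  using link[OF x0 x0] Q_le_1[OF x0 x0] by linarith

lemma c_le_1: "c \<le> 1"
  using hold[OF x0] Q_le_1[OF x0 x0] by linarith

lemma rho_nonneg: "0 \<le> \<rho>"
  using osc[of "\<lambda>_. 0" 1 x0 x0] x0 by simp

lemma u_link:
  assumes "x \<in> A" "y \<in> A" "0 < v x" and "0 \<le> t" "t \<le> Q x y"
  shows "t * u y (v(x := v x - 1)) \<le> u x v"
proof -
  have "t * u y (v(x := v x - 1)) \<le> Q x y * u y (v(x := v x - 1))"
    using assms u_nonneg by (intro mult_right_mono) auto
  also have "\<dots> \<le> (\<Sum>y\<in>A. Q x y * u y (v(x := v x - 1)))"
    using assms fin Q_nonneg u_nonneg by (intro member_le_sum) auto
  also have "\<dots> \<le> u x v" using assms by (intro u_step)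
  finally show ?thesis .
qed

text \<open>One explicit strategy: exhaust the visits at the current point by holding, at cost c
  each, then take a link of cost b to a new point of B, and leave x0 for the end. The set B holds
  the unfinished points; the condition on x keeps x0 last.\<close>

lemma lower_bound_deterministic:
  assumes "B \<subseteq> A" "x0 \<in> B" "x \<in> B" "x \<noteq> x0 \<or> B = {x0}" "\<And>z. z \<in> B \<Longrightarrow> 0 < v z" "\<And>z. z \<notin> B \<Longrightarrow> v z = 0"
  shows "c ^ (\<Sum>z\<in>B. v z - 1) * b ^ (card B - 1) * e0 \<le> u x v"
  using assms
proof (induction "\<Sum>z\<in>A. v z" arbitrary: B x v rule: less_induct)
  case less
  have finB: "finite B" using less.prems fin by (blast intro: finite_subset)
  have xA: "x \<in> A" using less.prems by blast
  define v' where "v' = v(x := v x - 1)"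
  have vx: "0 < v x" using less.prems by blast
  have lt: "(\<Sum>z\<in>A. v' z) < (\<Sum>z\<in>A. v z)"
    using xA vx fin unfolding v'_def by (intro sum_strict_mono_ex1) auto
  show ?case
  proof (cases "v x = 1")
    case False
    then have v2: "2 \<le> v x" using vx by linarith
    have "c ^ (\<Sum>z\<in>B. v' z - 1) * b ^ (card B - 1) * e0 \<le> u x v'"
      using less.prems v2 by (intro less.hyps[OF lt]) (auto simp: v'_def)
    moreover have "(\<Sum>z\<in>B. v z - 1) = Suc (\<Sum>z\<in>B. v' z - 1)"
    proof -
      have "(\<Sum>z\<in>B - {x}. v' z - 1) = (\<Sum>z\<in>B - {x}. v z - 1)" by (intro sum.cong) (auto simp: v'_def)
      then show ?thesis
        using sum.remove[OF finB less.prems(3), of "\<lambda>z. v z - 1"] sum.remove[OF finB less.prems(3), of "\<lambda>z. v' z - 1"] v2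
        by (simp add: v'_def)
    qed
    ultimately have "c ^ (\<Sum>z\<in>B. v z - 1) * b ^ (card B - 1) * e0 \<le> c * u x v'"
      using c_pos by (simp add: mult.assoc)
    also have "\<dots> \<le> u x v"
      unfolding v'_def using xA vx c_pos hold[OF xA] by (intro u_link) auto
    finally show ?thesis .
  next
    case True
    show ?thesis
    proof (cases "B = {x0}")
      case True
      then have "v = (\<lambda>z. if z = x0 then 1 else 0)" using less.prems \<open>v x = 1\<close> by auto
      then show ?thesis using True u_end less.prems by simp
    next
      case False
      then have xx: "x \<noteq> x0" using less.prems by blast
      define B' where "B' = B - {x}"
      have B': "x0 \<in> B'" "B' \<subseteq> A" "card B = Suc (card B')" "0 < card B'"
      proof -
        show 1: "x0 \<in> B'" "B' \<subseteq> A" using less.prems xx by (auto simp: B'_def)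
        show "card B = Suc (card B')" using card.remove[OF finB less.prems(3)] by (simp add: B'_def)
        show "0 < card B'" using 1 finB by (auto simp: B'_def card_gt_0_iff)
      qed
      obtain y where y: "y \<in> B'" "y \<noteq> x0 \<or> B' = {x0}"
        using B'(1) by blast
      have "c ^ (\<Sum>z\<in>B'. v' z - 1) * b ^ (card B' - 1) * e0 \<le> u y v'"
        using less.prems B' y True by (intro less.hyps[OF lt]) (auto simp: v'_def B'_def)
      moreover have "(\<Sum>z\<in>B. v z - 1) = (\<Sum>z\<in>B'. v' z - 1)"
        using sum.remove[OF finB less.prems(3), of "\<lambda>z. v z - 1"] True
        unfolding B'_def by (auto simp: v'_def intro!: sum.cong)
      moreover have "b ^ (card B - 1) = b * b ^ (card B' - 1)"
        using B' by (cases "card B'") auto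
      ultimately have "c ^ (\<Sum>z\<in>B. v z - 1) * b ^ (card B - 1) * e0 \<le> b * u y v'"
        using b_pos by (simp add: mult.assoc mult.left_commute[of _ b])
      also have "\<dots> \<le> u x v"
        unfolding v'_def using xA vx b_pos link[OF xA, of y] B' y by (intro u_link) auto
      finally show ?thesis .
    qed
  qed
qed

definition \<kappa> :: real where "\<kappa> = b ^ card A * e0"

text \<open>The correction has to start wherever the random phase ended, possibly at x0. So the
  current visit at x is spent on a link to some w other than x0, and two visits in reserve at every
  point keep all counts positive after that.\<close>

lemma lower_bound_any_start:
  assumes x: "x \<in> A" and v: "\<And>z. z \<in> A \<Longrightarrow> 2 \<le> v z" "\<And>z. z \<notin> A \<Longrightarrow> v z = 0"
  shows "\<kappa> * c ^ (\<Sum>z\<in>A. v z) \<le> u x v"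
proof -
  have "A \<noteq> {x0}" using two by auto
  then obtain w where w: "w \<in> A" "w \<noteq> x0" using x0 by blast
  define v' where "v' = v(x := v x - 1)"
  have "0 < v' z" if "z \<in> A" for z using v(1)[OF that] by (auto simp: v'_def)
  then have *: "c ^ (\<Sum>z\<in>A. v' z - 1) * b ^ (card A - 1) * e0 \<le> u w v'"
    using w x0 v x by (intro lower_bound_deterministic) (auto simp: v'_def)
  have "(\<Sum>z\<in>A. v' z - 1) \<le> (\<Sum>z\<in>A. v z)" by (intro sum_mono) (auto simp: v'_def)
  then have "c ^ (\<Sum>z\<in>A. v z) \<le> c ^ (\<Sum>z\<in>A. v' z - 1)"
    using c_pos c_le_1 by (intro power_decreasing) auto
  moreover have "b ^ card A = b * b ^ (card A - 1)" using two by (cases "card A") auto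
  ultimately have "\<kappa> * c ^ (\<Sum>z\<in>A. v z) \<le> b * (c ^ (\<Sum>z\<in>A. v' z - 1) * b ^ (card A - 1) * e0)"
    using b_pos e0 by (simp add: \<kappa>_def mult_left_mono mult_ac)
  also have "\<dots> \<le> b * u w v'" using * b_pos by simp
  also have "\<dots> \<le> u x v"
    unfolding v'_def using x w b_pos link v(1)[OF x] by (intro u_link) auto
  finally show ?thesis .
qed

text \<open>The density of Q with respect to q on a holding step.\<close>

definition a :: "'a \<Rightarrow> real" where "a z = Q z z / q z z"

lemma a_pos: "z \<in> A \<Longrightarrow> 0 < a z" and a_le_1: "z \<in> A \<Longrightarrow> a z \<le> 1"
  and a_ge: "z \<in> A \<Longrightarrow> exp (- e z / c) \<le> a z"
proof -
  assume z: "z \<in> A"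
  have Q: "c \<le> Q z z" "0 < Q z z" "0 \<le> e z" using hold[OF z] c_pos e_nonneg[OF z] by auto
  then show "0 < a z" "a z \<le> 1" by (auto simp: a_def q_def)
  have "a z = 1 / (1 + e z / Q z z)" using Q by (simp add: a_def q_def field_simps)
  moreover have "e z / Q z z \<le> e z / c" using Q c_pos by (intro divide_left_mono) auto
  moreover have "1 + e z / c \<le> exp (e z / c)" by (rule exp_ge_add_one_self)
  moreover have "0 \<le> e z / Q z z" using Q by simp
  ultimately have "1 / exp (e z / c) \<le> a z"
    by (smt (verit) divide_left_mono exp_gt_zero mult_pos_pos)
  then show "exp (- e z / c) \<le> a z" by (simp add: exp_minus inverse_eq_divide)
qed

text \<open>The true density is 1 on jumps to other points. Charging \<open>a x\<close> at every
  departure from x is a lower bound that depends on the visit counts only.\<close>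

lemma a_q_le: "x \<in> A \<Longrightarrow> y \<in> A \<Longrightarrow> q x y * a x \<le> Q x y"
proof (cases "x = y")
  case True
  assume "x \<in> A" "y \<in> A"
  then have "0 < q x x" using hold[of x] c_pos e_nonneg[of x] by (simp add: q_def add_pos_nonneg)
  then show ?thesis using True by (simp add: a_def)
next
  case False
  assume "x \<in> A" "y \<in> A"
  then show ?thesis using False a_le_1[of x] Q_nonneg[of x y] by (simp add: q_def mult_left_le)
qed

text \<open>Bounds from below what one trajectory of q contributes: two visits must be left at each
  point, the product is the change of measure, and the last factor is the cost of the deterministic
  correction by \<open>lower_bound_any_start\<close>.\<close>

definition payoff :: "('a \<Rightarrow> nat) \<Rightarrow> 'a list \<Rightarrow> real" where
  "payoff v xs = of_bool (\<forall>z\<in>A. count_list xs z + 2 \<le> v z) * (\<Prod>z\<in>A. a z ^ count_list xs z) *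
     (\<kappa> * c ^ (\<Sum>z\<in>A. v z - count_list xs z))"

lemma payoff_nonneg: "0 \<le> payoff v xs"
  using a_pos c_pos b_pos e0
  by (auto simp: payoff_def \<kappa>_def intro!: mult_nonneg_nonneg prod_nonneg zero_le_power intro: less_imp_le)

lemma payoff_Cons:
  assumes x: "x \<in> A" and vx: "0 < v x"
  shows "payoff v (x # xs) = a x * payoff (v(x := v x - 1)) xs"
proof -
  have 1: "(\<forall>z\<in>A. count_list (x # xs) z + 2 \<le> v z) \<longleftrightarrow> (\<forall>z\<in>A. count_list xs z + 2 \<le> (v(x := v x - 1)) z)"
    using vx by (intro ball_cong) auto
  have 2: "(\<Sum>z\<in>A. v z - count_list (x # xs) z) = (\<Sum>z\<in>A. (v(x := v x - 1)) z - count_list xs z)"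
    by (intro sum.cong) auto
  have "(\<Prod>z\<in>A - {x}. a z ^ count_list (x # xs) z) = (\<Prod>z\<in>A - {x}. a z ^ count_list xs z)"
    by (intro prod.cong) auto
  then have 3: "(\<Prod>z\<in>A. a z ^ count_list (x # xs) z) = a x * (\<Prod>z\<in>A. a z ^ count_list xs z)"
    using prod.remove[OF fin x, of "\<lambda>z. a z ^ count_list (x # xs) z"] prod.remove[OF fin x, of "\<lambda>z. a z ^ count_list xs z"]
    by simp
  show ?thesis unfolding payoff_def 1 2 3 by simp
qed

text \<open>Each step under q is turned into a step under Q by the density, and
  \<open>u_step\<close> absorbs it; at T = 0 the correction takes over.\<close>

lemma E_payoff_le:
  "x \<in> A \<Longrightarrow> (\<And>z. z \<notin> A \<Longrightarrow> v z = 0) \<Longrightarrow> E T x (payoff v) \<le> u x v"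
proof (induction T arbitrary: x v)
  case 0
  then show ?case
    using lower_bound_any_start[of x v] u_nonneg[of x v] by (auto simp: payoff_def numeral_2_eq_2)
next
  case (Suc T)
  show ?case
  proof (cases "v x = 0")
    case True
    have "payoff v (x # xs) = 0" for xs
      using True \<open>x \<in> A\<close> by (auto simp: payoff_def)
    then have "E (Suc T) x (payoff v) = 0" by (simp add: E_const)
    then show ?thesis using u_nonneg[of x v] by simp
  next
    case False
    define v' where "v' = v(x := v x - 1)"
    have "E (Suc T) x (payoff v) = (\<Sum>y\<in>A. q x y * a x * E T y (payoff v'))"
      using payoff_Cons[of x v] Suc.prems False by (simp add: E_cmult v'_def mult.assoc)
    also have "\<dots> \<le> (\<Sum>y\<in>A. Q x y * u y v')"
    proof (rule sum_mono)
      fix y assume y: "y \<in> A"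
      have "0 \<le> E T y (payoff v')"
        using E_mono[OF y, of T "\<lambda>_. 0" "payoff v'"] payoff_nonneg E_const[OF y, of T 0] by simp
      moreover have "E T y (payoff v') \<le> u y v'"
        using y Suc.prems by (intro Suc.IH) (auto simp: v'_def)
      ultimately show "q x y * a x * E T y (payoff v') \<le> Q x y * u y v'"
        using a_q_le[OF Suc.prems(1) y] Q_nonneg[OF Suc.prems(1) y] by (intro mult_mono) auto
    qed
    also have "\<dots> \<le> u x v"
      unfolding v'_def using Suc.prems False by (intro u_step) auto
    finally show ?thesis .
  qed
qed

lemma level_lower_bound:
  fixes m s :: nat
  assumes m: "0 < m" and s: "0 < s" and big: "4 * \<rho> * (real (card A) * real m) \<le> (real s)\<^sup>2"
  shows "\<exists>x\<in>A. 1/2 * exp (- (real m * (\<Sum>z\<in>A. e z) / c)) * b ^ card A * e0 * c ^ (card A * Suc s)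
      \<le> u x (\<lambda>z. if z \<in> A then m else 0)"
proof -
  let ?v = "\<lambda>z. if z \<in> A then m else 0" and ?K = "card A"
  define \<theta> where "\<theta> = exp (- (real m * (\<Sum>z\<in>A. e z) / c))"
  have \<theta>: "0 < \<theta>" "\<theta> \<le> 1"
    using c_pos e_nonneg by (auto simp: \<theta>_def sum_nonneg)
  have \<kappa>0: "0 \<le> \<kappa>" using b_pos e0 by (simp add: \<kappa>_def)
  show ?thesis
  proof (cases "m \<le> Suc s")
    \<comment> \<open>Here m is within the range of the fluctuations, and all visits are made by the
      deterministic strategy.\<close>
    case True
    have "A \<noteq> {x0}" using two by auto
    then obtain w where w: "w \<in> A" "w \<noteq> x0" using x0 by blast
    have "c ^ (\<Sum>z\<in>A. ?v z - 1) * b ^ (?K - 1) * e0 \<le> u w ?v"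
      using w x0 m by (intro lower_bound_deterministic) auto
    moreover have "c ^ (?K * Suc s) \<le> c ^ (\<Sum>z\<in>A. ?v z - 1)"
    proof -
      have "(\<Sum>z\<in>A. ?v z - 1) = ?K * (m - 1)" by simp
      also have "\<dots> \<le> ?K * Suc s" using True by (intro mult_le_mono2) simp
      finally show ?thesis using c_pos c_le_1 by (intro power_decreasing) auto
    qed
    moreover have "b ^ ?K \<le> b ^ (?K - 1)"
      using b_pos b_le_1 by (intro power_decreasing) auto
    ultimately have "b ^ ?K * e0 * c ^ (?K * Suc s) \<le> u w ?v"
    proof -
      have "b ^ ?K * e0 * c ^ (?K * Suc s) \<le> b ^ (?K - 1) * e0 * c ^ (\<Sum>z\<in>A. ?v z - 1)"
        using b_pos c_pos e0 \<open>b ^ ?K \<le> b ^ (?K - 1)\<close> \<open>c ^ (?K * Suc s) \<le> _\<close>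
        by (intro mult_mono mult_nonneg_nonneg) auto
      also have "\<dots> = c ^ (\<Sum>z\<in>A. ?v z - 1) * b ^ (?K - 1) * e0" by (simp only: mult_ac)
      finally show ?thesis using \<open>c ^ (\<Sum>z\<in>A. ?v z - 1) * b ^ (?K - 1) * e0 \<le> u w ?v\<close> by linarith
    qed
    moreover have "(1/2 * \<theta>) * (b ^ ?K * e0 * c ^ (?K * Suc s)) \<le> 1 * (b ^ ?K * e0 * c ^ (?K * Suc s))"
      using \<theta> b_pos e0 c_pos by (intro mult_right_mono) auto
    ultimately show ?thesis
      using w unfolding \<theta>_def[symmetric] by (intro bexI[of _ w]) (auto simp: mult.assoc)
  next
    case False
    \<comment> \<open>The mean number of visits is set s + 1 below the target, so that an excess of
      less than s still leaves the two visits in reserve that \<open>payoff\<close> demands.\<close>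
    define r where "r = m - Suc s"
    have mr: "m = r + s + 1" using False by (simp add: r_def)
    define T where "T = ?K * r"
    have "4 * \<rho> * real T \<le> 4 * \<rho> * (real ?K * real m)"
      using rho_nonneg by (intro mult_left_mono) (auto simp: T_def mr mult_left_mono)
    then have "4 * \<rho> * real T \<le> (real s)\<^sup>2" using big by linarith
    from concentration[OF s T_def this] obtain x where x: "x \<in> A"
      and Ex: "1/2 \<le> E T x (\<lambda>xs. of_bool (\<forall>z\<in>A. count_list xs z < r + s))" by blast
    let ?C = "\<theta> * (\<kappa> * c ^ (?K * Suc s))"
    have "E T x (\<lambda>xs. ?C * of_bool (\<forall>z\<in>A. count_list xs z < r + s)) \<le> E T x (payoff ?v)"
    proof (rule E_mono[OF x])
      fix xs assume xs: "set xs \<subseteq> A" "length xs = T"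
      show "?C * of_bool (\<forall>z\<in>A. count_list xs z < r + s) \<le> payoff ?v xs"
      proof (cases "\<forall>z\<in>A. count_list xs z < r + s")
        case True
        have le: "\<forall>z\<in>A. count_list xs z + 2 \<le> m" using True by (auto simp: mr dest!: bspec)
        \<comment> \<open>The trajectory has the fixed length K r, so the total deficit is
          deterministic although the single deficits are not.\<close>
        have sum: "(\<Sum>z\<in>A. ?v z - count_list xs z) = ?K * Suc s"
        proof -
          have "(\<Sum>z\<in>A. ?v z - count_list xs z) = (\<Sum>z\<in>A. m) - (\<Sum>z\<in>A. count_list xs z)"
            using le by (subst sum_subtractf_nat[symmetric]) (auto intro!: sum.cong dest!: bspec)
          also have "(\<Sum>z\<in>A. count_list xs z) = T" using sum_count_set[OF xs(1) fin] xs(2) by simp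
          finally show ?thesis by (simp add: T_def mr algebra_simps)
        qed
        have "\<theta> = (\<Prod>z\<in>A. exp (- e z / c) ^ m)"
          unfolding \<theta>_def using fin
          by (simp add: exp_sum[symmetric] exp_of_nat_mult[symmetric] sum_negf sum_divide_distrib sum_distrib_left)
        also have "\<dots> \<le> (\<Prod>z\<in>A. a z ^ count_list xs z)"
        proof (intro prod_mono conjI)
          fix z assume z: "z \<in> A"
          have "exp (- e z / c) ^ m \<le> a z ^ m" using a_ge[OF z] by (intro power_mono) auto
          also have "\<dots> \<le> a z ^ count_list xs z"
            using le z a_pos[OF z] a_le_1[OF z] by (intro power_decreasing) (auto dest!: bspec)
          finally show "exp (- e z / c) ^ m \<le> a z ^ count_list xs z" .
        qed simp
        finally have "\<theta> \<le> (\<Prod>z\<in>A. a z ^ count_list xs z)" .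
        then have "?C \<le> (\<Prod>z\<in>A. a z ^ count_list xs z) * (\<kappa> * c ^ (?K * Suc s))"
          using \<kappa>0 c_pos by (intro mult_right_mono) auto
        moreover have "(\<forall>z\<in>A. count_list xs z + 2 \<le> ?v z) = True" using le by auto
        then have "payoff ?v xs = (\<Prod>z\<in>A. a z ^ count_list xs z) * (\<kappa> * c ^ (?K * Suc s))"
          unfolding payoff_def sum by (simp only: of_bool_def if_True mult_1)
        moreover have "of_bool (\<forall>z\<in>A. count_list xs z < r + s) = (1 :: real)"
          using True by auto
        ultimately show ?thesis by (simp only: mult_1_right)
      next
        case False
        then show ?thesis using payoff_nonneg[of ?v xs] by (simp only: of_bool_def if_False mult_zero_right)
      qed
    qed
    also have "\<dots> \<le> u x ?v" using x by (intro E_payoff_le) auto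
    finally have "?C * E T x (\<lambda>xs. of_bool (\<forall>z\<in>A. count_list xs z < r + s)) \<le> u x ?v"
      by (simp only: E_cmult)
    moreover have "?C * (1/2) \<le> ?C * E T x (\<lambda>xs. of_bool (\<forall>z\<in>A. count_list xs z < r + s))"
      using Ex \<theta> \<kappa>0 c_pos by (intro mult_left_mono) auto
    ultimately have "?C * (1/2) \<le> u x ?v" by linarith
    then show ?thesis
      using x unfolding \<theta>_def[symmetric] \<kappa>_def by (intro bexI[of _ x]) (auto simp: mult_ac)
  qed
qed

end

section \<open>The walk observed on a finite set\<close>

text \<open>Probability of avoiding A at times 1 to j and being at w at time j + 1.\<close>

primrec fret :: "(int ^ 'd::finite) set \<Rightarrow> nat \<Rightarrow> int ^ 'd \<Rightarrow> int ^ 'd \<Rightarrow> real" where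
  "fret A 0 x w = step_prob TYPE('d) * of_bool (w \<in> nbhd x)"
| "fret A (Suc j) x w = step_prob TYPE('d) * (\<Sum>y\<in>nbhd x - A. fret A j y w)"

lemma fret_nonneg: "0 \<le> fret A j x w"
  by (induction j arbitrary: x) (simp_all add: sum_nonneg)

lemma fret_Suc_right:
  fixes x w :: "int ^ 'd::finite"
  shows "fret A (Suc j) x w = step_prob TYPE('d) * (\<Sum>y\<in>nbhd w - A. fret A j x y)"
proof (induction j arbitrary: x)
  case 0
  have "(nbhd x - A) \<inter> {y. w \<in> nbhd y} = (nbhd w - A) \<inter> {y. y \<in> nbhd x}"
    by (auto simp: nbhd_sym)
  then have "(\<Sum>y\<in>nbhd x - A. of_bool (w \<in> nbhd y)) = (\<Sum>y\<in>nbhd w - A. of_bool (y \<in> nbhd x) :: real)"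
    by (simp add: sum_of_bool_eq)
  then show ?case by (simp add: sum_divide_distrib[symmetric])
next
  case (Suc j)
  have "fret A (Suc (Suc j)) x w = step_prob TYPE('d) * (\<Sum>y\<in>nbhd x - A. step_prob TYPE('d) * (\<Sum>y'\<in>nbhd w - A. fret A j y y'))"
    using Suc.IH by (simp only: fret.simps(2)[of A "Suc j"])
  also have "\<dots> = step_prob TYPE('d) * (\<Sum>y'\<in>nbhd w - A. step_prob TYPE('d) * (\<Sum>y\<in>nbhd x - A. fret A j y y'))"
    unfolding sum_distrib_left by (subst sum.swap) simp
  finally show ?case by (simp only: fret.simps(2)[of A j])
qed

lemma fret_sym: "fret A j x w = fret A j w x"
proof (induction j arbitrary: x w)
  case (Suc j)
  show ?case
    by (subst fret_Suc_right) (auto simp only: fret.simps(2) intro!: arg_cong2[of _ _ _ _ times] sum.cong Suc.IH)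
qed (simp add: nbhd_sym)

lemma sum_fret:
  fixes x :: "int ^ 'd::finite"
  assumes "finite A"
  shows "(\<Sum>w\<in>A. fret A j x w) = esc A j x - esc A (Suc j) x"
proof (induction j arbitrary: x)
  case 0
  have "A \<inter> {w. w \<in> nbhd x} = nbhd x - (nbhd x - A)" by auto
  then have "real (card (A \<inter> {w. w \<in> nbhd x})) = real (card (nbhd x)) - real (card (nbhd x - A))"
    by (simp add: card_Diff_subset of_nat_diff card_mono)
  then have "(\<Sum>w\<in>A. of_bool (w \<in> nbhd x)) = 2 * real CARD('d) + 1 - real (card (nbhd x - A))"
    using assms by (simp add: sum_of_bool_eq card_nbhd)
  then have "(\<Sum>w\<in>A. fret A 0 x w) = step_prob TYPE('d) * (2 * real CARD('d) + 1 - real (card (nbhd x - A)))"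
    by (simp only: fret.simps(1) sum_distrib_left[symmetric])
  also have "\<dots> = 1 - step_prob TYPE('d) * real (card (nbhd x - A))"
    by (simp add: right_diff_distrib add_nonneg_eq_0_iff field_simps)
  finally show ?case by simp
next
  case (Suc j)
  have "(\<Sum>w\<in>A. fret A (Suc j) x w) = step_prob TYPE('d) * (\<Sum>y\<in>nbhd x - A. \<Sum>w\<in>A. fret A j y w)"
    unfolding fret.simps(2) sum_distrib_left[symmetric] by (subst sum.swap) simp
  also have "\<dots> = step_prob TYPE('d) * (\<Sum>y\<in>nbhd x - A. esc A j y) - step_prob TYPE('d) * (\<Sum>y\<in>nbhd x - A. esc A (Suc j) y)"
    by (simp only: Suc.IH sum_subtractf right_diff_distrib)
  finally show ?case by (simp only: esc.simps(2)[of A])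
qed

text \<open>The kernel Q of the walk observed on A, restricted to returns within J steps. The mass
  lost is then exactly \<open>esc A J\<close>, which takes the role of the killing e.\<close>

definition ret :: "(int ^ 'd::finite) set \<Rightarrow> nat \<Rightarrow> int ^ 'd \<Rightarrow> int ^ 'd \<Rightarrow> real" where
  "ret A J x w = (\<Sum>j<J. fret A j x w)"

lemma ret_nonneg: "0 \<le> ret A J x w"
  by (simp add: ret_def sum_nonneg fret_nonneg)

lemma ret_sym: "ret A J x w = ret A J w x"
  by (simp add: ret_def fret_sym[of A _ x w])

lemma fret_le_ret: "j < J \<Longrightarrow> fret A j x w \<le> ret A J x w"
  unfolding ret_def by (rule member_le_sum) (auto simp: fret_nonneg)

lemma sum_ret: "finite A \<Longrightarrow> (\<Sum>w\<in>A. ret A J x w) + esc A J x = 1"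
proof -
  assume A: "finite A"
  have "(\<Sum>w\<in>A. ret A J x w) = (\<Sum>j<J. esc A j x - esc A (Suc j) x)"
    unfolding ret_def by (subst sum.swap) (simp only: sum_fret[OF A])
  also have "\<dots> = esc A 0 x - esc A J x" by (rule sum_lessThan_telescope')
  finally show ?thesis by simp
qed

text \<open>Optional stopping at the return to A, truncated at J: a function harmonic off A is
  averaged exactly, and as it is nonnegative, dropping the paths that have not yet returned loses in
  one direction only.\<close>

lemma sum_ret_le:
  fixes h :: "int ^ 'd::finite \<Rightarrow> real"
  assumes A: "finite A" and h: "\<And>y. 0 \<le> h y"
    and harm: "\<And>y. y \<notin> A \<Longrightarrow> h y = step_prob TYPE('d) * (\<Sum>y'\<in>nbhd y. h y')"
  shows "(\<Sum>w\<in>A. ret A J x w * h w) \<le> step_prob TYPE('d) * (\<Sum>y\<in>nbhd x. h y)"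
proof (induction J arbitrary: x)
  case 0
  then show ?case by (simp add: ret_def sum_nonneg h)
next
  case (Suc J)
  let ?c = "step_prob TYPE('d)"
  have "ret A (Suc J) x w = ?c * of_bool (w \<in> nbhd x) + ?c * (\<Sum>y\<in>nbhd x - A. ret A J y w)" for w
  proof -
    have "ret A (Suc J) x w = fret A 0 x w + (\<Sum>j<J. fret A (Suc j) x w)"
      unfolding ret_def by (rule sum.lessThan_Suc_shift)
    also have "(\<Sum>j<J. fret A (Suc j) x w) = ?c * (\<Sum>y\<in>nbhd x - A. ret A J y w)"
      unfolding ret_def fret.simps(2) sum_distrib_left[symmetric] by (subst sum.swap) simp
    finally show ?thesis by simp
  qed
  then have "(\<Sum>w\<in>A. ret A (Suc J) x w * h w) =
      ?c * (\<Sum>w\<in>A. of_bool (w \<in> nbhd x) * h w) + ?c * (\<Sum>w\<in>A. (\<Sum>y\<in>nbhd x - A. ret A J y w) * h w)"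
    by (simp only: distrib_right sum.distrib mult.assoc sum_distrib_left[symmetric])
  also have "(\<Sum>w\<in>A. of_bool (w \<in> nbhd x) * h w) = (\<Sum>w\<in>nbhd x \<inter> A. h w)"
    using A by (intro sum.mono_neutral_cong_right) auto
  also have "(\<Sum>w\<in>A. (\<Sum>y\<in>nbhd x - A. ret A J y w) * h w) = (\<Sum>y\<in>nbhd x - A. \<Sum>w\<in>A. ret A J y w * h w)"
    by (simp only: sum_distrib_right) (rule sum.swap)
  also have "?c * (\<Sum>w\<in>nbhd x \<inter> A. h w) + ?c * (\<Sum>y\<in>nbhd x - A. \<Sum>w\<in>A. ret A J y w * h w) \<le>
      ?c * (\<Sum>w\<in>nbhd x \<inter> A. h w) + ?c * (\<Sum>y\<in>nbhd x - A. h y)"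
    using Suc.IH harm by (intro add_left_mono mult_left_mono sum_mono) auto
  also have "\<dots> = ?c * (\<Sum>y\<in>nbhd x. h y)"
    using sum.Int_Diff[of "nbhd x" h A] by (simp add: add_divide_distrib)
  finally show ?case .
qed

lemma lev_ret_in:
  assumes "finite A" "x \<in> A" "0 < v x"
  shows "(\<Sum>w\<in>A. ret A J x w * lev A (v(x := v x - 1)) w) \<le> lev A v x"
  using sum_ret_le[OF assms(1), of "lev A (v(x := v x - 1))" J x] lev_step_in[OF assms(2), of v] assms(3)
  by (simp add: lev_nonneg lev_step_out[of _ A])

lemma lev_ret_out:
  assumes "finite A" "x \<notin> A" "w \<in> A"
  shows "ret A J x w * lev A v w \<le> lev A v x"
proof -
  have "ret A J x w * lev A v w \<le> (\<Sum>w\<in>A. ret A J x w * lev A v w)"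
    using assms by (intro member_le_sum) (auto simp: ret_nonneg lev_nonneg)
  also have "\<dots> \<le> lev A v x"
    using sum_ret_le[OF assms(1), of "lev A v" J x] lev_step_out[OF assms(2), of v]
    by (simp add: lev_nonneg lev_step_out[of _ A])
  finally show ?thesis .
qed

lemma escape_le_lev_single:
  assumes "x \<in> A"
  shows "escape A x \<le> lev A (\<lambda>z. if z = x then 1 else 0) x"
proof -
  interpret prob_space "walk_law x" by (rule prob_space_walk_law)
  have "AE S in walk_law x. S \<in> {S. \<forall>i>0. S i \<notin> A} \<longrightarrow> S \<in> lev_event A (\<lambda>z. if z = x then 1 else 0)"
    using start_AE[of x]
  proof eventually_elim
    case (elim S)
    show ?case
    proof
      assume S: "S \<in> {S. \<forall>i>0. S i \<notin> A}"
      have e: "S = case_nat (S 0) (\<lambda>i. S (Suc i))" by (auto simp: fun_eq_iff split: nat.split)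
      have "local_time S z = of_nat (if z = x then 1 else 0)" if "z \<in> A" for z
      proof -
        have "\<nexists>i. S (Suc i) = z" using S that by auto
        then have "local_time (\<lambda>i. S (Suc i)) z = 0" using local_time_pos_visits by blast
        then have "local_time S z = indicator {z} (S 0)"
          by (subst e) (simp only: local_time_case_nat add_0_right)
        then show ?thesis using elim by (auto simp: indicator_def)
      qed
      then show "S \<in> lev_event A (\<lambda>z. if z = x then 1 else 0)" by (auto simp: lev_event_def)
    qed
  qed
  then show ?thesis
    unfolding escape_def lev_def using sets_avoid'[of A] sets_lev_event[of A]
    by (intro finite_measure_mono_AE) (auto simp: sets_walk_law)
qed

text \<open>Finite-horizon last-exit decomposition from an arbitrary start. Being at z at time k and
  off A for the next J steps are disjoint events for k < N, because two such times differ by less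
  than J.\<close>

lemma sum_hk_esc_le_1:
  fixes w :: "int ^ 'd::finite"
  assumes A: "finite A" and N: "N \<le> J"
  shows "(\<Sum>k<N. \<Sum>z\<in>A. hk k w z * esc A J z) \<le> 1"
proof -
  interpret prob_space "walk_law w" by (rule prob_space_walk_law)
  define R where "R = {S :: 'd path. \<forall>i\<in>{1..J}. S i \<notin> A}"
  define L where "L = (\<lambda>(k :: nat, z). {S. S k = z \<and> (\<lambda>i. S (i + k)) \<in> R})"
  have R: "R \<in> sets traj" unfolding R_def by (rule sets_avoid)
  have ev: "L p \<in> events" for p
    using sets_visit_shift[OF R, of "fst p" "snd p"] by (simp add: L_def case_prod_unfold sets_walk_law)
  have disj: "disjoint_family_on L ({..<N} \<times> A)"
  proof -
    have "p = p'" if "p \<in> {..<N} \<times> A" "p' \<in> {..<N} \<times> A" "S \<in> L p" "S \<in> L p'" "fst p \<le> fst p'" for p p' S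
    proof -
      obtain k z k' z' where p: "p = (k, z)" "p' = (k', z')" by (cases p; cases p')
      have S: "S k = z" "S k' = z'" "\<forall>i\<in>{1..J}. S (i + k) \<notin> A" "z' \<in> A" "k \<le> k'" "k' < N"
        using that by (auto simp: L_def R_def p)
      have "k' = k"
      proof (rule ccontr)
        assume "k' \<noteq> k"
        then have "k' - k \<in> {1..J}" using S N by auto
        then have "S ((k' - k) + k) \<notin> A" using S(3) by blast
        then show False using S by auto
      qed
      then show ?thesis using S p by auto
    qed
    then have "p = p'" if "p \<in> {..<N} \<times> A" "p' \<in> {..<N} \<times> A" "S \<in> L p" "S \<in> L p'" for p p' S
      using that by (metis nle_le)
    then show ?thesis by (auto simp: disjoint_family_on_def)
  qed
  have "(\<Sum>k<N. \<Sum>z\<in>A. hk k w z * esc A J z) = (\<Sum>k<N. \<Sum>z\<in>A. prob (L (k, z)))"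
  proof -
    have "measure (walk_law z) R = esc A J z" for z :: "int ^ 'd"
      unfolding R_def by (rule esc_eq_measure)
    then have "prob (L (k, z)) = hk k w z * esc A J z" for k z
      by (simp only: L_def prod.case markov[OF R])
    then show ?thesis by (simp only:)
  qed
  also have "\<dots> = (\<Sum>p\<in>{..<N} \<times> A. prob (L p))"
    by (simp add: sum.cartesian_product)
  also have "\<dots> = prob (\<Union>p\<in>{..<N} \<times> A. L p)"
    using A ev disj by (intro finite_measure_finite_Union[symmetric]) auto
  finally show ?thesis by simp
qed

section \<open>Upper bound for the escape probabilities of the cube\<close>

definition sqn :: "int ^ 'd::finite \<Rightarrow> real" where
  "sqn x = (\<Sum>i\<in>UNIV. (real_of_int (x $ i))\<^sup>2)"

lemma sqn_nbhd:
  fixes x :: "int ^ 'd::finite"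
  shows "step_prob TYPE('d) * (\<Sum>y\<in>nbhd x. sqn (y - z)) \<le> sqn (x - z) + 1"
proof -
  have "sqn (x + axis i 1 - z) + sqn (x - axis i 1 - z) = 2 * sqn (x - z) + 2" for i
  proof -
    have "sqn (x + axis i 1 - z) + sqn (x - axis i 1 - z) =
        (\<Sum>j\<in>UNIV. 2 * (real_of_int ((x - z) $ j))\<^sup>2 + (if j = i then 2 else 0))"
      unfolding sqn_def sum.distrib[symmetric]
      by (intro sum.cong refl) (auto simp: axis_def power2_eq_square algebra_simps)
    then show ?thesis by (simp add: sum.distrib sqn_def sum_distrib_left)
  qed
  then have "(\<Sum>y\<in>nbhd x. sqn (y - z)) = (2 * real CARD('d) + 1) * sqn (x - z) + 2 * real CARD('d)"
    by (simp add: sum_nbhd algebra_simps)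
  then show ?thesis by (simp add: field_simps)
qed

text \<open>Markov's inequality for the squared distance to z, whose mean grows by at most 1 per
  step; carried out by induction on k.\<close>

lemma sum_hk_ball:
  fixes x z :: "int ^ 'd::finite"
  assumes B: "finite B" and s: "0 < r" and out: "\<And>w. w \<notin> B \<Longrightarrow> r \<le> sqn (w - z)"
  shows "1 - (sqn (x - z) + real k) / r \<le> (\<Sum>w\<in>B. hk k x w)"
proof (induction k arbitrary: x)
  case 0
  have "0 \<le> sqn (x - z)" by (simp add: sqn_def sum_nonneg)
  then have "1 - sqn (x - z) / r \<le> of_bool (x \<in> B)"
    using out[of x] s by (cases "x \<in> B") auto
  then show ?case using B by (simp add: of_bool_def sum.delta')
next
  case (Suc k)
  let ?c = "step_prob TYPE('d)"
  have one: "?c * (\<Sum>y\<in>nbhd x. 1) = 1" by (simp add: card_nbhd field_simps add_nonneg_eq_0_iff)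
  have "1 - (sqn (x - z) + real (Suc k)) / r \<le> 1 - (?c * (\<Sum>y\<in>nbhd x. sqn (y - z)) + real k) / r"
    using sqn_nbhd[where x = x and z = z] s by (intro diff_left_mono divide_right_mono) auto
  also have "\<dots> = ?c * (\<Sum>y\<in>nbhd x. 1) - (?c * (\<Sum>y\<in>nbhd x. sqn (y - z)) + (?c * (\<Sum>y\<in>nbhd x. 1)) * real k) / r"
    unfolding one by simp
  also have "\<dots> = ?c * (\<Sum>y\<in>nbhd x. 1 - (sqn (y - z) + real k) / r)"
    by (simp only: sum_subtractf sum.distrib sum_divide_distrib[symmetric] add_divide_distrib sum_constant right_diff_distrib distrib_left)
       (simp add: field_simps)
  also have "\<dots> \<le> ?c * (\<Sum>y\<in>nbhd x. \<Sum>w\<in>B. hk k y w)"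
    using Suc.IH by (intro mult_left_mono sum_mono) auto
  also have "\<dots> = (\<Sum>w\<in>B. hk (Suc k) x w)"
    unfolding hk.simps sum_distrib_left[symmetric] by (subst sum.swap) simp
  finally show ?case .
qed

lemma vec_box:
  assumes "finite T"
  shows "finite {z :: int ^ 'd::finite. \<forall>i. z $ i \<in> T}" "card {z :: int ^ 'd::finite. \<forall>i. z $ i \<in> T} = card T ^ CARD('d)"
proof -
  have eq: "{z :: int ^ 'd. \<forall>i. z $ i \<in> T} = vec_lambda ` (PiE UNIV (\<lambda>_. T))"
  proof (intro equalityI subsetI)
    fix z :: "int ^ 'd" assume "z \<in> {z. \<forall>i. z $ i \<in> T}"
    then show "z \<in> vec_lambda ` (PiE UNIV (\<lambda>_. T))"
      by (intro image_eqI[where x = "vec_nth z"]) (auto simp: PiE_def)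
  qed (auto simp: PiE_def)
  have inj: "inj_on (vec_lambda :: ('d \<Rightarrow> int) \<Rightarrow> _) (PiE UNIV (\<lambda>_. T))"
    by (auto simp: inj_on_def vec_lambda_inject)
  show "finite {z :: int ^ 'd. \<forall>i. z $ i \<in> T}"
    unfolding eq using assms by (intro finite_imageI finite_PiE) auto
  show "card {z :: int ^ 'd. \<forall>i. z $ i \<in> T} = card T ^ CARD('d)"
    unfolding eq card_image[OF inj] by (simp add: card_PiE)
qed

text \<open>Odd rather than even coordinates keep the start 0 outside the set and make every site
  with an even coordinate a free passage.\<close>

definition odd_box :: "nat \<Rightarrow> (int ^ 'd::finite) set" where
  "odd_box s = {z. \<forall>i. z $ i \<in> {t. odd t \<and> 0 \<le> t \<and> t < 2 * int s}}"

lemma finite_odd_box: "finite (odd_box s :: (int ^ 'd::finite) set)"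
  and card_odd_box: "card (odd_box s :: (int ^ 'd::finite) set) = s ^ CARD('d)"
proof -
  let ?T = "{t. odd t \<and> 0 \<le> t \<and> t < 2 * int s}"
  have eq: "?T = (\<lambda>k. 2 * int k + 1) ` {..<s}"
  proof (intro equalityI subsetI)
    fix t assume t: "t \<in> ?T"
    then obtain k where k: "t = 2 * k + 1" by (auto elim: oddE)
    then show "t \<in> (\<lambda>k. 2 * int k + 1) ` {..<s}" using t by (intro image_eqI[where x = "nat k"]) auto
  qed auto
  have fin: "finite ?T" unfolding eq by simp
  have "card ?T = s" unfolding eq by (subst card_image) (auto simp: inj_on_def)
  then show "finite (odd_box s :: (int ^ 'd) set)" "card (odd_box s :: (int ^ 'd) set) = s ^ CARD('d)"
    using vec_box[OF fin, where 'd = 'd] unfolding odd_box_def by simp_all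
qed

text \<open>Sum \<open>sum_hk_esc_le_1\<close> over all starts w in a larger box B. By symmetry of
  the heat kernel every z in the cube then receives mass at least 1/2 at each time below N, so N/2
  times the sum of the escape probabilities is at most |B|, of order s^d, with N of order
  s^2.\<close>

lemma sum_esc_odd_box:
  fixes s :: nat
  assumes s: "2 \<le> s" and J: "s ^ 2 div 2 \<le> J" and d: "2 \<le> CARD('d::finite)"
  shows "(\<Sum>z\<in>odd_box s. esc (odd_box s :: (int ^ 'd) set) J z) \<le> 8 * 5 ^ CARD('d) * real s ^ (CARD('d) - 2)"
proof -
  let ?A = "odd_box s :: (int ^ 'd) set"
  define B :: "(int ^ 'd) set" where "B = {z. \<forall>i. z $ i \<in> {- int s .. 3 * int s}}"
  \<comment> \<open>The squared distance from the cube to the outside of B is at least s^2, so a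
    walk is still in B after fewer than s^2/2 steps with probability at least 1/2.\<close>
  define N where "N = s ^ 2 div 2"
  have B: "finite B" "card B = (4 * s + 1) ^ CARD('d)"
    using vec_box[of "{- int s .. 3 * int s}", where 'd = 'd] by (auto simp: B_def nat_add_distrib nat_mult_distrib)
  have N: "real (s ^ 2) / 4 \<le> real N" "2 * N \<le> s ^ 2"
  proof -
    have "4 \<le> s ^ 2" using power_mono[OF s, of 2] by simp
    then have "s ^ 2 \<le> 4 * N" unfolding N_def by presburger
    then show "real (s ^ 2) / 4 \<le> real N" by (simp flip: of_nat_power)
    show "2 * N \<le> s ^ 2" by (simp add: N_def)
  qed
  have half: "1/2 \<le> (\<Sum>w\<in>B. hk k w z)" if z: "z \<in> ?A" and k: "k < N" for z k
  proof -
    have out: "real (s ^ 2) \<le> sqn (w - z)" if w: "w \<notin> B" for w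
    proof -
      obtain i where i: "w $ i < - int s \<or> 3 * int s < w $ i" using w by (auto simp: B_def not_le)
      have "0 \<le> z $ i" "z $ i < 2 * int s" using z by (auto simp: odd_box_def)
      then have "int s \<le> \<bar>(w - z) $ i\<bar>" using i by auto
      then have "(int s)\<^sup>2 \<le> ((w - z) $ i)\<^sup>2" by (metis abs_le_square_iff abs_of_nat)
      then have "real (s ^ 2) \<le> (real_of_int ((w - z) $ i))\<^sup>2"
        by (metis of_int_le_iff of_int_of_nat_eq of_int_power of_nat_power)
      also have "\<dots> \<le> sqn (w - z)" unfolding sqn_def by (rule member_le_sum) auto
      finally show ?thesis .
    qed
    have "1 - (sqn (z - z) + real k) / real (s ^ 2) \<le> (\<Sum>w\<in>B. hk k z w)"
      using B out s by (intro sum_hk_ball) auto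
    moreover have "real k / real (s ^ 2) \<le> 1/2"
    proof -
      have "2 * k \<le> s ^ 2" using k N by linarith
      then have "2 * real k \<le> real (s ^ 2)" by (metis of_nat_le_iff of_nat_mult of_nat_numeral)
      then show ?thesis using s by (simp add: field_simps)
    qed
    ultimately show ?thesis by (simp add: hk_sym[of k z] sqn_def)
  qed
  let ?E = "\<Sum>z\<in>?A. esc ?A J z"
  have esc0: "0 \<le> esc ?A J z" for z by (simp flip: esc_eq_measure)
  have "real N / 2 * ?E = (\<Sum>z\<in>?A. \<Sum>k<N. 1/2 * esc ?A J z)"
    by (simp add: sum_distrib_left)
  also have "\<dots> \<le> (\<Sum>z\<in>?A. \<Sum>k<N. (\<Sum>w\<in>B. hk k w z) * esc ?A J z)"
    using half esc0 by (intro sum_mono mult_right_mono) auto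
  also have "\<dots> = (\<Sum>w\<in>B. \<Sum>k<N. \<Sum>z\<in>?A. hk k w z * esc ?A J z)"
  proof -
    have "(\<Sum>z\<in>?A. \<Sum>k<N. (\<Sum>w\<in>B. hk k w z) * esc ?A J z) = (\<Sum>k<N. \<Sum>z\<in>?A. \<Sum>w\<in>B. hk k w z * esc ?A J z)"
      by (subst sum.swap) (simp only: sum_distrib_right)
    also have "\<dots> = (\<Sum>k<N. \<Sum>w\<in>B. \<Sum>z\<in>?A. hk k w z * esc ?A J z)"
      by (rule sum.cong[OF refl], rule sum.swap)
    also have "\<dots> = (\<Sum>w\<in>B. \<Sum>k<N. \<Sum>z\<in>?A. hk k w z * esc ?A J z)"
      by (rule sum.swap)
    finally show ?thesis .
  qed
  also have "\<dots> \<le> (\<Sum>w\<in>B. 1)"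
    using finite_odd_box J by (intro sum_mono sum_hk_esc_le_1) (auto simp: N_def)
  also have "\<dots> = real ((4 * s + 1) ^ CARD('d))" using B by simp
  also have "\<dots> \<le> real ((5 * s) ^ CARD('d))" using s by (intro of_nat_mono power_mono) auto
  finally have 1: "real N / 2 * ?E \<le> 5 ^ CARD('d) * real s ^ CARD('d)" by (simp add: power_mult_distrib)
  have "real (s ^ 2) / 8 * ?E \<le> real N / 2 * ?E"
    using N esc0 by (intro mult_right_mono sum_nonneg) auto
  then have "real s ^ 2 * ?E \<le> 8 * 5 ^ CARD('d) * real s ^ CARD('d)" using 1 by simp
  also have "real s ^ CARD('d) = real s ^ 2 * real s ^ (CARD('d) - 2)"
    using power_add[of "real s" 2 "CARD('d) - 2"] d by (simp only: le_add_diff_inverse)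
  finally have "real s ^ 2 * ?E \<le> real s ^ 2 * (8 * 5 ^ CARD('d) * real s ^ (CARD('d) - 2))" by (simp add: mult_ac)
  then show ?thesis using s by (subst (asm) mult_le_cancel_left_pos) auto
qed

section \<open>Lower bound on a sparse cube\<close>

lemma l1_norm_nonneg: "0 \<le> l1_norm x"
  by (simp add: l1_norm_def sum_nonneg)

lemma l1_norm_step:
  fixes x y :: "int ^ 'd::finite"
  assumes "t = sgn ((y - x) $ j) * r" "0 \<le> r" "r \<le> \<bar>(y - x) $ j\<bar>"
  shows "l1_norm (x + axis j t - y) = l1_norm (x - y) - r"
proof -
  have 1: "l1_norm v = \<bar>v $ j\<bar> + (\<Sum>i\<in>UNIV - {j}. \<bar>v $ i\<bar>)" for v :: "int ^ 'd"
    unfolding l1_norm_def by (rule sum.remove) auto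
  have 2: "(\<Sum>i\<in>UNIV - {j}. \<bar>(x + axis j t - y) $ i\<bar>) = (\<Sum>i\<in>UNIV - {j}. \<bar>(x - y) $ i\<bar>)"
    by (intro sum.cong) (auto simp: axis_def)
  have "\<bar>(x + axis j t - y) $ j\<bar> = \<bar>(x - y) $ j\<bar> - r"
    using assms by (auto simp: axis_def sgn_if abs_if split: if_splits)
  then show ?thesis unfolding 1 2 by simp
qed

lemma axis_in_nbhd: "\<bar>t\<bar> \<le> 1 \<Longrightarrow> x + axis j t \<in> nbhd x"
proof -
  assume t: "\<bar>t\<bar> \<le> 1"
  have "l1_norm (axis j t) = \<bar>t\<bar>"
    unfolding l1_norm_def axis_def by (simp add: if_distrib[of abs] cong: if_cong)
  then show ?thesis using t by (simp add: nbhd_def)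
qed

text \<open>A walk that keeps one coordinate even never meets a set of points with odd coordinates.\<close>
lemma fret_even_path:
  fixes w :: "int ^ 'd::finite"
  assumes A: "\<And>z i. z \<in> A \<Longrightarrow> odd (z $ i)" and p: "p = step_prob TYPE('d)"
    and end': "p ^ Suc k \<le> fret A k z' w"
  shows "l1_norm (z - z') = int m \<Longrightarrow> even (z' $ i) \<Longrightarrow> z $ i = z' $ i \<Longrightarrow> p ^ Suc (k + m) \<le> fret A (k + m) z w"
proof (induction m arbitrary: z)
  case 0
  have "(\<Sum>i\<in>UNIV. \<bar>(z - z') $ i\<bar>) = 0" using 0 by (simp add: l1_norm_def)
  then have "\<forall>i\<in>UNIV. \<bar>(z - z') $ i\<bar> = 0"
    by (subst (asm) sum_nonneg_eq_0_iff) auto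
  then have "z = z'" by (auto simp: vec_eq_iff)
  then show ?case using end' by simp
next
  case (Suc m)
  have "z \<noteq> z'" using Suc.prems(1) by (auto simp: l1_norm_def)
  then obtain j where j: "z $ j \<noteq> z' $ j" by (auto simp: vec_eq_iff)
  define t where "t = sgn ((z' - z) $ j) * 1"
  define y where "y = z + axis j t"
  have "l1_norm (y - z') = l1_norm (z - z') - 1"
    unfolding y_def by (rule l1_norm_step[OF t_def]) (use j in auto)
  then have l: "l1_norm (y - z') = int m" using Suc.prems(1) by simp
  have yi: "y $ i = z' $ i" using Suc.prems(3) j by (auto simp: y_def axis_def)
  have y: "y \<in> nbhd z" unfolding y_def by (rule axis_in_nbhd) (auto simp: t_def sgn_if)
  have yA: "y \<notin> A" using A[of y i] yi Suc.prems(2) by auto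
  have "p ^ Suc (k + m) \<le> fret A (k + m) y w" by (rule Suc.IH[OF l Suc.prems(2) yi])
  also have "\<dots> \<le> (\<Sum>y\<in>nbhd z - A. fret A (k + m) y w)"
    using y yA by (intro member_le_sum) (auto simp: fret_nonneg)
  finally have "p * p ^ Suc (k + m) \<le> p * (\<Sum>y\<in>nbhd z - A. fret A (k + m) y w)"
    by (intro mult_left_mono) (auto simp: p)
  then show ?case by (simp add: p)
qed

lemma l1_norm_le_card: "(\<And>i. \<bar>x $ i\<bar> \<le> r) \<Longrightarrow> l1_norm x \<le> int CARD('d) * r"
  for x :: "int ^ 'd::finite"
  unfolding l1_norm_def using sum_bounded_above[of UNIV "\<lambda>i. \<bar>x $ i\<bar>" r] by simp

lemma odd_box_odd: "z \<in> odd_box s \<Longrightarrow> odd (z $ i)" and odd_box_bounds: "z \<in> odd_box s \<Longrightarrow> 0 < z $ i \<and> z $ i < 2 * int s"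
proof -
  assume z: "z \<in> odd_box s"
  then show o: "odd (z $ i)" by (auto simp: odd_box_def)
  have "0 \<le> z $ i" "z $ i < 2 * int s" using z by (auto simp: odd_box_def)
  then show "0 < z $ i \<and> z $ i < 2 * int s" using o by (cases "z $ i = 0") auto
qed

text \<open>Two legs, each protected by a frozen even coordinate: from z to \<open>mid\<close> with
  coordinate i0 fixed, and from \<open>mid\<close> to a neighbour of w with coordinate i1 fixed.
  Since z and that neighbour need not share an even coordinate, \<open>mid\<close> takes one from
  each.\<close>

lemma ret_link_start:
  fixes z w :: "int ^ 'd::finite"
  assumes d: "2 \<le> CARD('d)" and w: "w \<in> odd_box s" and z: "even (z $ i0)" "\<And>i. 0 \<le> z $ i \<and> z $ i \<le> 2 * int s"
  shows "\<exists>k < 2 * s * (CARD('d) * 2) + 1. step_prob TYPE('d) ^ Suc k \<le> fret (odd_box s) k z w"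
proof -
  let ?p = "step_prob TYPE('d)" and ?A = "odd_box s :: (int ^ 'd) set"
  obtain i1 where i1: "i1 \<noteq> i0"
  proof -
    have "UNIV \<noteq> {i0}" using d by (metis card.empty card.insert empty_iff finite.emptyI not_less_eq_eq numeral_2_eq_2 One_nat_def le_refl)
    then show ?thesis using that by blast
  qed
  \<comment> \<open>The last site before w; shifting w along i1 makes this coordinate even.\<close>
  define w1 where "w1 = w + axis i1 1"
  define mid where "mid = (\<chi> i. if i = i0 then z $ i0 else w1 $ i)"
  have w1b: "0 \<le> w1 $ i \<and> w1 $ i \<le> 2 * int s" for i
    using odd_box_bounds[OF w, of i] by (auto simp: w1_def axis_def)
  have w1e: "even (w1 $ i1)" using odd_box_odd[OF w, of i1] by (auto simp: w1_def axis_def)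
  have "w \<in> nbhd w1"
    using axis_in_nbhd[of 1 w i1] by (simp add: w1_def nbhd_sym[of w])
  then have k0: "?p ^ Suc 0 \<le> fret ?A 0 w1 w" by simp
  have A: "\<And>z i. z \<in> ?A \<Longrightarrow> odd (z $ i)" by (rule odd_box_odd)
  define m1 where "m1 = nat (l1_norm (mid - w1))"
  define m2 where "m2 = nat (l1_norm (z - mid))"
  have m: "l1_norm (mid - w1) = int m1" "l1_norm (z - mid) = int m2"
    using l1_norm_nonneg by (auto simp: m1_def m2_def)
  have "l1_norm (mid - w1) \<le> int CARD('d) * (2 * int s)"
  proof (intro l1_norm_le_card)
    fix i show "\<bar>(mid - w1) $ i\<bar> \<le> 2 * int s"
      using z(2)[of i] w1b[of i] by (auto simp: mid_def)
  qed
  moreover have "l1_norm (z - mid) \<le> int CARD('d) * (2 * int s)"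
  proof (intro l1_norm_le_card)
    fix i show "\<bar>(z - mid) $ i\<bar> \<le> 2 * int s"
      using z(2)[of i] w1b[of i] by (auto simp: mid_def)
  qed
  ultimately have "m1 + m2 \<le> 2 * s * (CARD('d) * 2)"
  proof -
    assume "l1_norm (mid - w1) \<le> int CARD('d) * (2 * int s)" "l1_norm (z - mid) \<le> int CARD('d) * (2 * int s)"
    then have "int (m1 + m2) \<le> int (2 * s * (CARD('d) * 2))"
      unfolding m by (simp add: algebra_simps)
    then show ?thesis by (simp only: of_nat_le_iff)
  qed
  moreover have k1: "?p ^ Suc (0 + m1) \<le> fret ?A (0 + m1) mid w"
    by (rule fret_even_path[OF A refl k0 m(1), where i = i1]) (use w1e i1 in \<open>auto simp: mid_def\<close>)
  have "?p ^ Suc (0 + m1 + m2) \<le> fret ?A (0 + m1 + m2) z w"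
    by (rule fret_even_path[OF A refl k1 m(2), where i = i0]) (use z(1) in \<open>auto simp: mid_def\<close>)
  ultimately show ?thesis by (intro exI[of _ "m1 + m2"]) auto
qed

text \<open>Bounds the number of steps of a connecting path: two legs of at most 2 s times the
  dimension, one step off the starting point and one onto w.\<close>

definition link_len :: "'d::finite itself \<Rightarrow> nat \<Rightarrow> nat" where
  "link_len _ s = 2 * s * (CARD('d) * 2) + 2"

lemma ret_link:
  fixes x w :: "int ^ 'd::finite"
  assumes d: "2 \<le> CARD('d)" and w: "w \<in> odd_box s" and x: "x \<in> odd_box s \<or> x = 0"
    and J: "link_len TYPE('d) s \<le> J"
  shows "step_prob TYPE('d) ^ link_len TYPE('d) s \<le> ret (odd_box s) J x w"
proof -
  let ?p = "step_prob TYPE('d)" and ?A = "odd_box s :: (int ^ 'd) set"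
  have p: "0 \<le> ?p" "?p \<le> 1" by auto
  have "\<exists>k < link_len TYPE('d) s. ?p ^ Suc k \<le> fret ?A k x w"
  proof (cases "x = 0")
    case True
    have "\<exists>k < 2 * s * (CARD('d) * 2) + 1. ?p ^ Suc k \<le> fret ?A k x w"
      by (rule ret_link_start[OF d w, of x undefined]) (auto simp: True)
    then show ?thesis by (auto simp: link_len_def intro: less_trans)
  next
    case False
    then have xA: "x \<in> ?A" using x by auto
    \<comment> \<open>\<open>undefined\<close> stands for an arbitrary axis; one step along it makes
      that coordinate even and so leaves the cube.\<close>
    define y where "y = x + axis undefined 1"
    have "\<exists>k < 2 * s * (CARD('d) * 2) + 1. ?p ^ Suc k \<le> fret ?A k y w"
    proof (rule ret_link_start[OF d w])
      show ev: "even (y $ undefined)" using odd_box_odd[OF xA, of undefined] by (auto simp: y_def axis_def)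
      show "0 \<le> y $ i \<and> y $ i \<le> 2 * int s" for i
        using odd_box_bounds[OF xA, of i] by (auto simp: y_def axis_def)
    qed
    then obtain k where k: "k < 2 * s * (CARD('d) * 2) + 1" "?p ^ Suc k \<le> fret ?A k y w" by blast
    have "even (y $ undefined)" using odd_box_odd[OF xA, of undefined] by (auto simp: y_def axis_def)
    then have yA: "y \<notin> ?A" using odd_box_odd[of y s undefined] by auto
    have yn: "y \<in> nbhd x" unfolding y_def by (rule axis_in_nbhd) simp
    have "fret ?A k y w \<le> (\<Sum>y\<in>nbhd x - ?A. fret ?A k y w)"
      using yA yn by (intro member_le_sum) (auto simp: fret_nonneg)
    then have "?p * ?p ^ Suc k \<le> ?p * (\<Sum>y\<in>nbhd x - ?A. fret ?A k y w)"
      using k(2) by (intro mult_left_mono) auto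
    then have "?p ^ Suc (Suc k) \<le> fret ?A (Suc k) x w" by simp
    then show ?thesis using k(1) by (intro exI[of _ "Suc k"]) (simp add: link_len_def)
  qed
  then obtain k where k: "k < link_len TYPE('d) s" "?p ^ Suc k \<le> fret ?A k x w" by blast
  have "?p ^ link_len TYPE('d) s \<le> ?p ^ Suc k" using k(1) p by (intro power_decreasing) auto
  also have "\<dots> \<le> ret ?A J x w" using k J fret_le_ret[of k J ?A x w] by linarith
  finally show ?thesis .
qed

lemma ret_neighbour:
  fixes x :: "int ^ 'd::finite"
  assumes x: "x \<in> odd_box s" and t: "\<bar>t\<bar> = 2" and J: "2 \<le> J"
  shows "step_prob TYPE('d) ^ 2 \<le> ret (odd_box s) J x (x + axis j t)"
proof -
  let ?A = "odd_box s :: (int ^ 'd) set" and ?p = "step_prob TYPE('d)"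
  define y where "y = x + axis j (sgn t)"
  have y: "y \<in> nbhd x" unfolding y_def by (rule axis_in_nbhd) (auto simp: sgn_if)
  have ts: "t = sgn t + sgn t" using t by (auto simp: sgn_if abs_if split: if_splits)
  have "x + axis j t = y + axis j (sgn t)"
    unfolding y_def by (subst ts) (simp add: vec_eq_iff axis_def)
  then have n: "x + axis j t \<in> nbhd y" using axis_in_nbhd[of "sgn t" y j] by (auto simp: sgn_if)
  have "t \<noteq> 0" using t by auto
  then have "even (y $ j)" using odd_box_odd[OF x, of j] by (auto simp: y_def axis_def sgn_if)
  then have "y \<notin> ?A" using odd_box_odd[of y s j] by auto
  then have "fret ?A 0 y (x + axis j t) \<le> (\<Sum>y\<in>nbhd x - ?A. fret ?A 0 y (x + axis j t))"
    using y by (intro member_le_sum) (auto simp: fret_nonneg)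
  then have "?p * fret ?A 0 y (x + axis j t) \<le> fret ?A (Suc 0) x (x + axis j t)"
    unfolding fret.simps(2) by (intro mult_left_mono) auto
  moreover have "fret ?A 0 y (x + axis j t) = ?p" using n by simp
  ultimately have "?p ^ 2 \<le> fret ?A (Suc 0) x (x + axis j t)" by (simp add: power2_eq_square)
  moreover have "Suc 0 < J" using J by simp
  ultimately show ?thesis using fret_le_ret[of "Suc 0" J ?A x "x + axis j t"] by linarith
qed

lemma odd_box_lipschitz:
  fixes g :: "int ^ 'd::finite \<Rightarrow> real"
  assumes step: "\<And>x j t. x \<in> odd_box s \<Longrightarrow> x + axis j t \<in> odd_box s \<Longrightarrow> \<bar>t\<bar> = 2 \<Longrightarrow> \<bar>g x - g (x + axis j t)\<bar> \<le> \<delta>"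
    and \<delta>: "0 \<le> \<delta>" and y: "y \<in> odd_box s"
  shows "x \<in> odd_box s \<Longrightarrow> \<bar>g x - g y\<bar> \<le> \<delta> * real_of_int (l1_norm (x - y))"
proof (induction "nat (l1_norm (x - y))" arbitrary: x rule: less_induct)
  case less
  show ?case
  proof (cases "x = y")
    case True
    then show ?thesis using \<delta> l1_norm_nonneg[of "x - y"] by simp
  next
    case False
    then obtain j where j: "x $ j \<noteq> y $ j" by (auto simp: vec_eq_iff)
    define t where "t = sgn ((y - x) $ j) * 2"
    have odd: "odd (x $ j)" "odd (y $ j)" using odd_box_odd[OF less.prems] odd_box_odd[OF y] by auto
    have big: "2 \<le> \<bar>(y - x) $ j\<bar>"
    proof -
      have "2 \<le> \<bar>t\<bar>" if "even t" "t \<noteq> 0" for t :: int using that by presburger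
      moreover have "even ((y - x) $ j)" "(y - x) $ j \<noteq> 0" using odd j by auto
      ultimately show ?thesis by blast
    qed
    have t2: "\<bar>t\<bar> = 2" using j by (auto simp: t_def sgn_if)
    have x': "x + axis j t \<in> odd_box s"
    proof -
      have "odd ((x + axis j t) $ i) \<and> 0 \<le> (x + axis j t) $ i \<and> (x + axis j t) $ i < 2 * int s" for i
        using odd_box_bounds[OF less.prems, of i] odd_box_bounds[OF y, of i] odd_box_odd[OF less.prems, of i] big
        by (auto simp: axis_def t_def sgn_if abs_if split: if_splits)
      then show ?thesis by (simp add: odd_box_def)
    qed
    have l: "l1_norm (x + axis j t - y) = l1_norm (x - y) - 2"
      by (rule l1_norm_step[OF t_def]) (use big in auto)
    then have "nat (l1_norm (x + axis j t - y)) < nat (l1_norm (x - y))"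
      using l1_norm_nonneg[of "x + axis j t - y"] by simp
    from less.hyps[OF this x'] have "\<bar>g (x + axis j t) - g y\<bar> \<le> \<delta> * (real_of_int (l1_norm (x - y)) - 2)"
      by (simp add: l)
    moreover have "\<bar>g x - g (x + axis j t)\<bar> \<le> \<delta>" by (rule step[OF less.prems x' t2])
    ultimately have "\<bar>g x - g y\<bar> \<le> \<delta> * (real_of_int (l1_norm (x - y)) - 2) + \<delta>" by linarith
    then show ?thesis using \<delta> by (simp add: algebra_simps)
  qed
qed

text \<open>Points of the cube at distance 2 along an axis are joined by Q with probability bounded
  below, so g changes boundedly in sqrt B along such an edge. Chains of these edges across the cube
  have length of order s, which gives \<rho> of order s^2.\<close>

lemma odd_box_osc:
  fixes g :: "int ^ 'd::finite \<Rightarrow> real"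
  assumes B: "\<And>x y. x \<in> odd_box s \<Longrightarrow> y \<in> odd_box s \<Longrightarrow> ret (odd_box s) J x y * (g x - g y)\<^sup>2 \<le> B"
    and J: "2 \<le> J" and xy: "x \<in> odd_box s" "y \<in> odd_box s"
  shows "(g x - g y)\<^sup>2 \<le> ((2 * real CARD('d) + 1) * (real CARD('d) * (2 * real s)))\<^sup>2 * B"
proof -
  let ?D = "2 * real CARD('d) + 1"
  have B0: "0 \<le> B" using B[OF xy(1) xy(1)] by simp
  define \<delta> where "\<delta> = ?D * sqrt B"
  have \<delta>0: "0 \<le> \<delta>" using B0 by (simp add: \<delta>_def)
  have "\<bar>g x - g (x + axis j t)\<bar> \<le> \<delta>" if "x \<in> odd_box s" "x + axis j t \<in> odd_box s" "\<bar>t\<bar> = 2" for x j t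
  proof -
    have "step_prob TYPE('d) ^ 2 * (g x - g (x + axis j t))\<^sup>2 \<le> ret (odd_box s) J x (x + axis j t) * (g x - g (x + axis j t))\<^sup>2"
      using ret_neighbour[OF that(1,3) J] by (intro mult_right_mono) auto
    also have "\<dots> \<le> B" by (rule B[OF that(1,2)])
    finally have "(g x - g (x + axis j t))\<^sup>2 \<le> ?D\<^sup>2 * B"
      by (simp add: power_divide field_simps add_pos_nonneg)
    also have "\<dots> = \<delta>\<^sup>2" using B0 by (simp add: \<delta>_def power_mult_distrib)
    finally show ?thesis using \<delta>0 by (metis abs_le_square_iff abs_of_nonneg)
  qed
  then have "\<bar>g x - g y\<bar> \<le> \<delta> * real_of_int (l1_norm (x - y))"
    by (rule odd_box_lipschitz[OF _ \<delta>0 xy(2) xy(1)])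
  also have "\<dots> \<le> \<delta> * (real CARD('d) * (2 * real s))"
  proof -
    have "l1_norm (x - y) \<le> int CARD('d) * (2 * int s)"
    proof (rule l1_norm_le_card)
      fix i show "\<bar>(x - y) $ i\<bar> \<le> 2 * int s"
        using odd_box_bounds[OF xy(1), of i] odd_box_bounds[OF xy(2), of i] by auto
    qed
    then have "real_of_int (l1_norm (x - y)) \<le> real_of_int (int CARD('d) * (2 * int s))" by (simp only: of_int_le_iff)
    then show ?thesis using \<delta>0 by (intro mult_left_mono) auto
  qed
  finally have "\<bar>g x - g y\<bar>\<^sup>2 \<le> (\<delta> * (real CARD('d) * (2 * real s)))\<^sup>2" by (rule power_mono) simp
  then show ?thesis using B0 by (simp add: \<delta>_def power_mult_distrib mult_ac)
qed

lemma lev_odd_box_lower: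
  fixes s m t :: nat
  assumes d: "5 \<le> CARD('d::finite)" and s: "2 \<le> s" and m: "0 < m" and t: "0 < t"
    and c: "c = step_prob TYPE('d)" and \<rho>: "\<rho> = ((2 * real CARD('d) + 1) * (real CARD('d) * (2 * real s)))\<^sup>2"
    and K: "K = s ^ CARD('d)" and big: "4 * \<rho> * (real K * real m) \<le> (real t)\<^sup>2"
  shows "c ^ link_len TYPE('d) s *
     (1/2 * exp (- (real m * (8 * 5 ^ CARD('d) * real s ^ (CARD('d) - 2)) / c)) * (c ^ link_len TYPE('d) s) ^ K *
       (1 / (green_L2 TYPE('d) * real K)) * c ^ (K * Suc t)) \<le> lev (odd_box s) (\<lambda>_. m) (0 :: int ^ 'd)"
proof -
  let ?A = "odd_box s :: (int ^ 'd) set"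
  \<comment> \<open>The horizon must exceed both the length of the links and the diffusive time
    s^2/2 of \<open>sum_esc_odd_box\<close>.\<close>
  define J where "J = link_len TYPE('d) s + s ^ 2"
  have J: "link_len TYPE('d) s \<le> J" "s ^ 2 div 2 \<le> J" "2 \<le> J"
    by (auto simp: J_def link_len_def)
  have cK: "card ?A = K" by (simp add: card_odd_box K)
  have K1: "32 \<le> K"
  proof -
    have "(2::nat) ^ 5 \<le> s ^ 5" using s by (rule power_mono) simp
    also have "\<dots> \<le> s ^ CARD('d)" using s d by (intro power_increasing) auto
    finally show ?thesis by (simp add: K)
  qed
  have finA: "finite ?A" by (rule finite_odd_box)
  have neA: "?A \<noteq> {}" using cK K1 by auto
  have c0: "0 < c" by (simp add: c add_pos_nonneg)
  have esc0: "0 \<le> esc ?A J z" for z by (simp flip: esc_eq_measure)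
  interpret sub_chain ?A "ret ?A J" "esc ?A J" c \<rho>
  proof
    show "c \<le> ret ?A J x x" if "x \<in> ?A" for x
      using fret_le_ret[of 0 J ?A x x] J(3) by (simp add: c)
    show "(g x - g y)\<^sup>2 \<le> \<rho> * B" if "\<And>x y. x \<in> ?A \<Longrightarrow> y \<in> ?A \<Longrightarrow> ret ?A J x y * (g x - g y)\<^sup>2 \<le> B" "x \<in> ?A" "y \<in> ?A"
      for g B x y unfolding \<rho> by (rule odd_box_osc[OF that(1) J(3) that(2,3)])
  qed (use finA neA c0 esc0 sum_ret[OF finA] in \<open>auto simp: ret_nonneg intro: ret_sym\<close>)
  have g2: "1 \<le> green_L2 TYPE('d)" by (simp add: green_L2_def)
  \<comment> \<open>Pigeonhole: the capacity is at least 1/\<open>green_L2\<close>, so one of the K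
    points carries a K-th part of that.\<close>
  obtain x0 where x0: "x0 \<in> ?A" "1 / (green_L2 TYPE('d) * real K) \<le> escape ?A x0"
  proof -
    have "\<exists>x\<in>?A. 1 / (green_L2 TYPE('d) * real K) \<le> escape ?A x"
    proof (rule ccontr)
      assume "\<not> ?thesis"
      then have "escape ?A x < 1 / (green_L2 TYPE('d) * real K)" if "x \<in> ?A" for x using that by force
      then have "capacity ?A < (\<Sum>x\<in>?A. 1 / (green_L2 TYPE('d) * real K))"
        unfolding capacity_eq using finA neA by (intro sum_strict_mono) auto
      also have "\<dots> = 1 / green_L2 TYPE('d)" using K1 by (simp add: cK)
      finally have "green_L2 TYPE('d) * capacity ?A < 1" using g2 by (simp add: field_simps)
      moreover have "1 \<le> sqrt (real K)" using K1 by simp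
      ultimately show False using capacity_lower[OF d finA] unfolding cK by linarith
    qed
    then show ?thesis using that by blast
  qed
  interpret level_chain ?A "ret ?A J" "esc ?A J" c \<rho> "\<lambda>x v. lev ?A v x" x0 "c ^ link_len TYPE('d) s" "1 / (green_L2 TYPE('d) * real K)"
  proof
    show "(\<Sum>y\<in>?A. ret ?A J x y * lev ?A (v(x := v x - 1)) y) \<le> lev ?A v x" if "x \<in> ?A" "0 < v x" for x v
      using that by (intro lev_ret_in finA)
    show "1 / (green_L2 TYPE('d) * real K) \<le> lev ?A (\<lambda>z. if z = x0 then 1 else 0) x0"
      using x0(2) escape_le_lev_single[OF x0(1)] by linarith
    show "c ^ link_len TYPE('d) s \<le> ret ?A J x y" if "x \<in> ?A" "y \<in> ?A" for x y
      unfolding c using d that J(1) by (intro ret_link) auto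
  qed (use x0 c0 g2 K1 cK in \<open>auto simp: lev_nonneg\<close>)
  have b4: "4 * \<rho> * (real (card ?A) * real m) \<le> (real t)\<^sup>2" using big by (simp add: cK)
  from level_lower_bound[OF m t b4] obtain x where x: "x \<in> ?A" and
    low: "1/2 * exp (- (real m * (\<Sum>z\<in>?A. esc ?A J z) / c)) * (c ^ link_len TYPE('d) s) ^ K *
       (1 / (green_L2 TYPE('d) * real K)) * c ^ (K * Suc t) \<le> lev ?A (\<lambda>z. if z \<in> ?A then m else 0) x"
    unfolding cK by blast
  have "lev_event ?A (\<lambda>z. if z \<in> ?A then m else 0) = lev_event ?A (\<lambda>_. m)" by (auto simp: lev_event_def)
  then have eq: "lev ?A (\<lambda>z. if z \<in> ?A then m else 0) x = lev ?A (\<lambda>_. m) x" by (simp add: lev_def)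
  have "exp (- (real m * (8 * 5 ^ CARD('d) * real s ^ (CARD('d) - 2)) / c)) \<le> exp (- (real m * (\<Sum>z\<in>?A. esc ?A J z) / c))"
    using sum_esc_odd_box[OF s J(2), where 'd = 'd] d c0 by (auto intro!: divide_right_mono mult_left_mono)
  then have "1/2 * exp (- (real m * (8 * 5 ^ CARD('d) * real s ^ (CARD('d) - 2)) / c)) * (c ^ link_len TYPE('d) s) ^ K *
       (1 / (green_L2 TYPE('d) * real K)) * c ^ (K * Suc t) \<le> lev ?A (\<lambda>_. m) x"
    using c0 g2 by (intro order_trans[OF _ low[unfolded eq]] mult_right_mono mult_left_mono) auto
  moreover have "c ^ link_len TYPE('d) s \<le> ret ?A J 0 x"
    unfolding c using d x J(1) by (intro ret_link) auto
  ultimately have "c ^ link_len TYPE('d) s *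
     (1/2 * exp (- (real m * (8 * 5 ^ CARD('d) * real s ^ (CARD('d) - 2)) / c)) * (c ^ link_len TYPE('d) s) ^ K *
       (1 / (green_L2 TYPE('d) * real K)) * c ^ (K * Suc t)) \<le> ret ?A J 0 x * lev ?A (\<lambda>_. m) x"
    using c0 g2 by (intro mult_mono) (auto simp: ret_nonneg)
  also have "\<dots> \<le> lev ?A (\<lambda>_. m) 0"
  proof (rule lev_ret_out[OF finA _ x])
    show "0 \<notin> ?A" using odd_box_odd[of 0 s undefined] by auto
  qed
  finally show ?thesis .
qed

section \<open>The two events for a pair of walks\<close>

text \<open>All factors are absorbed in exp(-C X) with X = N s^(d-2). The growth condition is the
  one that makes the correction cost K r with r = sqrt(4 \<rho> K N) admissible, since K^2 \<rho> K
  N is of order s^(3d+2) N and 3d + 2 = (d + 6) + 2 (d - 2). Allowing every m up to N lets one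
  estimate serve both walks.\<close>

lemma lev_odd_box_exp:
  assumes d: "5 \<le> CARD('d::finite)" and M: "1 \<le> M"
  shows "\<exists>C>0. \<forall>s N m. 2 \<le> s \<longrightarrow> 0 < m \<longrightarrow> m \<le> N \<longrightarrow> real s ^ (CARD('d) + 6) \<le> M * real N \<longrightarrow>
    exp (- (C * real N * real s ^ (CARD('d) - 2))) \<le> lev (odd_box s) (\<lambda>_. m) (0 :: int ^ 'd)"
proof -
  define D where "D = 2 * real CARD('d) + 1"
  define l where "l = ln D"
  define g where "g = green_L2 TYPE('d)"
  define \<delta> where "\<delta> = real CARD('d)"
  have D: "1 < D" using d by (simp add: D_def)
  have l: "0 < l" using D by (simp add: l_def)
  have g: "1 \<le> g" by (simp add: g_def green_L2_def)
  have \<delta>: "5 \<le> \<delta>" using d by (simp add: \<delta>_def)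
  \<comment> \<open>The summands pay, in this order, for the links, the escapes (change of measure),
    the deterministic correction, the final escape and the factor 1/2; l is the cost of one
    prescribed step.\<close>
  define C where "C = l * ((8 * \<delta> + 4) * M) + 8 * 5 ^ CARD('d) * D + l * (4 * D * \<delta> * sqrt M + 2 * M) + g * M + M"
  have C: "0 < C" using D l g M \<delta> unfolding C_def by (intro add_nonneg_pos add_nonneg_nonneg mult_nonneg_nonneg) auto
  have main: "exp (- (C * real N * real s ^ (CARD('d) - 2))) \<le> lev (odd_box s) (\<lambda>_. m) (0 :: int ^ 'd)"
    if s: "2 \<le> s" and m: "0 < m" "m \<le> N" and big: "real s ^ (CARD('d) + 6) \<le> M * real N" for s N m
  proof -
    define c where "c = step_prob TYPE('d)"
    have cexp: "c ^ k = exp (- (l * real k))" for k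
    proof -
      have "c = exp (- l)" using D by (simp add: c_def l_def D_def exp_minus inverse_eq_divide)
      then show ?thesis by (simp add: exp_of_nat_mult[symmetric] mult.commute)
    qed
    define \<rho> where "\<rho> = (D * (\<delta> * (2 * real s)))\<^sup>2"
    define K where "K = s ^ CARD('d)"
    define X where "X = real N * real s ^ (CARD('d) - 2)"
    define q where "q = link_len TYPE('d) s"
    define r where "r = sqrt (4 * \<rho> * (real K * real N))"
    define t where "t = nat \<lceil>r\<rceil>"
    have S: "2 \<le> real s" using s by simp
    have N1: "1 \<le> real N" using m by simp
    have K1: "1 \<le> real K" using s by (simp add: K_def)
    have X1: "1 \<le> X" unfolding X_def using N1 S by (intro mult_ge1_I one_le_power) auto
    have sMX: "real s ^ (CARD('d) + 1) \<le> M * X"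
    proof -
      have "real s ^ (CARD('d) + 1) \<le> real s ^ (CARD('d) + 6)" using S by (intro power_increasing) auto
      also have "\<dots> \<le> (M * real N) * 1" using big by simp
      also have "\<dots> \<le> (M * real N) * real s ^ (CARD('d) - 2)"
        using M S by (intro mult_left_mono one_le_power) auto
      finally show ?thesis by (simp add: X_def)
    qed
    have KMX: "real K \<le> M * X"
    proof -
      have "real K \<le> real s ^ (CARD('d) + 1)" unfolding K_def using S by (simp add: )
      then show ?thesis using sMX by linarith
    qed
    have \<rho>0: "0 < \<rho>" using D \<delta> S by (simp add: \<rho>_def)
    have r0: "0 < r" using \<rho>0 K1 N1 by (simp add: r_def)
    have t0: "0 < t" using r0 by (simp add: t_def)
    have tr: "r \<le> real t" "real t \<le> r + 1" using r0 by (auto simp: t_def)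
    have bigt: "4 * \<rho> * (real K * real m) \<le> (real t)\<^sup>2"
    proof -
      have "4 * \<rho> * (real K * real m) \<le> 4 * \<rho> * (real K * real N)"
        using \<rho>0 m by (intro mult_left_mono) auto
      also have "\<dots> = r\<^sup>2" using \<rho>0 by (simp add: r_def)
      also have "\<dots> \<le> (real t)\<^sup>2" using tr r0 by (intro power_mono) auto
      finally show ?thesis .
    qed
    have Kr: "real K * r \<le> 4 * D * \<delta> * sqrt M * X"
    proof (rule power2_le_imp_le)
      have e1: "(real K)\<^sup>2 * (4 * \<rho> * (real K * real N)) = 16 * D\<^sup>2 * \<delta>\<^sup>2 * (real s ^ (3 * CARD('d) + 2) * real N)"
        unfolding K_def \<rho>_def by (simp add: power_mult_distrib power_add power_mult[symmetric] power2_eq_square power3_eq_cube mult.commute[of 3])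
          (simp add: power_mult power3_eq_cube)
      have e2: "real s ^ (3 * CARD('d) + 2) = real s ^ (CARD('d) + 6) * (real s ^ (CARD('d) - 2))\<^sup>2"
      proof -
        have "3 * CARD('d) + 2 = (CARD('d) + 6) + (CARD('d) - 2) * 2" using d by simp
        then show ?thesis by (simp only: power_add power_mult)
      qed
      have "(real K * r)\<^sup>2 = 16 * D\<^sup>2 * \<delta>\<^sup>2 * ((real s ^ (CARD('d) + 6) * (real s ^ (CARD('d) - 2))\<^sup>2) * real N)"
        using \<rho>0 e1 unfolding e2 by (simp add: power_mult_distrib r_def)
      also have "\<dots> \<le> 16 * D\<^sup>2 * \<delta>\<^sup>2 * (((M * real N) * (real s ^ (CARD('d) - 2))\<^sup>2) * real N)"
        using big by (intro mult_left_mono mult_right_mono) auto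
      also have "\<dots> = (4 * D * \<delta> * sqrt M * X)\<^sup>2"
        using M by (simp add: X_def power_mult_distrib power2_eq_square[of "real N"] mult_ac)
      finally show "(real K * r)\<^sup>2 \<le> (4 * D * \<delta> * sqrt M * X)\<^sup>2" .
      show "0 \<le> 4 * D * \<delta> * sqrt M * X" using D \<delta> M X1 by simp
    qed
    have qK: "real q + real q * real K \<le> (8 * \<delta> + 4) * M * X"
    proof -
      have "real q \<le> (4 * \<delta> + 2) * real s"
        using S by (simp add: q_def link_len_def \<delta>_def algebra_simps)
      then have "real q * real K \<le> ((4 * \<delta> + 2) * real s) * real K" using K1 by (intro mult_right_mono) auto
      moreover have "real q * 1 \<le> real q * real K" using K1 by (intro mult_left_mono) auto
      ultimately have "real q + real q * real K \<le> 2 * (((4 * \<delta> + 2) * real s) * real K)" by linarith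
      also have "\<dots> = (8 * \<delta> + 4) * real s ^ (CARD('d) + 1)" by (simp add: K_def algebra_simps)
      also have "\<dots> \<le> (8 * \<delta> + 4) * (M * X)" using sMX \<delta> by (intro mult_left_mono) auto
      finally show ?thesis by (simp add: mult_ac)
    qed
    have low: "c ^ q * (1/2 * exp (- (real m * (8 * 5 ^ CARD('d) * real s ^ (CARD('d) - 2)) / c)) * (c ^ q) ^ K *
       (1 / (g * real K)) * c ^ (K * Suc t)) \<le> lev (odd_box s) (\<lambda>_. m) (0 :: int ^ 'd)"
      unfolding q_def g_def
      by (rule lev_odd_box_lower[OF d s m(1) t0 c_def _ K_def bigt]) (simp add: \<rho>_def D_def \<delta>_def)
    have e1: "exp (- (8 * 5 ^ CARD('d) * D * X)) \<le> exp (- (real m * (8 * 5 ^ CARD('d) * real s ^ (CARD('d) - 2)) / c))"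
    proof -
      have "real m * (8 * 5 ^ CARD('d) * real s ^ (CARD('d) - 2)) / c = 8 * 5 ^ CARD('d) * D * (real m * real s ^ (CARD('d) - 2))"
        by (simp add: c_def D_def mult_ac)
      also have "\<dots> \<le> 8 * 5 ^ CARD('d) * D * X"
        unfolding X_def using D m by (intro mult_left_mono mult_right_mono) auto
      finally show ?thesis by simp
    qed
    have e2: "exp (- (M * X)) \<le> 1/2"
    proof -
      have "1 * 1 \<le> M * X" using M X1 by (intro mult_mono) auto
      then have "1 + 1 \<le> exp (M * X)" using exp_ge_add_one_self[of "M * X"] by linarith
      then show ?thesis by (simp add: exp_minus field_simps)
    qed
    have e3: "exp (- (g * M * X)) \<le> 1 / (g * real K)"
    proof -
      have "g * real K \<le> exp (g * real K)" using exp_ge_add_one_self[of "g * real K"] by linarith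
      also have "\<dots> \<le> exp (g * M * X)" using KMX g by (simp add: mult.assoc mult_left_mono)
      finally show ?thesis using g K1 by (simp add: exp_minus field_simps)
    qed
    have "C * X = (l * ((8 * \<delta> + 4) * M * X)) + (M * X + 8 * 5 ^ CARD('d) * D * X) + g * M * X + l * (4 * D * \<delta> * sqrt M * X + 2 * (M * X))"
      by (simp add: C_def algebra_simps)
    also have "\<dots> \<ge> l * (real q + real q * real K) + (M * X + 8 * 5 ^ CARD('d) * D * X) + g * M * X + l * (real K * real (Suc t))"
    proof -
      have "real K * real (Suc t) \<le> real K * (r + 2)" using tr K1 by (intro mult_left_mono) auto
      also have "\<dots> \<le> 4 * D * \<delta> * sqrt M * X + 2 * (M * X)" using Kr KMX by (simp add: algebra_simps)
      finally have "l * (real K * real (Suc t)) \<le> l * (4 * D * \<delta> * sqrt M * X + 2 * (M * X))"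
        using l by (intro mult_left_mono) auto
      moreover have "l * (real q + real q * real K) \<le> l * ((8 * \<delta> + 4) * M * X)"
        using qK l by (intro mult_left_mono) auto
      ultimately show ?thesis by linarith
    qed
    finally have "exp (- (C * X)) \<le> exp (- (l * (real q + real q * real K) + (M * X + 8 * 5 ^ CARD('d) * D * X) + g * M * X + l * (real K * real (Suc t))))"
      by simp
    also have "\<dots> = exp (- (l * real q)) * (exp (- (M * X)) * exp (- (8 * 5 ^ CARD('d) * D * X)) * exp (- (l * real (q * K))) * exp (- (g * M * X)) * exp (- (l * real (K * Suc t))))"
      by (simp add: exp_add[symmetric] algebra_simps)
    also have "\<dots> \<le> c ^ q * (1/2 * exp (- (real m * (8 * 5 ^ CARD('d) * real s ^ (CARD('d) - 2)) / c)) * (c ^ q) ^ K * (1 / (g * real K)) * c ^ (K * Suc t))"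
    proof -
      have cqK: "(c ^ q) ^ K = exp (- (l * real (q * K)))" using cexp[of "q * K"] by (simp only: power_mult)
      show ?thesis unfolding cqK unfolding cexp using e1 e2 e3 g K1
        by (intro mult_mono order_refl mult_nonneg_nonneg) auto
    qed
    finally show ?thesis using low by (simp add: X_def mult.assoc)
  qed
  show ?thesis using C main by blast
qed

definition inter_event :: "nat \<Rightarrow> nat \<Rightarrow> (int ^ 'd::finite) set \<Rightarrow> ('d path \<times> 'd path) set" where
  "inter_event n m A = {(S, S'). A \<subseteq> level_set S n \<inter> level_set S' m}"

abbreviation (input) pair_law :: "('d::finite path \<times> 'd path) measure" where
  "pair_law \<equiv> walk_law 0 \<Otimes>\<^sub>M walk_law 0"

lemma prob_space_pair_law: "prob_space (pair_law :: ('d::finite path \<times> _) measure)"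
proof -
  interpret A: prob_space "walk_law (0 :: int ^ 'd)" by (rule prob_space_walk_law)
  interpret pair_prob_space "walk_law (0 :: int ^ 'd)" "walk_law (0 :: int ^ 'd)" ..
  show ?thesis by (rule prob_space_axioms)
qed

lemma inter_event_eq: "inter_event n m A = lev_event A (\<lambda>_. n) \<times> lev_event A (\<lambda>_. m)"
  by (auto simp: inter_event_def lev_event_def level_set_def)

lemma sets_inter_event: "inter_event n m A \<in> sets (pair_law :: ('d::finite path \<times> _) measure)"
  unfolding inter_event_eq by (intro pair_measureI) (auto simp: sets_walk_law sets_lev_event)

lemma measure_inter_event:
  "measure pair_law (inter_event n m A) = lev A (\<lambda>_. n) 0 * lev A (\<lambda>_. m) (0 :: int ^ 'd::finite)"
proof -
  interpret A: prob_space "walk_law (0 :: int ^ 'd)" by (rule prob_space_walk_law)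
  have "emeasure pair_law (inter_event n m A) = emeasure (walk_law (0 :: int ^ 'd)) (lev_event A (\<lambda>_. n)) * emeasure (walk_law (0 :: int ^ 'd)) (lev_event A (\<lambda>_. m))"
    unfolding inter_event_eq by (rule A.emeasure_pair_measure_Times) (auto simp: sets_walk_law sets_lev_event)
  then show ?thesis
    by (simp add: measure_def lev_def enn2real_mult)
qed

text \<open>A bound uniform over finite subfamilies passes to the countable union by continuity from
  below.\<close>

lemma (in finite_measure) measure_UN_le_sum:
  assumes I: "countable I" and E: "\<And>i. i \<in> I \<Longrightarrow> E i \<in> sets M"
    and B: "\<And>F. finite F \<Longrightarrow> F \<subseteq> I \<Longrightarrow> (\<Sum>i\<in>F. measure M (E i)) \<le> B"
  shows "measure M (\<Union>i\<in>I. E i) \<le> B"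
proof (cases "I = {}")
  case True
  then show ?thesis using B[of "{}"] by simp
next
  case False
  define F where "F n = from_nat_into I ` {..<n}" for n :: nat
  have F: "finite (F n)" "F n \<subseteq> I" for n
    using from_nat_into[OF False] by (auto simp: F_def)
  have mono: "incseq (\<lambda>n. \<Union>i\<in>F n. E i)"
    unfolding incseq_def F_def by (intro allI impI UN_mono) auto
  have "(\<Union>n. \<Union>i\<in>F n. E i) = (\<Union>i\<in>I. E i)"
  proof -
    have "i \<in> F (Suc (to_nat_on I i))" if "i \<in> I" for i
      using that from_nat_into_to_nat_on[OF I that] by (auto simp: F_def intro!: image_eqI[where x = "to_nat_on I i"])
    then show ?thesis using F(2) by blast
  qed
  moreover have "(\<lambda>n. measure M (\<Union>i\<in>F n. E i)) \<longlonglongrightarrow> measure M (\<Union>n. \<Union>i\<in>F n. E i)"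
    using E F mono by (intro finite_Lim_measure_incseq) (auto intro!: sets.finite_UN)
  moreover have "measure M (\<Union>i\<in>F n. E i) \<le> B" for n
  proof -
    have "measure M (\<Union>i\<in>F n. E i) \<le> (\<Sum>i\<in>F n. measure M (E i))"
      using E F by (intro finite_measure_subadditive_finite) auto
    then show ?thesis using B[OF F(1,2), of n] by linarith
  qed
  ultimately show ?thesis by (intro LIMSEQ_le_const2) auto
qed

text \<open>The sizes k are at most of order a^2, and (k!)^2 is at most exp(2 k^2); hence a^4 as the
  price of the union bound over all positions and sizes.\<close>

lemma capacity_event_upper:
  assumes d: "5 \<le> CARD('d::finite)"
  shows "\<exists>C>0. \<forall>a n m. 1 \<le> a \<longrightarrow> 0 < n \<longrightarrow> 0 < m \<longrightarrow>
    measure (pair_law :: ('d path \<times> _) measure)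
      (\<Union>A\<in>{A. finite A \<and> A \<noteq> {} \<and> real (card A) \<le> 2 * (green_L2 TYPE('d) * a)\<^sup>2 \<and> a \<le> capacity A}. inter_event n m A)
    \<le> (2 * real CARD('d) + 1) * exp (C * a ^ 4 - real (max n m) * a / 10)"
proof -
  define g where "g = green_L2 TYPE('d)"
  define \<Gamma> where "\<Gamma> = green_Lp TYPE('d)"
  define D where "D = 2 * real CARD('d) + 1"
  have g: "1 \<le> g" by (simp add: g_def green_L2_def)
  have \<Gamma>: "1 \<le> \<Gamma>" unfolding \<Gamma>_def by (rule green_Lp(1)[OF d])
  have D: "0 < D" by (simp add: D_def add_nonneg_pos)
  \<comment> \<open>With k0 at most 2 g^2 a^2, the 2 comes from the squared factorial, ln \<Gamma>
    from the power sums and 1 from the number of sizes; 4 g^4 a^4 bounds k0^2.\<close>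
  define C where "C = (3 + ln \<Gamma>) * (4 * g ^ 4)"
  have C: "0 < C" using \<Gamma> g by (simp add: C_def add_pos_nonneg)
  interpret prob_space "pair_law :: ('d path \<times> _) measure" by (rule prob_space_pair_law)
  have main: "prob (\<Union>A\<in>{A. finite A \<and> A \<noteq> {} \<and> real (card A) \<le> 2 * (g * a)\<^sup>2 \<and> a \<le> capacity A}. inter_event n m A)
    \<le> D * exp (C * a ^ 4 - real (max n m) * a / 10)" if a: "1 \<le> a" and nm: "0 < n" "0 < m" for a n m
  proof (rule measure_UN_le_sum)
    let ?I = "{A :: (int ^ 'd) set. finite A \<and> A \<noteq> {} \<and> real (card A) \<le> 2 * (g * a)\<^sup>2 \<and> a \<le> capacity A}"
    show "countable ?I"
      by (rule countable_subset[OF _ countable_Collect_finite]) auto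
    show "inter_event n m A \<in> events" for A :: "(int ^ 'd) set" by (rule sets_inter_event)
    define E where "E = D * exp (- (real (max n m) * a / 10))"
    define k0 where "k0 = nat \<lfloor>2 * (g * a)\<^sup>2\<rfloor>"
    have ga: "1 \<le> g * a" using g a by (simp add: mult_ge1_I)
    have k0: "real k0 \<le> 2 * (g * a)\<^sup>2" by (simp add: k0_def)
    have k01: "1 \<le> k0"
    proof -
      have "1 \<le> (g * a)\<^sup>2" using ga by (rule one_le_power)
      then have "1 \<le> \<lfloor>2 * (g * a)\<^sup>2\<rfloor>" by linarith
      then show ?thesis unfolding k0_def by linarith
    qed
    fix F assume F: "finite F" "F \<subseteq> ?I"
    have cF: "card A \<in> {..k0}" if "A \<in> F" for A
    proof -
      have "real (card A) \<le> 2 * (g * a)\<^sup>2" using F that by auto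
      then have "int (card A) \<le> \<lfloor>2 * (g * a)\<^sup>2\<rfloor>" by (simp add: le_floor_iff)
      then show ?thesis by (simp add: k0_def le_nat_iff)
    qed
    have "(\<Sum>A\<in>F. prob (inter_event n m A)) \<le> (\<Sum>A\<in>F. E * cover A 0 powr pexp)"
    proof (rule sum_mono)
      fix A assume "A \<in> F"
      then have A: "finite A" "A \<noteq> {}" "a \<le> capacity A" using F by auto
      show "prob (inter_event n m A) \<le> E * cover A 0 powr pexp"
        unfolding measure_inter_event E_def D_def by (rule lev_mult_le[OF A(1,2) nm A(3)])
    qed
    also have "\<dots> = E * (\<Sum>k\<le>k0. \<Sum>A\<in>{A\<in>F. card A = k}. cover A 0 powr pexp)"
      unfolding sum_distrib_left[symmetric] using F(1) cF by (subst sum.group) auto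
    also have "\<dots> \<le> E * (\<Sum>k\<le>k0. exp ((2 + ln \<Gamma>) * (real k0)\<^sup>2))"
    proof (intro mult_left_mono sum_mono)
      fix k assume k: "k \<in> {..k0}"
      have "(\<Sum>A\<in>{A\<in>F. card A = k}. cover A 0 powr pexp) \<le> (fact k)\<^sup>2 * \<Gamma> ^ k"
        unfolding \<Gamma>_def using F by (intro sum_cover_powr[OF d]) auto
      also have "\<dots> \<le> (exp ((real k0)\<^sup>2))\<^sup>2 * exp (ln \<Gamma> * (real k0)\<^sup>2)"
      proof (intro mult_mono power_mono)
        have "fact k \<le> real (k ^ k)" using fact_le_power[of k, where 'a = real] by simp
        also have "\<dots> \<le> exp (real k) ^ k"
        proof -
          have "real k \<le> exp (real k)" using exp_ge_add_one_self[of "real k"] by linarith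
          then show ?thesis by (simp add: power_mono)
        qed
        also have "\<dots> = exp ((real k)\<^sup>2)" by (simp add: exp_of_nat_mult[symmetric] power2_eq_square)
        also have "\<dots> \<le> exp ((real k0)\<^sup>2)" using k by simp
        finally show "fact k \<le> exp ((real k0)\<^sup>2)" .
        have "\<Gamma> ^ k = exp (ln \<Gamma> * real k)" using \<Gamma> by (simp add: exp_of_nat_mult mult.commute[of "ln \<Gamma>"])
        moreover have "real k \<le> (real k0)\<^sup>2"
        proof -
          have "real k \<le> real k0 * 1" using k by simp
          also have "\<dots> \<le> real k0 * real k0" using k01 by (intro mult_left_mono) auto
          finally show ?thesis by (simp add: power2_eq_square)
        qed
        ultimately show "\<Gamma> ^ k \<le> exp (ln \<Gamma> * (real k0)\<^sup>2)" using \<Gamma> by (simp add: mult_left_mono)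
      qed (use \<Gamma> in auto)
      also have "\<dots> = exp ((2 + ln \<Gamma>) * (real k0)\<^sup>2)"
        by (simp add: exp_of_nat_mult[symmetric] exp_add[symmetric] exp_double[symmetric] algebra_simps flip: exp_double)
      finally show "(\<Sum>A\<in>{A\<in>F. card A = k}. cover A 0 powr pexp) \<le> exp ((2 + ln \<Gamma>) * (real k0)\<^sup>2)" .
    qed (use D in \<open>simp add: E_def\<close>)
    also have "\<dots> = E * ((1 + real k0) * exp ((2 + ln \<Gamma>) * (real k0)\<^sup>2))" by simp
    also have "\<dots> \<le> E * exp (C * a ^ 4)"
    proof (intro mult_left_mono)
      have "1 + real k0 \<le> exp (real k0)" by (rule exp_ge_add_one_self)
      also have "\<dots> \<le> exp ((real k0)\<^sup>2)" using k01 by (simp add: power2_eq_square)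
      finally have "(1 + real k0) * exp ((2 + ln \<Gamma>) * (real k0)\<^sup>2) \<le> exp ((real k0)\<^sup>2) * exp ((2 + ln \<Gamma>) * (real k0)\<^sup>2)"
        by (rule mult_right_mono) simp
      also have "\<dots> = exp ((3 + ln \<Gamma>) * (real k0)\<^sup>2)" by (simp add: exp_add[symmetric] algebra_simps)
      also have "\<dots> \<le> exp ((3 + ln \<Gamma>) * (2 * (g * a)\<^sup>2)\<^sup>2)"
      proof -
        have "(real k0)\<^sup>2 \<le> (2 * (g * a)\<^sup>2)\<^sup>2" using k0 by (intro power_mono) auto
        then have "(3 + ln \<Gamma>) * (real k0)\<^sup>2 \<le> (3 + ln \<Gamma>) * (2 * (g * a)\<^sup>2)\<^sup>2"
          using \<Gamma> by (intro mult_left_mono) auto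
        then show ?thesis by (simp only: exp_le_cancel_iff)
      qed
      also have "(3 + ln \<Gamma>) * (2 * (g * a)\<^sup>2)\<^sup>2 = C * a ^ 4"
        by (simp add: C_def power_mult_distrib power_mult[symmetric])
      finally show "(1 + real k0) * exp ((2 + ln \<Gamma>) * (real k0)\<^sup>2) \<le> exp (C * a ^ 4)" .
    qed (use D in \<open>simp add: E_def\<close>)
    also have "\<dots> = D * exp (C * a ^ 4 - real (max n m) * a / 10)"
      by (simp add: E_def mult.assoc exp_add[symmetric])
    finally show "(\<Sum>A\<in>F. prob (inter_event n m A)) \<le> D * exp (C * a ^ 4 - real (max n m) * a / 10)" .
  qed
  show ?thesis using C main unfolding D_def g_def by blast
qed

text \<open>A point z lies in both level sets with probability at most the square of the Green
  function, which is summable, so Borel-Cantelli applies. On an infinite set \<open>card\<close>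
  would be 0, and containing a large set A would not force a large cardinality.\<close>

lemma AE_finite_inter:
  assumes d: "5 \<le> CARD('d::finite)" and nm: "0 < n" "0 < m"
  shows "AE (S, S') in (pair_law :: ('d path \<times> _) measure). finite (level_set S n \<inter> level_set S' m)"
proof -
  interpret prob_space "pair_law :: ('d path \<times> _) measure" by (rule prob_space_pair_law)
  have single: "lev {z} (\<lambda>_. k) 0 \<le> green 0 z" if "0 < k" for z :: "int ^ 'd" and k
  proof -
    have "lev {z} (\<lambda>_. k) 0 \<le> cover {z} 0" using that by (intro lev_le_cover) auto
    also have "\<dots> \<le> green 0 z * cover {} z" using cover_le_sum[OF d, of "{z}" 0] by simp
    also have "\<dots> \<le> green 0 z * 1"
      using green_nonneg[OF d, of 0 z] prob_space.prob_le_1[OF prob_space_walk_law[of z]]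
      by (intro mult_left_mono) (auto simp: cover_def)
    finally show ?thesis by simp
  qed
  \<comment> \<open>Enumerates the lattice: \<open>V k\<close> is empty or a single point, and the
    sets are disjoint, so no site is counted twice.\<close>
  define V :: "nat \<Rightarrow> (int ^ 'd) set" where "V k = {z. to_nat z = k}" for k
  define Z where "Z k = (\<Union>z\<in>V k. inter_event n m {z})" for k
  have Vc: "V k = {} \<or> V k = {from_nat k}" for k by (auto simp: V_def)
  have evZ: "Z k \<in> events" for k
    using Vc[of k] by (auto simp: Z_def sets_inter_event)
  have PZ: "prob (Z k) \<le> (\<Sum>z\<in>V k. (green 0 z)\<^sup>2)" for k
  proof (cases "V k = {}")
    case False
    then have "prob (Z k) = lev {from_nat k} (\<lambda>_. n) (0 :: int ^ 'd) * lev {from_nat k} (\<lambda>_. m) (0 :: int ^ 'd)"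
      using Vc[of k] by (auto simp: Z_def measure_inter_event)
    also have "\<dots> \<le> green 0 (from_nat k :: int ^ 'd) * green 0 (from_nat k :: int ^ 'd)"
      by (rule mult_mono[OF single[OF nm(1)] single[OF nm(2)] green_nonneg[OF d] lev_nonneg])
    finally show ?thesis using Vc[of k] False by (auto simp: power2_eq_square)
  qed (simp add: Z_def)
  have "summable (\<lambda>k. prob (Z k))"
  proof (rule summableI_nonneg_bounded)
    fix N
    have finV: "finite (\<Union>k<N. V k)" using Vc by (auto intro!: finite_UN_I) (metis finite.emptyI finite.insertI)
    have "(\<Sum>k<N. prob (Z k)) \<le> (\<Sum>k<N. \<Sum>z\<in>V k. (green 0 z)\<^sup>2)"
      by (intro sum_mono PZ)
    also have "\<dots> = (\<Sum>z\<in>(\<Union>k<N. V k). (green 0 z)\<^sup>2)"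
    proof (rule sum.UNION_disjoint[symmetric])
      show "\<forall>k\<in>{..<N}. finite (V k)" using Vc by (metis finite.emptyI finite.insertI)
    qed (auto simp: V_def)
    also have "\<dots> \<le> green_L2 TYPE('d)" by (rule sum_green_sq_le[OF d finV])
    finally show "(\<Sum>k<N. prob (Z k)) \<le> green_L2 TYPE('d)" .
  qed simp
  then have "AE \<omega> in pair_law. eventually (\<lambda>k. \<omega> \<in> space pair_law - Z k) sequentially"
    using evZ by (intro borel_cantelli_AE1) (auto simp: emeasure_eq_measure)
  then show ?thesis
  proof eventually_elim
    case (elim \<omega>)
    obtain S S' where \<omega>: "\<omega> = (S, S')" by (cases \<omega>)
    obtain N where N: "\<And>k. N \<le> k \<Longrightarrow> \<omega> \<notin> Z k" using elim by (auto simp: eventually_sequentially)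
    have "level_set S n \<inter> level_set S' m \<subseteq> from_nat ` {..<N}"
    proof
      fix z assume z: "z \<in> level_set S n \<inter> level_set S' m"
      then have "\<omega> \<in> Z (to_nat z)" by (auto simp: Z_def V_def inter_event_def \<omega>)
      then have "to_nat z < N" using N[of "to_nat z"] by (auto simp: not_le[symmetric])
      then show "z \<in> from_nat ` {..<N}" by (intro image_eqI[where x = "to_nat z"]) auto
    qed
    then show ?case unfolding \<omega> by (auto intro: finite_subset)
  qed
qed

text \<open>L > 0 rules out infinite intersections, whose \<open>card\<close> is 0, so the event is
  a union over the countably many finite values of the intersection.\<close>

lemma sets_card_inter:
  assumes "0 < L"
  shows "{(S, S'). L \<le> card (level_set S n \<inter> level_set S' m)} \<in> sets (pair_law :: ('d::finite path \<times> _) measure)"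
proof -
  let ?M = "pair_law :: ('d path \<times> _) measure"
  let ?I = "{A :: (int ^ 'd) set. finite A \<and> L \<le> card A}"
  define R where "R A = (\<Inter>z. if z \<in> A then inter_event n m {z} else space ?M - inter_event n m {z})" for A
  have sp: "space ?M = UNIV" by (simp add: space_pair_measure)
  have R: "R A = {(S, S'). level_set S n \<inter> level_set S' m = A}" for A
    by (auto simp: R_def inter_event_def sp split: if_splits)
  have "R A \<in> sets ?M" for A
    unfolding R_def using sets_inter_event by (intro sets.countable_INT') auto
  moreover have "countable ?I"
    by (rule countable_subset[OF _ countable_Collect_finite]) auto
  ultimately have "(\<Union>A\<in>?I. R A) \<in> sets ?M" by (intro sets.countable_UN') auto
  moreover have "(\<Union>A\<in>?I. R A) = {(S, S'). L \<le> card (level_set S n \<inter> level_set S' m)}"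
  proof -
    have "finite X" if "L \<le> card X" for X :: "(int ^ 'd) set"
      using that assms by (intro card_ge_0_finite) linarith
    then show ?thesis by (auto simp: R)
  qed
  ultimately show ?thesis by simp
qed

lemma card_event_lower:
  assumes d: "5 \<le> CARD('d::finite)" and nm: "0 < n" "0 < m" and L: "0 < L" "L \<le> card A"
  shows "lev A (\<lambda>_. n) 0 * lev A (\<lambda>_. m) (0 :: int ^ 'd) \<le>
    measure (pair_law :: ('d path \<times> _) measure) {(S, S'). L \<le> card (level_set S n \<inter> level_set S' m)}"
proof -
  interpret prob_space "pair_law :: ('d path \<times> _) measure" by (rule prob_space_pair_law)
  have "AE \<omega> in pair_law. \<omega> \<in> inter_event n m A \<longrightarrow> \<omega> \<in> {(S, S'). L \<le> card (level_set S n \<inter> level_set S' m)}"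
    using AE_finite_inter[OF d nm]
  proof eventually_elim
    case (elim \<omega>)
    then show ?case using L(2) by (auto simp: inter_event_def intro: order_trans[OF _ card_mono])
  qed
  then show ?thesis
    unfolding measure_inter_event[symmetric] using sets_card_inter[OF L(1)]
    by (intro finite_measure_mono_AE) auto
qed

text \<open>A set of large capacity may be too large for a union bound, but any subset of \<open>k\<close> points
  with \<open>k\<close> about \<open>a\<^sup>2\<close> already has capacity at least \<open>a\<close>.\<close>
lemma capacity_event_subset:
  fixes a :: real
  assumes d: "5 \<le> CARD('d::finite)" and a: "1 \<le> a"
  shows "{(S, S'). a \<le> capacity (level_set S n \<inter> level_set S' m)} \<subseteq>
    (\<Union>A\<in>{A :: (int ^ 'd) set. finite A \<and> A \<noteq> {} \<and> real (card A) \<le> 2 * (green_L2 TYPE('d) * a)\<^sup>2 \<and> a \<le> capacity A}. inter_event n m A)"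
proof safe
  fix S S' :: "'d path"
  let ?g = "green_L2 TYPE('d)"
  assume cap: "a \<le> capacity (level_set S n \<inter> level_set S' m)" (is "_ \<le> capacity ?I")
  have g: "1 \<le> ?g" by (simp add: green_L2_def)
  have ga: "1 \<le> ?g * a" using g a by (simp add: mult_ge1_I)
  \<comment> \<open>\<open>capacity\<close> is 0 on infinite sets, being a sum, and on the empty
    set, while a is at least 1.\<close>
  have fin: "finite ?I" and ne: "?I \<noteq> {}"
    using cap a by (auto simp: capacity_def intro: ccontr)
  have "\<exists>A\<subseteq>?I. A \<noteq> {} \<and> real (card A) \<le> 2 * (?g * a)\<^sup>2 \<and> a \<le> capacity A"
  proof (cases "real (card ?I) \<le> 2 * (?g * a)\<^sup>2")
    case True
    then show ?thesis using cap ne by blast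
  next
    case False
    define k where "k = nat \<lceil>(?g * a)\<^sup>2\<rceil>"
    have ga2: "1 \<le> (?g * a)\<^sup>2" using ga by (rule one_le_power)
    have k: "(?g * a)\<^sup>2 \<le> real k" "real k \<le> 2 * (?g * a)\<^sup>2"
    proof -
      show "(?g * a)\<^sup>2 \<le> real k" unfolding k_def by (rule real_nat_ceiling_ge)
      have "real k \<le> (?g * a)\<^sup>2 + 1" unfolding k_def using ga2 by linarith
      then show "real k \<le> 2 * (?g * a)\<^sup>2" using ga2 by linarith
    qed
    have "real k \<le> real (card ?I)" using k False by linarith
    then have "k \<le> card ?I" by simp
    then obtain A where A: "A \<subseteq> ?I" "card A = k" "finite A"
      by (rule obtain_subset_with_card_n)
    have "?g * a \<le> sqrt (real k)" using k(1) by (rule real_le_rsqrt)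
    also have "\<dots> \<le> ?g * capacity A" using capacity_lower[OF d A(3)] A(2) by simp
    finally have "a \<le> capacity A" using g by (subst (asm) mult_le_cancel_left_pos) auto
    moreover have "A \<noteq> {}" using A(2) k(1) ga2 by auto
    ultimately show ?thesis using A k(2) by blast
  qed
  then obtain A where A: "A \<subseteq> ?I" "A \<noteq> {}" "real (card A) \<le> 2 * (?g * a)\<^sup>2" "a \<le> capacity A" by blast
  have "finite A" using A(1) fin by (rule finite_subset)
  then show "(S, S') \<in> (\<Union>A\<in>{A :: (int ^ 'd) set. finite A \<and> A \<noteq> {} \<and> real (card A) \<le> 2 * (?g * a)\<^sup>2 \<and> a \<le> capacity A}. inter_event n m A)"
    using A by (intro UN_I[of A]) (auto simp: inter_event_def)
qed

section \<open>Comparison of the two exponential rates\<close>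

theorem corollary1p10:
  fixes n m :: "nat \<Rightarrow> nat" and \<epsilon> :: real
  assumes dim: "CARD('d::finite) \<ge> 5"
    and pos: "\<And>L. L \<ge> 1 \<Longrightarrow> n L > 0 \<and> m L > 0"
    and growth: "filterlim (\<lambda>L. real (max (n L) (m L)) / real L powr (real CARD('d) / 2))
                   at_top at_top"
    and eps: "\<epsilon> > 0"
  shows "(\<lambda>L. \<P>((S, S') in walk_law (0 :: int ^ 'd) \<Otimes>\<^sub>M walk_law (0 :: int ^ 'd).
             capacity (level_set S (n L) \<inter> level_set S' (m L))
               \<ge> real L powr (1 - 2 / real CARD('d) + \<epsilon>)
           \<bar> card (level_set S (n L) \<inter> level_set S' (m L)) \<ge> L)) \<longlonglongrightarrow> 0"
proof -
  let ?d = "CARD('d)" and ?M = "pair_law :: ('d path \<times> _) measure"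
  interpret prob_space ?M by (rule prob_space_pair_law)
  define \<delta> where "\<delta> = real ?d"
  have \<delta>: "5 \<le> \<delta>" using dim by (simp add: \<delta>_def)
  define D where "D = 2 * real ?d + 1"
  have D: "0 < D" by (simp add: D_def add_nonneg_pos)
  obtain C1 where C1: "0 < C1" and low': "\<forall>s N m. 2 \<le> s \<longrightarrow> 0 < m \<longrightarrow> m \<le> N \<longrightarrow>
      real s ^ (?d + 6) \<le> 2 ^ (?d + 6) * real N \<longrightarrow>
      exp (- (C1 * real N * real s ^ (?d - 2))) \<le> lev (odd_box s) (\<lambda>_. m) (0 :: int ^ 'd)"
    using lev_odd_box_exp[OF dim one_le_power[of 2]] by (metis one_le_numeral)
  note low = low'[rule_format]
  obtain C2 where C2: "0 < C2" and upp': "\<forall>a n m. 1 \<le> a \<longrightarrow> 0 < n \<longrightarrow> 0 < m \<longrightarrow>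
      measure ?M (\<Union>A\<in>{A. finite A \<and> A \<noteq> {} \<and> real (card A) \<le> 2 * (green_L2 TYPE('d) * a)\<^sup>2 \<and> a \<le> capacity A}. inter_event n m A)
      \<le> D * exp (C2 * a ^ 4 - real (max n m) * a / 10)"
    using capacity_event_upper[OF dim, folded D_def] by (elim exE conjE)
  note upp = upp'[rule_format]
  \<comment> \<open>A smaller exponent gives a larger event. The cap 1/10 keeps the entropy a^4 =
    L^(4(b+\<eta>)) below L^(d/2 + b).\<close>
  define \<eta> where "\<eta> = min \<epsilon> (1/10)"
  have \<eta>: "0 < \<eta>" "\<eta> \<le> \<epsilon>" "\<eta> \<le> 1/10" using eps by (auto simp: \<eta>_def)
  define b where "b = 1 - 2 / \<delta>"
  have b: "0 < b" "b < 1" using \<delta> by (auto simp: b_def field_simps)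
  \<comment> \<open>Total coefficient of N L^b to be beaten: both walks of the denominator and the
    entropy of the numerator.\<close>
  define C3 where "C3 = 2 * C1 * 2 ^ (?d - 2) + C2"
  define f where "f L = \<P>((S, S') in ?M. capacity (level_set S (n L) \<inter> level_set S' (m L)) \<ge> real L powr (b + \<epsilon>)
           \<bar> card (level_set S (n L) \<inter> level_set S' (m L)) \<ge> L)" for L
  have bound: "f L \<le> D * exp (- real L)"
    if L: "2 \<le> L" and N: "real L powr (\<delta> / 2) \<le> real (max (n L) (m L))" and big: "10 * (C3 + 1) \<le> real L powr \<eta>" for L
  proof -
    define N where "N = max (n L) (m L)"
    define x where "x = real L"
    define a where "a = x powr (b + \<eta>)"
    have nm: "0 < n L" "0 < m L" using pos[of L] L by auto
    have x: "2 \<le> x" using L by (simp add: x_def)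
    have Nx: "x powr (\<delta> / 2) \<le> real N" using N by (simp add: N_def x_def)
    have a1: "1 \<le> a" using x b \<eta> by (simp add: a_def ge_one_powr_ge_zero)
    let ?Q = "{(S, S'). L \<le> card (level_set S (n L) \<inter> level_set S' (m L))} :: ('d path \<times> 'd path) set"
    let ?P = "{(S, S'). real L powr (b + \<epsilon>) \<le> capacity (level_set S (n L) \<inter> level_set S' (m L)) \<and> L \<le> card (level_set S (n L) \<inter> level_set S' (m L))} :: ('d path \<times> 'd path) set"
    have f: "f L = prob ?P / prob ?Q"
      by (simp add: f_def cond_prob_def space_pair_measure case_prod_unfold)
    define U where "U = (\<Union>A\<in>{A :: (int ^ 'd) set. finite A \<and> A \<noteq> {} \<and> real (card A) \<le> 2 * (green_L2 TYPE('d) * a)\<^sup>2 \<and> a \<le> capacity A}. inter_event (n L) (m L) A)"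
    have U: "U \<in> events"
      unfolding U_def using sets_inter_event
      by (intro sets.countable_UN') (auto intro: countable_subset[OF _ countable_Collect_finite])
    have "a \<le> real L powr (b + \<epsilon>)"
      unfolding a_def x_def using L \<eta> by (intro powr_mono) auto
    then have "?P \<subseteq> U"
      using capacity_event_subset[OF dim a1, of "n L" "m L"] unfolding U_def by auto
    then have "prob ?P \<le> prob U" using U by (rule finite_measure_mono)
    also have "\<dots> \<le> D * exp (C2 * a ^ 4 - real N * a / 10)"
      unfolding U_def N_def by (rule upp[OF a1 nm])
    finally have P: "prob ?P \<le> D * exp (C2 * a ^ 4 - real N * a / 10)" .
    \<comment> \<open>Rounded up so that the cube has at least L points. The rounding at most
      doubles the value, hence the powers of 2 below.\<close>
    define s where "s = nat \<lceil>x powr (1 / \<delta>)\<rceil>"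
    have root: "1 < x powr (1 / \<delta>)" using x \<delta> by (simp add: gr_one_powr)
    have s_ge: "x powr (1 / \<delta>) \<le> real s" unfolding s_def by (rule real_nat_ceiling_ge)
    have s2: "2 \<le> s" using root s_ge by linarith
    have s_le: "real s \<le> 2 * x powr (1 / \<delta>)" unfolding s_def using root by linarith
    have pw: "(x powr (1 / \<delta>)) ^ k = x powr (real k / \<delta>)" for k
      using x by (simp add: powr_realpow[symmetric] powr_powr)
    have card: "L \<le> card (odd_box s :: (int ^ 'd) set)"
    proof -
      have "x = x powr (real ?d / \<delta>)" using x \<delta> by (simp add: \<delta>_def)
      also have "\<dots> = (x powr (1 / \<delta>)) ^ ?d" by (rule pw[symmetric])
      also have "\<dots> \<le> real s ^ ?d" using s_ge by (intro power_mono) auto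
      finally have "real L \<le> real (s ^ ?d)" by (simp add: x_def)
      then show ?thesis by (simp add: card_odd_box)
    qed
    have sN: "real s ^ (?d + 6) \<le> 2 ^ (?d + 6) * real N"
    proof -
      have "real s ^ (?d + 6) \<le> (2 * x powr (1 / \<delta>)) ^ (?d + 6)" using s_le by (intro power_mono) auto
      also have "\<dots> = 2 ^ (?d + 6) * x powr ((\<delta> + 6) / \<delta>)"
        using pw[of "?d + 6"] by (simp only: power_mult_distrib of_nat_add of_nat_numeral \<delta>_def)
      also have "\<dots> \<le> 2 ^ (?d + 6) * x powr (\<delta> / 2)"
      proof -
        have "5 * \<delta> \<le> \<delta> * \<delta>" using \<delta> by (intro mult_right_mono) auto
        moreover have "(\<delta> + 6) * 2 \<le> 5 * \<delta>" using \<delta> by simp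
        ultimately have "(\<delta> + 6) * 2 \<le> \<delta> * \<delta>" by (rule order_trans[rotated])
        then have "(\<delta> + 6) / \<delta> \<le> \<delta> / 2" using \<delta> by (simp add: field_simps)
        then show ?thesis using x by (intro mult_left_mono powr_mono) auto
      qed
      also have "\<dots> \<le> 2 ^ (?d + 6) * real N" using Nx by (intro mult_left_mono) auto
      finally show ?thesis .
    qed
    have sb: "real s ^ (?d - 2) \<le> 2 ^ (?d - 2) * x powr b"
    proof -
      have "real s ^ (?d - 2) \<le> (2 * x powr (1 / \<delta>)) ^ (?d - 2)" using s_le by (intro power_mono) auto
      also have "\<dots> = 2 ^ (?d - 2) * x powr (real (?d - 2) / \<delta>)" by (simp add: power_mult_distrib pw)
      also have "real (?d - 2) / \<delta> = b" using dim by (simp add: b_def \<delta>_def of_nat_diff field_simps)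
      finally show ?thesis .
    qed
    let ?e = "C1 * real N * real s ^ (?d - 2)"
    have "exp (- ?e) * exp (- ?e) \<le> lev (odd_box s) (\<lambda>_. n L) (0 :: int ^ 'd) * lev (odd_box s) (\<lambda>_. m L) (0 :: int ^ 'd)"
      using s2 nm sN by (intro mult_mono low lev_nonneg) (auto simp: N_def)
    also have "\<dots> \<le> prob ?Q" using L by (intro card_event_lower[OF dim nm _ card]) simp
    finally have "exp (- ?e + - ?e) \<le> prob ?Q" by (simp only: exp_add)
    then have Q: "exp (- (2 * ?e)) \<le> prob ?Q" by (simp only: mult_2 minus_add_distrib)
    have "2 * ?e \<le> 2 * C1 * 2 ^ (?d - 2) * (real N * x powr b)"
      using mult_left_mono[OF sb, of "2 * C1 * real N"] C1 by (simp add: mult_ac)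
    moreover have "C2 * a ^ 4 \<le> C2 * (real N * x powr b)"
    proof -
      have "a ^ 4 = x powr (4 * (b + \<eta>))" using x by (simp add: a_def powr_realpow[symmetric] powr_powr mult.commute)
      also have "\<dots> \<le> x powr (\<delta> / 2 + b)"
      proof (rule powr_mono)
        \<comment> \<open>Multiplied by 10 \<delta>, the inequality 3 - 6/\<delta> + 4/10 \<le>
          \<delta>/2 becomes 34 \<delta> - 60 \<le> 5 \<delta>^2; the product, nonnegative for
          \<delta> at least 5, yields it with 45 in place of 60.\<close>
        have "0 \<le> (\<delta> - 5) * (\<delta> - 9/5)" using \<delta> by (intro mult_nonneg_nonneg) auto
        moreover have "5 * ((\<delta> - 5) * (\<delta> - 9/5)) = 5 * \<delta> * \<delta> - 34 * \<delta> + 45"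
          by (simp add: field_simps)
        ultimately have "34 * \<delta> - 60 \<le> 5 * \<delta> * \<delta>" by linarith
        then have "3 - 6 / \<delta> + 4/10 \<le> \<delta> / 2" using \<delta> by (simp add: field_simps)
        then show "4 * (b + \<eta>) \<le> \<delta> / 2 + b" using \<eta> by (simp add: b_def)
      qed (use x in simp)
      also have "\<dots> = x powr (\<delta> / 2) * x powr b" by (simp add: powr_add)
      also have "\<dots> \<le> real N * x powr b" using Nx by (intro mult_right_mono) auto
      finally show ?thesis using C2 by (intro mult_left_mono) auto
    qed
    moreover have "real N * a / 10 = (real N * x powr b) * (x powr \<eta> / 10)"
      by (simp add: a_def powr_add)
    moreover have "(real N * x powr b) * (C3 + 1) \<le> (real N * x powr b) * (x powr \<eta> / 10)"
      using big by (intro mult_left_mono) (auto simp: x_def)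
    \<comment> \<open>The extra 1 in \<open>C3 + 1\<close> leaves a surplus N L^b in the exponent;
      being at least L, it makes the ratio at most D exp(-L).\<close>
    moreover have "x \<le> real N * x powr b"
    proof -
      have "x powr 1 \<le> x powr (\<delta> / 2)" using x \<delta> by (intro powr_mono) auto
      then have "x * 1 \<le> real N * x powr b"
        using x b Nx by (intro mult_mono ge_one_powr_ge_zero) auto
      then show ?thesis by simp
    qed
    moreover have "(real N * x powr b) * (C3 + 1) = 2 * C1 * 2 ^ (?d - 2) * (real N * x powr b) + C2 * (real N * x powr b) + real N * x powr b"
      by (simp add: C3_def algebra_simps)
    ultimately have "C2 * a ^ 4 - real N * a / 10 + 2 * ?e \<le> - x" by linarith
    then have ex: "exp (C2 * a ^ 4 - real N * a / 10) \<le> exp (- x) * exp (- (2 * ?e))"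
      by (simp add: exp_add[symmetric])
    have "f L \<le> (D * exp (C2 * a ^ 4 - real N * a / 10)) / exp (- (2 * ?e))"
      unfolding f using P Q D by (intro frac_le) auto
    also have "\<dots> \<le> (D * (exp (- x) * exp (- (2 * ?e)))) / exp (- (2 * ?e))"
      using ex D by (intro divide_right_mono mult_left_mono) auto
    finally show ?thesis by (simp add: x_def)
  qed
  have "eventually (\<lambda>L. f L \<le> D * exp (- real L)) sequentially"
  proof -
    have "eventually (\<lambda>L. 1 \<le> real (max (n L) (m L)) / real L powr (\<delta> / 2)) sequentially"
      using growth unfolding filterlim_at_top \<delta>_def by blast
    moreover have "filterlim (\<lambda>L. real L powr \<eta>) at_top sequentially"
      using \<eta> by real_asymp
    then have "eventually (\<lambda>L. 10 * (C3 + 1) \<le> real L powr \<eta>) sequentially"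
      unfolding filterlim_at_top by blast
    ultimately show ?thesis
      using eventually_ge_at_top[of 2]
    proof eventually_elim
      case (elim L)
      have "0 < real L powr (\<delta> / 2)" using elim(3) by simp
      then have "real L powr (\<delta> / 2) \<le> real (max (n L) (m L))"
        using elim(1) by (simp add: le_divide_eq)
      then show ?case by (rule bound[OF elim(3) _ elim(2)])
    qed
  qed
  moreover have "(\<lambda>L. D * exp (- real L)) \<longlonglongrightarrow> 0" by real_asymp
  moreover have "0 \<le> f L" for L by (simp add: f_def cond_prob_def)
  then have "eventually (\<lambda>L. 0 \<le> f L) sequentially" by (intro always_eventually allI)
  ultimately have "f \<longlonglongrightarrow> 0"
    using tendsto_sandwich[of "\<lambda>_. 0" f sequentially "\<lambda>L. D * exp (- real L)" 0] by simp
  then show ?thesis unfolding f_def b_def \<delta>_def .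
qed

end
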